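(* Let $\mathbf{X}\sim\mathcal{LMN}_{p,n;q}(\boldsymbol{\mu},\boldsymbol{\Sigma},\mathbf{B};f_{\boldsymbol{\nu}})$ with $\boldsymbol{\Sigma}$ positive definite, and let $p=p(n)$ satisfy $p/n=c+o(n^{-1/2})$ with $c\in[0,+\infty)$ as $n\to\infty$. Let $\mathbf{l}$ be a non-zero $p$-dimensional vector of constants. Assume that there are constants $m_1,M_1,M_2$, not depending on $p$, such that, with $(\lambda_i,\mathbf{u}_i)$, $i=1,\dots,p$, the eigenvalues and (orthonormal) eigenvectors of $\boldsymbol{\Sigma}$: (i) $0<m_1\le\lambda_1\le\lambda_2\le\dots\le\lambda_p\le M_1<\infty$ uniformly in $p$; (ii) $M_2<\infty$ and $|\mathbf{u}_i^\top\boldsymbol{\mu}|\le M_2$, $|\mathbf{u}_i^\top\mathbf{b}_j|\le M_2$ for all $i=1,\dots,p$, $j=1,\dots,q$, uniformly in $p$, where $\mathbf{b}_1,\dots,\mathbf{b}_q$ are the columns of $\mathbf{B}$; (iii) $|\mathbf{u}_i^\top\mathbf{l}|\le M_2$ for all $i=1,\dots,p$, uniformly in $p$. Then $$\sqrt{n}\,\sigma_{\boldsymbol{\nu}}^{-1}\left(\mathbf{l}^\top\mathbf{S}\overline{\mathbf{x}}-\mathbf{l}^\top\boldsymbol{\Sigma}\boldsymbol{\mu}_{\boldsymbol{\nu}}\right)\overset{\mathcal{D}}{\longrightarrow}\mathcal{N}(0,1)\quad\text{for } p/n\to c\in[0,+\infty)\text{ as } n\to\infty,$$ where $$\boldsymbol{\mu}_{\boldsymbol{\nu}}=\boldsymbol{\mu}+\mathbf{B}\boldsymbol{\nu},\qquad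 \sigma_{\boldsymbol{\nu}}^2=\left[\boldsymbol{\mu}_{\boldsymbol{\nu}}^\top\boldsymbol{\Sigma}\boldsymbol{\mu}_{\boldsymbol{\nu}}+c\,\frac{\mathrm{tr}(\boldsymbol{\Sigma}^2)}{p}\right]\mathbf{l}^\top\boldsymbol{\Sigma}\mathbf{l}+(\mathbf{l}^\top\boldsymbol{\Sigma}\boldsymbol{\mu}_{\boldsymbol{\nu}})^2+\mathbf{l}^\top\boldsymbol{\Sigma}^3\mathbf{l}.$$
   Context: $\mathbf{X}=(\mathbf{x}_1,\dots,\mathbf{x}_n)\sim\mathcal{LMN}_{p,n;q}(\boldsymbol{\mu},\boldsymbol{\Sigma},\mathbf{B};f_{\boldsymbol{\nu}})$ (matrix-variate location mixture of normal distributions) means that the $p\times n$ random matrix $\mathbf{X}$ has the stochastic representation $\mathbf{X}\stackrel{d}{=}\mathbf{Y}+\mathbf{B}\boldsymbol{\nu}\mathbf{1}_n^\top$, where $\mathbf{Y}\sim\mathcal{N}_{p,n}(\boldsymbol{\mu}\mathbf{1}_n^\top,\boldsymbol{\Sigma}\otimes\mathbf{I}_n)$ (i.e. the columns of $\mathbf{Y}$ are i.i.d. $\mathcal{N}_p(\boldsymbol{\mu},\boldsymbol{\Sigma})$), $\boldsymbol{\nu}$ is a $q$-dimensional random vector with continuous density function $f_{\boldsymbol{\nu}}$, $\mathbf{B}$ is a $p\times q$ matrix of constants, $\mathbf{Y}$ and $\boldsymbol{\nu}$ are independent, and $\mathbf{1}_n$ is the $n$-vector of ones. The vector $\boldsymbol{\nu}$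 in the claim is the one in this representation (so one takes $\mathbf{X}=\mathbf{Y}+\mathbf{B}\boldsymbol{\nu}\mathbf{1}_n^\top$). The sample mean and sample covariance matrix are $\overline{\mathbf{x}}=\frac1n\sum_{i=1}^n\mathbf{x}_i$ and $\mathbf{S}=\frac{1}{n-1}\sum_{i=1}^n(\mathbf{x}_i-\overline{\mathbf{x}})(\mathbf{x}_i-\overline{\mathbf{x}})^\top$. The dimension $q$ and the density $f_{\boldsymbol{\nu}}$ are fixed, independent of $p$ and $n$; $\boldsymbol{\mu},\boldsymbol{\Sigma},\mathbf{B},\mathbf{l}$ depend on $p$. The dimension $p$ may exceed $n-1$ (then $\mathbf{S}$ is singular). *)

theory Defs
  imports
    "HOL-Probability.Probability"
    "HOL-Library.Landau_Symbols"
    "Jordan_Normal_Form.Char_Poly"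
    "Jordan_Normal_Form.Gauss_Jordan_Elimination"
begin

(* Dimensions vary with the sample size, so vectors and matrices are those of Jordan_Normal_Form. *)
unbundle no inner_syntax and no vec_syntax
hide_type (open) Finite_Cartesian_Product.vec
hide_const (open) Finite_Cartesian_Product.vec Determinants.det

text \<open>Lebesgue measure (and hence the Borel sigma-algebra) on the carriers of d-vectors and of
  r-by-c matrices, transported from the product measure along the bijections that send an
  extensional coefficient function to the vector or matrix with these entries.\<close>

definition lborel_vec :: "nat \<Rightarrow> real vec measure" where
  "lborel_vec d = embed_measure (PiM {..<d} (\<lambda>_. lborel)) (vec d)"

definition lborel_mat :: "nat \<Rightarrow> nat \<Rightarrow> real mat measure" where
  "lborel_mat r c = embed_measure (PiM ({..<r} \<times> {..<c}) (\<lambda>_. lborel)) (mat r c)"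

lemma inj_on_vec: "inj_on (vec d) (PiE {..<d} (\<lambda>_. UNIV :: real set))"
proof (rule inj_onI)
  fix f g :: "nat \<Rightarrow> real"
  assume fg: "f \<in> PiE {..<d} (\<lambda>_. UNIV)" "g \<in> PiE {..<d} (\<lambda>_. UNIV)" and eq: "vec d f = vec d g"
  have "f i = g i" if "i < d" for i
    using arg_cong[OF eq, of "\<lambda>v. vec_index v i"] that by simp
  with fg show "f = g"
    by (intro PiE_ext[of f "{..<d}" "\<lambda>_. UNIV" g]) auto
qed

lemma inj_on_mat: "inj_on (mat r c) (PiE ({..<r} \<times> {..<c}) (\<lambda>_. UNIV :: real set))"
proof (rule inj_onI)
  fix f g :: "nat \<times> nat \<Rightarrow> real"
  assume fg: "f \<in> PiE ({..<r} \<times> {..<c}) (\<lambda>_. UNIV)" "g \<in> PiE ({..<r} \<times> {..<c}) (\<lambda>_. UNIV)"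
    and eq: "mat r c f = mat r c g"
  have "f ij = g ij" if "ij \<in> {..<r} \<times> {..<c}" for ij
    using arg_cong[OF eq, of "\<lambda>A. A $$ ij"] that by (cases ij) simp
  with fg show "f = g"
    by (intro PiE_ext[of f "{..<r} \<times> {..<c}" "\<lambda>_. UNIV" g]) auto
qed

lemma space_lborel_vec: "space (lborel_vec d) = carrier_vec d"
proof -
  have "v \<in> vec d ` PiE {..<d} (\<lambda>_. UNIV)" if "v \<in> carrier_vec d" for v :: "real vec"
    using that by (intro image_eqI[of _ _ "restrict (vec_index v) {..<d}"]) auto
  then show ?thesis
    by (auto simp: lborel_vec_def space_embed_measure space_PiM)
qed

lemma space_lborel_mat: "space (lborel_mat r c) = carrier_mat r c"
proof -
  have "A \<in> mat r c ` PiE ({..<r} \<times> {..<c}) (\<lambda>_. UNIV)" if "A \<in> carrier_mat r c" for A :: "real mat"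
    using that
    by (intro image_eqI[of _ _ "restrict (\<lambda>ij. A $$ ij) ({..<r} \<times> {..<c})"]) auto
  then show ?thesis
    by (auto simp: lborel_mat_def space_embed_measure space_PiM)
qed

definition pos_def_mat :: "nat \<Rightarrow> real mat \<Rightarrow> bool" where
  "pos_def_mat d A \<longleftrightarrow> A \<in> carrier_mat d d \<and> transpose_mat A = A \<and>
     (\<forall>v\<in>carrier_vec d. v \<noteq> 0\<^sub>v d \<longrightarrow> 0 < v \<bullet> (A *\<^sub>v v))"

definition trace_mat :: "real mat \<Rightarrow> real" where
  "trace_mat A = (\<Sum>i<dim_row A. A $$ (i, i))"

definition orthonormal_eigensystem ::
    "nat \<Rightarrow> real mat \<Rightarrow> (nat \<Rightarrow> real) \<Rightarrow> (nat \<Rightarrow> real vec) \<Rightarrow> bool" where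
  "orthonormal_eigensystem d A lam u \<longleftrightarrow>
     (\<forall>i<d. eigenvector A (u i) (lam i)) \<and>
     (\<forall>i<d. \<forall>j<d. u i \<bullet> u j = (if i = j then 1 else 0))"

text \<open>Meant for positive definite Sig, where mat_inverse returns the inverse wrapped in Some.\<close>

definition mvn_density :: "real vec \<Rightarrow> real mat \<Rightarrow> real vec \<Rightarrow> real" where
  "mvn_density mu Sig x =
     exp (- ((x - mu) \<bullet> (the (mat_inverse Sig) *\<^sub>v (x - mu))) / 2) /
     sqrt ((2 * pi) ^ dim_vec mu * det Sig)"

definition iid_normal_columns ::
    "'w measure \<Rightarrow> nat \<Rightarrow> nat \<Rightarrow> real vec \<Rightarrow> real mat \<Rightarrow> ('w \<Rightarrow> real mat) \<Rightarrow> bool" where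
  "iid_normal_columns M p n mu Sig Y \<longleftrightarrow>
     Y \<in> measurable M (lborel_mat p n) \<and>
     prob_space.indep_vars M (\<lambda>_. lborel_vec p) (\<lambda>j \<omega>. col (Y \<omega>) j) {..<n} \<and>
     (\<forall>j<n. distributed M (lborel_vec p) (\<lambda>\<omega>. col (Y \<omega>) j)
        (\<lambda>x. ennreal (mvn_density mu Sig x)))"

text \<open>A continuous density on the space of q-vectors. The topology is that of the coefficients:
  on functions from the naturals to the reals it is the product topology, and a function of the
  first q coordinates only is continuous there iff it is continuous on q-space.\<close>

definition continuous_density :: "nat \<Rightarrow> (real vec \<Rightarrow> real) \<Rightarrow> bool" where
  "continuous_density q f \<longleftrightarrow>
     (\<forall>x\<in>carrier_vec q. 0 \<le> f x) \<and> continuous_on UNIV (\<lambda>x :: nat \<Rightarrow> real. f (vec q x))"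

text \<open>X follows the matrix-variate location mixture of normal distributions, with Y and nu the
  normal matrix and the mixing vector of the stochastic representation. Independence of Y and nu is
  that of their generated sigma-algebras, as indep_var needs both variables to have the same type.\<close>

definition LMN_representation ::
    "'w measure \<Rightarrow> nat \<Rightarrow> nat \<Rightarrow> nat \<Rightarrow> real vec \<Rightarrow> real mat \<Rightarrow> real mat \<Rightarrow> (real vec \<Rightarrow> real) \<Rightarrow>
     ('w \<Rightarrow> real mat) \<Rightarrow> ('w \<Rightarrow> real mat) \<Rightarrow> ('w \<Rightarrow> real vec) \<Rightarrow> bool" where
  "LMN_representation M p n q mu Sig B f X Y nu \<longleftrightarrow>
     prob_space M \<and>
     mu \<in> carrier_vec p \<and> Sig \<in> carrier_mat p p \<and> B \<in> carrier_mat p q \<and>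
     iid_normal_columns M p n mu Sig Y \<and>
     continuous_density q f \<and>
     distributed M (lborel_vec q) nu (\<lambda>x. ennreal (f x)) \<and>
     prob_space.indep_set M
       {Y -` A \<inter> space M |A. A \<in> sets (lborel_mat p n)}
       {nu -` A \<inter> space M |A. A \<in> sets (lborel_vec q)} \<and>
     (\<forall>\<omega>\<in>space M. X \<omega> = Y \<omega> + mat p n (\<lambda>(i, j). (B *\<^sub>v nu \<omega>) $ i))"

definition sample_mean :: "real mat \<Rightarrow> real vec" where
  "sample_mean X = vec (dim_row X) (\<lambda>k. (\<Sum>i<dim_col X. X $$ (k, i)) / real (dim_col X))"

definition sample_cov :: "real mat \<Rightarrow> real mat" where
  "sample_cov X = mat (dim_row X) (dim_row X) (\<lambda>(k, l).
     (\<Sum>i<dim_col X. (X $$ (k, i) - sample_mean X $ k) * (X $$ (l, i) - sample_mean X $ l))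
       / (real (dim_col X) - 1))"

definition LMN_mean :: "real vec \<Rightarrow> real mat \<Rightarrow> real vec \<Rightarrow> real vec" where
  "LMN_mean mu B v = mu + B *\<^sub>v v"

text \<open>The squared scale, with m in the role of the conditional mean vector.\<close>

definition LMN_var :: "real \<Rightarrow> nat \<Rightarrow> real mat \<Rightarrow> real vec \<Rightarrow> real vec \<Rightarrow> real" where
  "LMN_var c p Sig l m =
     (m \<bullet> (Sig *\<^sub>v m) + c * (trace_mat (Sig ^\<^sub>m 2) / real p)) * (l \<bullet> (Sig *\<^sub>v l))
       + (l \<bullet> (Sig *\<^sub>v m))\<^sup>2 + l \<bullet> ((Sig ^\<^sub>m 3) *\<^sub>v l)"

end

theory Submission
  imports Defs "HOL-Complex_Analysis.Conformal_Mappings" "HOL-Real_Asymp.Real_Asymp"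
begin

text \<open>
  The statistic is asymptotically standard normal even conditionally on the mixing vector, and
  uniformly in the conditional mean; this is what makes the mixing harmless.

  Fix \<open>\<nu>\<close> and put \<open>m = \<mu> + B \<nu>\<close>. A common shift of all columns leaves the sample covariance \<open>S\<close>
  unchanged, so \<open>S\<close> depends on the normal matrix \<open>Y\<close> alone. In the eigenbasis of \<open>\<Sigma>\<close> the standardised
  columns of \<open>Y\<close> form an array of independent standard normal variables, and rotating the
  sample index by an orthogonal matrix whose row 0 is constant keeps this so. Row 0 of the rotated
  array carries the sample mean, the rows \<open>1, ..., n - 1\<close> carry \<open>S\<close>. Up to the factor
  \<open>1 / (n - 1)\<close>, the form \<open>l \<bullet> S x\<close> with \<open>x\<close> the sample mean is therefore a sum of \<open>n - 1\<close> products of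
  two linear functionals of independent standard normal vectors, where the coefficients of the second
  functional depend on \<open>x\<close> (lemma \<open>statistic_eq\<close>).

  Given \<open>x\<close>, each product has mean \<open>l \<bullet> \<Sigma> x\<close> and variance
  \<open>V = (l \<bullet> \<Sigma> l) (x \<bullet> \<Sigma> x) + (l \<bullet> \<Sigma> x)\<^sup>2\<close>, and its third absolute central moment is at most a numerical
  constant times \<open>V\<close> to the power \<open>3/2\<close>. This gives a central limit theorem for the sum with an
  error that depends on the dimension and the parameters only through \<open>V\<close>. Two things
  remain. The conditional mean \<open>l \<bullet> \<Sigma> x\<close> is exactly normal around \<open>l \<bullet> \<Sigma> m\<close> and contributes the
  term \<open>l \<bullet> \<Sigma>\<^sup>3 l\<close> of the squared scale. And \<open>x \<bullet> \<Sigma> x\<close> concentrates at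
  \<open>m \<bullet> \<Sigma> m + tr \<Sigma>\<^sup>2 / n\<close>; measured in units of the squared scale, the deviation of \<open>V\<close> has
  expectation tending to 0 at a rate free of \<open>m\<close> and \<open>l\<close>, because \<open>l \<bullet> \<Sigma>\<^sup>3 l\<close> dominates a multiple of
  \<open>l \<bullet> \<Sigma> l\<close> (lemma \<open>expectation_V_close\<close>). The result is the bound \<open>char_T_bound\<close> between the
  characteristic function given \<open>\<nu>\<close> and \<open>exp (- t\<^sup>2 / 2)\<close>. It is integrated over the law of \<open>\<nu>\<close>, and
  the continuity theorem of Levy finishes the proof.

  The step from the normal density to independent standard normal variables rests on moment
  generating functions. Translation invariance of Lebesgue measure gives the moment generating
  function of the density (lemma \<open>mgf_mvn\<close>), and a random vector whose moment generating function is that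
  of independent standard normal variables consists of such variables.
\<close>

(* Vector and matrix notation refers throughout to vectors and matrices of variable dimension. *)
unbundle no inner_syntax and no vec_syntax
hide_type (open) Finite_Cartesian_Product.vec
hide_const (open) Finite_Cartesian_Product.vec Determinants.det

section \<open>Normal laws identified by moment generating functions\<close>

text \<open>A moment generating function that is finite everywhere extends to an entire function, given by
  the power series of the moments. This extension agrees with \<open>exp (z\<^sup>2 / 2)\<close> on the real line,
  hence everywhere; on the imaginary axis it is the characteristic function.\<close>

lemma std_normal_eqI_mgf:
  assumes "real_distribution \<mu>"
    and mgf: "\<And>t. (\<integral>\<^sup>+x. ennreal (exp (t * x)) \<partial>\<mu>) = ennreal (exp (t\<^sup>2 / 2))"
  shows "\<mu> = std_normal_distribution"
proof -
  interpret real_distribution \<mu> by fact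
  have int_exp: "integrable \<mu> (\<lambda>x. exp (t * x))" for t
    by (rule integrableI_nonneg) (simp_all add: mgf)
  have mgf_real: "(LINT x|\<mu>. exp (t * x)) = exp (t\<^sup>2 / 2)" for t
    by (simp add: integral_eq_nn_integral mgf)
  have int_abs: "integrable \<mu> (\<lambda>x. exp (r * \<bar>x\<bar>))" for r
  proof (rule Bochner_Integration.integrable_bound)
    show "integrable \<mu> (\<lambda>x. exp (r * x) + exp ((-r) * x))"
      by (intro Bochner_Integration.integrable_add int_exp)
    show "AE x in \<mu>. norm (exp (r * \<bar>x\<bar>)) \<le> norm (exp (r * x) + exp ((-r) * x))"
    proof (rule AE_I2)
      fix x
      have "0 < exp (r * x) + exp ((-r) * x)" by (intro add_pos_pos) auto
      then show "norm (exp (r * \<bar>x\<bar>)) \<le> norm (exp (r * x) + exp ((-r) * x))"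
        by (cases "x < 0") auto
    qed
  qed simp
  (* The entire extension of the moment generating function; a k are its Taylor coefficients. *)
  define F :: "complex \<Rightarrow> complex" where "F z = (LINT x|\<mu>. exp (z * of_real x))" for z
  define a where "a k = complex_of_real (LINT x|\<mu>. x ^ k / fact k)" for k :: nat
  have pow_le: "\<bar>r * x\<bar> ^ k / fact k \<le> exp (\<bar>r\<bar> * \<bar>x\<bar>)" for r x :: real and k :: nat
  proof -
    have "(\<Sum>i\<in>{k}. (\<bar>r\<bar> * \<bar>x\<bar>) ^ i /\<^sub>R fact i) \<le> (\<Sum>i. (\<bar>r\<bar> * \<bar>x\<bar>) ^ i /\<^sub>R fact i)"
      by (rule sum_le_suminf[OF summable_exp_generic]) auto
    then show ?thesis by (simp add: exp_def abs_mult divide_inverse mult.commute)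
  qed
  have int_pow: "integrable \<mu> (\<lambda>x. x ^ k / fact k)" for k :: nat
    by (rule Bochner_Integration.integrable_bound[OF int_abs[of 1]])
       (use pow_le[of 1 _ k] in \<open>auto simp: power_abs\<close>)
  have F_sums: "(\<lambda>k. a k * (z - 0) ^ k) sums F z" for z
  proof -
    let ?g = "\<lambda>k x. z ^ k * of_real (x ^ k / fact k)"
    have g_int: "integrable \<mu> (?g k)" for k
      by (intro integrable_mult_right integrable_of_real int_pow)
    have norm_g: "norm (?g k x) = (norm z * \<bar>x\<bar>) ^ k / fact k" for k x
      by (simp add: norm_mult norm_power norm_divide power_mult_distrib)
    have norm_sums: "(\<lambda>k. norm (?g k x)) sums exp (norm z * \<bar>x\<bar>)" for x
      using exp_converges[of "norm z * \<bar>x\<bar>"] by (simp only: norm_g) (simp add: divide_inverse mult.commute)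
    have "(\<lambda>k. integral\<^sup>L \<mu> (?g k)) sums (LINT x|\<mu>. (\<Sum>k. ?g k x))"
    proof (rule sums_integral)
      show "AE x in \<mu>. summable (\<lambda>k. norm (?g k x))"
        using norm_sums by (auto simp: sums_iff)
      show "summable (\<lambda>k. LINT x|\<mu>. norm (?g k x))"
      proof (rule summableI_nonneg_bounded[where x="LINT x|\<mu>. exp (norm z * \<bar>x\<bar>)"])
        fix n
        have "(\<Sum>k<n. LINT x|\<mu>. norm (?g k x)) = (LINT x|\<mu>. (\<Sum>k<n. norm (?g k x)))"
          by (rule Bochner_Integration.integral_sum[symmetric]) (use g_int in auto)
        also have "\<dots> \<le> (LINT x|\<mu>. exp (norm z * \<bar>x\<bar>))"
        proof (rule integral_mono)
          show "(\<Sum>k<n. norm (?g k x)) \<le> exp (norm z * \<bar>x\<bar>)" for x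
            using sum_le_suminf[of "\<lambda>k. norm (?g k x)" "{..<n}"] norm_sums[of x] unfolding sums_iff by simp
          show "integrable \<mu> (\<lambda>x. (\<Sum>k<n. norm (?g k x)))"
            by (intro Bochner_Integration.integrable_sum integrable_norm g_int)
        qed (rule int_abs)
        finally show "(\<Sum>k<n. LINT x|\<mu>. norm (?g k x)) \<le> (LINT x|\<mu>. exp (norm z * \<bar>x\<bar>))" .
      qed simp
    qed (rule g_int)
    moreover have "(\<Sum>k. ?g k x) = exp (z * of_real x)" for x
      using exp_converges[of "z * of_real x"]
      by (simp add: sums_iff scaleR_conv_of_real divide_inverse mult_ac power_mult_distrib)
    moreover have "integral\<^sup>L \<mu> (?g k) = a k * z ^ k" for k
      unfolding a_def by (simp only: integral_mult_right_zero integral_complex_of_real mult.commute)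
    ultimately show ?thesis by (simp add: F_def)
  qed
  have F_holo: "F holomorphic_on UNIV"
  proof -
    have "F holomorphic_on ball 0 r" for r
      using power_series_holomorphic[of 0 r a F] F_sums by blast
    then have "F field_differentiable (at z)" for z
      by (rule holomorphic_on_imp_differentiable_at[of _ "ball 0 (norm z + 1)"]) auto
    then show ?thesis
      by (simp add: holomorphic_on_def)
  qed
  have F_exp: "F z = exp (z\<^sup>2 / 2)" for z
  proof -
    have "F z - exp (z\<^sup>2 / 2) = 0"
    proof (rule analytic_continuation[of "\<lambda>z. F z - exp (z\<^sup>2 / 2)" UNIV "\<real>" 0])
      show "(\<lambda>z. F z - exp (z\<^sup>2 / 2)) holomorphic_on UNIV"
        by (intro holomorphic_intros F_holo) auto
      show "(0::complex) islimpt \<real>"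
      proof (rule islimptI)
        fix T :: "complex set" assume "0 \<in> T" "open T"
        then obtain e where e: "e > 0" "ball 0 e \<subseteq> T" by (meson openE)
        then have "complex_of_real (e / 2) \<in> T" by (auto simp: subset_iff)
        then show "\<exists>y\<in>\<real>. y \<in> T \<and> y \<noteq> 0" using e by (intro bexI[of _ "complex_of_real (e / 2)"]) auto
      qed
      fix w :: complex assume "w \<in> \<real>"
      then obtain t where t: "w = of_real t" by (auto elim: Reals_cases)
      have "F w = (LINT x|\<mu>. complex_of_real (exp (t * x)))"
        unfolding F_def t by (simp add: exp_of_real[symmetric])
      also have "\<dots> = of_real (exp (t\<^sup>2 / 2))"
        using mgf_real[of t] by (simp only: integral_complex_of_real)
      finally show "F w - exp (w\<^sup>2 / 2) = 0"
        by (simp add: t exp_of_real[symmetric])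
    qed auto
    then show ?thesis by simp
  qed
  show ?thesis
  proof (rule Levy_uniqueness)
    show "char \<mu> = char std_normal_distribution"
    proof
      fix t
      have "char \<mu> t = F (\<i> * t)" by (simp add: char_def F_def mult_ac)
      then show "char \<mu> t = char std_normal_distribution t"
        by (simp add: F_exp char_std_normal_distribution power_mult_distrib exp_of_real[symmetric])
    qed
  qed (fact assms real_dist_normal_dist)+
qed

text \<open>The coordinates are handled one at a time: an exponential factor \<open>exp (s i * h i)\<close> under the
  integral is traded for the indicator of an event \<open>h i \<in> A i\<close>. With the remaining factors
  absorbed into a change of measure, the hypothesis says that \<open>h i\<close> has the moment generating
  function of a standard normal variable under the new measure. All weights are nonnegative, so
  everything stays in nonnegative integrals.\<close>

lemma (in prob_space) iid_std_normal_if_mgf: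
  fixes h :: "'i \<Rightarrow> 'a \<Rightarrow> real"
  assumes I: "finite I"
    and h[measurable]: "\<And>i. i \<in> I \<Longrightarrow> h i \<in> borel_measurable M"
    and mgf: "\<And>s. (\<integral>\<^sup>+\<omega>. ennreal (exp (\<Sum>i\<in>I. s i * h i \<omega>)) \<partial>M) = ennreal (exp ((\<Sum>i\<in>I. (s i)\<^sup>2) / 2))"
  shows "distr M (PiM I (\<lambda>_. borel)) (\<lambda>\<omega>. \<lambda>i\<in>I. h i \<omega>) = PiM I (\<lambda>_. std_normal_distribution)"
proof -
  interpret N: prob_space std_normal_distribution by (rule prob_space_normal_density) simp
  interpret PN: product_sigma_finite "\<lambda>_::'i. std_normal_distribution" ..
  (* Coordinates in J carry indicators, the others still carry exponentials. *)
  have tilt: "(\<integral>\<^sup>+\<omega>. (\<Prod>j\<in>J. indicator (A j) (h j \<omega>)) * ennreal (exp (\<Sum>i\<in>I-J. s i * h i \<omega>)) \<partial>M)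
      = (\<Prod>j\<in>J. emeasure std_normal_distribution (A j)) * ennreal (exp ((\<Sum>i\<in>I-J. (s i)\<^sup>2) / 2))"
    if "J \<subseteq> I" "\<And>j. j \<in> J \<Longrightarrow> A j \<in> sets borel" for J A s
    using finite_subset[OF that(1) I] that
  proof (induction J arbitrary: s)
    case empty
    then show ?case using mgf by simp
  next
    case (insert j J)
    note [measurable] = insert.prems(2)
    have Im[simp]: "j \<in> I" "J \<subseteq> I" and [simp]: "finite J" "finite I" using insert I by auto
    have hJ[measurable]: "\<And>i. i \<in> J \<Longrightarrow> h i \<in> borel_measurable M" using h Im by blast
    have split: "(\<Sum>i\<in>I-J. g i) = g j + (\<Sum>i\<in>I-insert j J. g i)" for g :: "'i \<Rightarrow> real"
      using insert(2) by (subst sum.remove[of _ j]) (auto intro!: sum.cong)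
    (* D is the weight without its factor at j, and d is its total mass. *)
    define D where "D \<omega> = (\<Prod>j\<in>J. indicator (A j) (h j \<omega>)) * ennreal (exp (\<Sum>i\<in>I-insert j J. s i * h i \<omega>))" for \<omega>
    have [measurable]: "D \<in> borel_measurable M"
    proof -
      have "(\<lambda>\<omega>. indicator (A i) (h i \<omega>) :: ennreal) \<in> borel_measurable M" if "i \<in> J" for i
        using measurable_compose[OF hJ[OF that] borel_measurable_indicator] insert.prems(2)[of i] that by simp
      moreover have "(\<lambda>\<omega>. \<Sum>i\<in>I-insert j J. s i * h i \<omega>) \<in> borel_measurable M"
        using h by (intro borel_measurable_sum borel_measurable_times) auto
      ultimately show ?thesis unfolding D_def
        by (intro borel_measurable_times_ennreal borel_measurable_prod_ennreal measurable_compose[OF _ measurable_ennreal]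
          measurable_compose[OF _ borel_measurable_exp]) auto
    qed
    define d where "d = (\<Prod>j\<in>J. emeasure std_normal_distribution (A j)) * ennreal (exp ((\<Sum>i\<in>I-insert j J. (s i)\<^sup>2) / 2))"
    have d_fin: "d < \<top>" unfolding d_def
      by (simp add: N.emeasure_eq_measure prod_ennreal ennreal_mult_less_top)
    have Dt: "(\<integral>\<^sup>+\<omega>. D \<omega> * ennreal (exp (t * h j \<omega>)) \<partial>M) = d * ennreal (exp (t\<^sup>2 / 2))" for t
    proof -
      have "(\<integral>\<^sup>+\<omega>. D \<omega> * ennreal (exp (t * h j \<omega>)) \<partial>M) =
        (\<integral>\<^sup>+\<omega>. (\<Prod>j\<in>J. indicator (A j) (h j \<omega>)) * ennreal (exp (\<Sum>i\<in>I-J. (s(j:=t)) i * h i \<omega>)) \<partial>M)"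
        unfolding D_def by (intro nn_integral_cong, subst split)
          (auto simp: exp_add ennreal_mult' mult_ac intro!: arg_cong2[where f="(*)"] sum.cong)
      also have "\<dots> = (\<Prod>j\<in>J. emeasure std_normal_distribution (A j)) * ennreal (exp ((\<Sum>i\<in>I-J. ((s(j:=t)) i)\<^sup>2) / 2))"
        using insert by auto
      also have "\<dots> = d * ennreal (exp (t\<^sup>2 / 2))"
        unfolding d_def by (subst split)
          (auto simp: exp_add add_divide_distrib ennreal_mult' mult_ac intro!: arg_cong2[where f="(*)"] sum.cong)
      finally show ?thesis .
    qed
    have D0: "(\<integral>\<^sup>+\<omega>. D \<omega> \<partial>M) = d" using Dt[of 0] by simp
    have "(\<integral>\<^sup>+\<omega>. D \<omega> * indicator (A j) (h j \<omega>) \<partial>M) = d * emeasure std_normal_distribution (A j)"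
    (* A vanishing total mass cannot be normalised, but then the weight vanishes almost everywhere. *)
    proof (cases "d = 0")
      case True
      then have "AE \<omega> in M. D \<omega> = 0" using D0 True nn_integral_0_iff_AE[of D M] by simp
      then have "(\<integral>\<^sup>+\<omega>. D \<omega> * indicator (A j) (h j \<omega>) \<partial>M) = (\<integral>\<^sup>+\<omega>. 0 \<partial>M)"
        by (intro nn_integral_cong_AE) (auto elim!: eventually_mono)
      then show ?thesis using True by simp
    next
      case False
      define P where "P = density M (\<lambda>\<omega>. D \<omega> / d)"
      have d': "x * d / d = x" for x using False d_fin
        by (simp add: ennreal_times_divide[symmetric] ennreal_divide_self)
      have P: "prob_space P"
        unfolding P_def using False d_fin
        by (intro prob_spaceI) (simp add: emeasure_density nn_integral_divide D0)
      have hP[measurable]: "h j \<in> borel_measurable P" by (simp add: P_def)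
      have "distr P borel (h j) = std_normal_distribution"
      proof (rule std_normal_eqI_mgf)
        show "real_distribution (distr P borel (h j))"
          by (simp add: P prob_space.real_distribution_distr)
        show "(\<integral>\<^sup>+x. ennreal (exp (t * x)) \<partial>distr P borel (h j)) = ennreal (exp (t\<^sup>2 / 2))" for t
        proof -
          have "(\<integral>\<^sup>+x. ennreal (exp (t * x)) \<partial>distr P borel (h j)) = (\<integral>\<^sup>+\<omega>. (D \<omega> * ennreal (exp (t * h j \<omega>))) / d \<partial>M)"
            by (subst nn_integral_distr) (simp_all add: P_def nn_integral_density divide_ennreal_def mult_ac)
          also have "\<dots> = d * ennreal (exp (t\<^sup>2 / 2)) / d"
            by (simp add: nn_integral_divide Dt)
          finally show ?thesis by (simp only: mult.commute[of d] d')
        qed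
      qed
      then have "emeasure std_normal_distribution (A j) = emeasure (distr P borel (h j)) (A j)" by simp
      also have "\<dots> = (\<integral>\<^sup>+x. indicator (A j) x \<partial>distr P borel (h j))"
        by simp
      also have "\<dots> = (\<integral>\<^sup>+\<omega>. (D \<omega> * indicator (A j) (h j \<omega>)) / d \<partial>M)"
        by (subst nn_integral_distr) (simp_all add: P_def nn_integral_density divide_ennreal_def mult_ac)
      also have "\<dots> = (\<integral>\<^sup>+\<omega>. D \<omega> * indicator (A j) (h j \<omega>) \<partial>M) / d"
        by (rule nn_integral_divide) simp
      finally have N_eq: "emeasure std_normal_distribution (A j) = (\<integral>\<^sup>+\<omega>. D \<omega> * indicator (A j) (h j \<omega>) \<partial>M) / d" .
      show ?thesis using False d_fin
        by (simp only: N_eq mult.commute[of d] ennreal_divide_times) (simp add: ennreal_divide_self)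
    qed
    then show ?case
      using insert(1,2) by (simp add: D_def d_def mult_ac)
  qed
  show ?thesis
  proof (rule PN.PiM_eqI)
    show "sets (distr M (PiM I (\<lambda>_. borel)) (\<lambda>\<omega>. \<lambda>i\<in>I. h i \<omega>)) = sets (PiM I (\<lambda>_. std_normal_distribution))"
      by (simp cong: sets_PiM_cong)
    fix A assume A: "\<And>i. i \<in> I \<Longrightarrow> A i \<in> sets std_normal_distribution"
    then have A'[measurable]: "\<And>i. i \<in> I \<Longrightarrow> A i \<in> sets borel" by simp
    have "emeasure (distr M (PiM I (\<lambda>_. borel)) (\<lambda>\<omega>. \<lambda>i\<in>I. h i \<omega>)) (Pi\<^sub>E I A)
        = emeasure M {\<omega>\<in>space M. \<forall>i\<in>I. h i \<omega> \<in> A i}"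
      using I by (subst emeasure_distr) (auto intro!: arg_cong[where f="emeasure M"])
    also have "\<dots> = (\<integral>\<^sup>+\<omega>. indicator {\<omega>\<in>space M. \<forall>i\<in>I. h i \<omega> \<in> A i} \<omega> \<partial>M)"
      using I by (subst nn_integral_indicator) auto
    also have "\<dots> = (\<integral>\<^sup>+\<omega>. (\<Prod>j\<in>I. indicator (A j) (h j \<omega>)) \<partial>M)"
      using I by (intro nn_integral_cong) (auto simp: indicator_def prod_zero_iff split: if_splits)
    also have "\<dots> = (\<Prod>i\<in>I. emeasure std_normal_distribution (A i))"
      using tilt[of I A "\<lambda>_. 0"] A' by simp
    finally show "emeasure (distr M (PiM I (\<lambda>_. borel)) (\<lambda>\<omega>. \<lambda>i\<in>I. h i \<omega>)) (Pi\<^sub>E I A) = (\<Prod>i\<in>I. emeasure std_normal_distribution (A i))" .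
  qed (fact I)
qed

section \<open>The multivariate normal density\<close>

lemma PiM_lborel_translate:
  fixes v :: "'i \<Rightarrow> real"
  assumes I: "finite I"
  shows "distr (PiM I (\<lambda>_. lborel)) (PiM I (\<lambda>_. lborel)) (\<lambda>x. \<lambda>i\<in>I. v i + x i) = PiM I (\<lambda>_. lborel)"
proof -
  interpret product_sigma_finite "\<lambda>_::'i. lborel :: real measure" ..
  show ?thesis
  proof (rule PiM_eqI)
    fix A :: "'i \<Rightarrow> real set" assume A: "\<And>i. i \<in> I \<Longrightarrow> A i \<in> sets lborel"
    then have [measurable]: "\<And>i. i \<in> I \<Longrightarrow> A i \<in> sets borel" by simp
    have pre: "(\<lambda>x. v i + x) -` A i \<in> sets borel" if "i \<in> I" for i
      using measurable_sets[of "\<lambda>x. v i + x" borel borel "A i"] A[OF that] by simp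
    have tr: "emeasure lborel ((\<lambda>x. v i + x) -` A i) = emeasure lborel (A i)" if "i \<in> I" for i
    proof -
      have "emeasure lborel (A i) = emeasure (distr lborel borel ((+) (v i))) (A i)"
        by (simp add: lborel_distr_plus)
      also have "\<dots> = emeasure lborel ((\<lambda>x. v i + x) -` A i)"
        using A[OF that] by (subst emeasure_distr) auto
      finally show ?thesis by simp
    qed
    have "emeasure (distr (PiM I (\<lambda>_. lborel)) (PiM I (\<lambda>_. lborel)) (\<lambda>x. \<lambda>i\<in>I. v i + x i)) (Pi\<^sub>E I A)
       = emeasure (PiM I (\<lambda>_. lborel)) ((\<lambda>x. \<lambda>i\<in>I. v i + x i) -` Pi\<^sub>E I A \<inter> space (PiM I (\<lambda>_. lborel)))"
      using A I by (intro emeasure_distr sets_PiM_I_finite measurable_restrict) auto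
    also have "(\<lambda>x. \<lambda>i\<in>I. v i + x i) -` Pi\<^sub>E I A \<inter> space (PiM I (\<lambda>_. lborel)) = Pi\<^sub>E I (\<lambda>i. (\<lambda>x. v i + x) -` A i)"
      by (auto simp: space_PiM PiE_iff)
    also have "emeasure (PiM I (\<lambda>_. lborel)) \<dots> = (\<Prod>i\<in>I. emeasure lborel (A i))"
      using I pre tr by (subst emeasure_PiM) auto
    finally show "emeasure (distr (PiM I (\<lambda>_. lborel)) (PiM I (\<lambda>_. lborel)) (\<lambda>x. \<lambda>i\<in>I. v i + x i)) (Pi\<^sub>E I A) = (\<Prod>i\<in>I. emeasure lborel (A i))" .
  qed (use I in auto)
qed

lemma inj_on_vec_space: "inj_on (vec d) (space (PiM {..<d} (\<lambda>_. lborel :: real measure)))"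
  using inj_on_vec[of d] by (simp add: space_PiM)

lemma measurable_vec_lborel: "vec d \<in> measurable (PiM {..<d} (\<lambda>_. lborel)) (lborel_vec d)"
  unfolding lborel_vec_def by (rule measurable_embed_measure2'[OF inj_on_vec_space])

lemma measurable_vec_index [measurable]:
  assumes "i < d" shows "(\<lambda>x. x $ i) \<in> borel_measurable (lborel_vec d)"
  unfolding lborel_vec_def using assms by (intro measurable_embed_measure1) simp

lemma measurable_scalar_prod_lborel_vec:
  assumes "s \<in> carrier_vec d"
  shows "(\<lambda>x. s \<bullet> x) \<in> borel_measurable (lborel_vec d)"
proof -
  have "(\<lambda>x. \<Sum>i<d. s $ i * x $ i) \<in> borel_measurable (lborel_vec d)"
    by measurable
  then show ?thesis
    by (rule measurable_cong[THEN iffD1, rotated])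
      (auto simp: space_lborel_vec scalar_prod_def atLeast0LessThan)
qed

lemma measurable_lborel_vecI:
  assumes "\<And>i. i < d \<Longrightarrow> (\<lambda>\<omega>. h \<omega> $ i) \<in> borel_measurable M" "\<And>\<omega>. \<omega> \<in> space M \<Longrightarrow> h \<omega> \<in> carrier_vec d"
  shows "h \<in> measurable M (lborel_vec d)"
proof -
  have "(\<lambda>\<omega>. vec d (\<lambda>i\<in>{..<d}. h \<omega> $ i)) \<in> measurable M (lborel_vec d)"
    by (rule measurable_compose[OF _ measurable_vec_lborel]) (use assms(1) in \<open>auto intro!: measurable_restrict\<close>)
  moreover have "vec d (\<lambda>i\<in>{..<d}. h \<omega> $ i) = h \<omega>" if "\<omega> \<in> space M" for \<omega>
    using assms(2)[OF that] by (intro eq_vecI) auto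
  ultimately show ?thesis by (simp cong: measurable_cong)
qed

lemma measurable_minus_vec:
  assumes "v \<in> carrier_vec d"
  shows "(\<lambda>x. x - v) \<in> measurable (lborel_vec d) (lborel_vec d)"
proof (rule measurable_lborel_vecI)
  fix i assume i: "i < d"
  have "(\<lambda>x. x $ i - v $ i) \<in> borel_measurable (lborel_vec d)" using i by measurable
  then show "(\<lambda>x. (x - v) $ i) \<in> borel_measurable (lborel_vec d)"
    using i carrier_vecD[OF assms] by simp
qed (use assms in \<open>auto simp: space_lborel_vec\<close>)

lemma nn_integral_lborel_vec_translate:
  assumes v: "v \<in> carrier_vec d" and F[measurable]: "F \<in> borel_measurable (lborel_vec d)"
  shows "(\<integral>\<^sup>+x. F (x - v) \<partial>lborel_vec d) = (\<integral>\<^sup>+x. F x \<partial>lborel_vec d)"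
proof -
  let ?P = "PiM {..<d} (\<lambda>_. lborel :: real measure)"
  have shift: "(\<lambda>x. x - v) \<in> measurable (lborel_vec d) (lborel_vec d)"
    using v by (rule measurable_minus_vec)
  have Fv: "(\<lambda>x. F (vec d x)) \<in> borel_measurable ?P"
    by (rule measurable_compose[OF measurable_vec_lborel F])
  have "(\<integral>\<^sup>+x. F (x - v) \<partial>lborel_vec d) = (\<integral>\<^sup>+x. F (vec d x - v) \<partial>?P)"
    unfolding lborel_vec_def
    by (rule nn_integral_embed_measure'[OF inj_on_vec_space]) (use measurable_compose[OF shift F] in \<open>simp add: lborel_vec_def\<close>)
  also have "\<dots> = (\<integral>\<^sup>+x. F (vec d (\<lambda>i\<in>{..<d}. - (v $ i) + x i)) \<partial>?P)"
    using v by (intro nn_integral_cong arg_cong[where f=F] eq_vecI) auto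
  also have "\<dots> = (\<integral>\<^sup>+x. F (vec d x) \<partial>distr ?P ?P (\<lambda>x. \<lambda>i\<in>{..<d}. - (v $ i) + x i))"
    using Fv by (subst nn_integral_distr) auto
  also have "\<dots> = (\<integral>\<^sup>+x. F (vec d x) \<partial>?P)"
    by (simp only: PiM_lborel_translate finite_lessThan)
  also have "\<dots> = (\<integral>\<^sup>+x. F x \<partial>lborel_vec d)"
    unfolding lborel_vec_def
    by (rule nn_integral_embed_measure'[OF inj_on_vec_space, symmetric]) (use F in \<open>simp add: lborel_vec_def\<close>)
  finally show ?thesis .
qed

lemma pos_def_mat_inverse:
  assumes "pos_def_mat d S"
  defines "A \<equiv> the (mat_inverse S)"
  shows "A \<in> carrier_mat d d" "A * S = 1\<^sub>m d" "S * A = 1\<^sub>m d"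
proof -
  have S: "S \<in> carrier_mat d d" using assms by (simp add: pos_def_mat_def)
  have "det S \<noteq> 0"
  proof
    assume "det S = 0"
    then obtain v where v: "v \<in> carrier_vec d" "v \<noteq> 0\<^sub>v d" "S *\<^sub>v v = 0\<^sub>v d"
      using det_0_iff_vec_prod_zero_field[OF S] by auto
    then have "0 < v \<bullet> (S *\<^sub>v v)" using assms(1) unfolding pos_def_mat_def by blast
    then show False using v by simp
  qed
  then have "S \<in> Units (ring_mat TYPE(real) d ())" by (rule det_non_zero_imp_unit[OF S])
  then obtain C where C: "mat_inverse S = Some C" using mat_inverse(1)[OF S, where b="()"] by (cases "mat_inverse S") auto
  from mat_inverse(2)[OF S this] show "A \<in> carrier_mat d d" "A * S = 1\<^sub>m d" "S * A = 1\<^sub>m d"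
    by (auto simp: A_def C)
qed

text \<open>Completing the square, the tilt by \<open>exp (s \<bullet> (x - m))\<close> translates the density by
  \<open>S s\<close> and multiplies it by \<open>exp (s \<bullet> S s / 2)\<close>. Translation invariance then gives the integral, since
  the density has total mass 1.\<close>

lemma (in prob_space) mgf_mvn:
  assumes pd: "pos_def_mat d S" and m: "m \<in> carrier_vec d" and s: "s \<in> carrier_vec d"
    and X: "distributed M (lborel_vec d) X (\<lambda>x. ennreal (mvn_density m S x))"
  shows "(\<integral>\<^sup>+\<omega>. ennreal (exp (s \<bullet> (X \<omega> - m))) \<partial>M) = ennreal (exp (s \<bullet> (S *\<^sub>v s) / 2))"
proof -
  define A where "A = the (mat_inverse S)"
  note A = pos_def_mat_inverse[OF pd, folded A_def]
  have S: "S \<in> carrier_mat d d" and ST: "transpose_mat S = S" using pd by (auto simp: pos_def_mat_def)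
  define v where "v = S *\<^sub>v s"
  have v[simp]: "v \<in> carrier_vec d" using S s by (simp add: v_def)
  have dv: "dim_vec v = d" using v by (rule carrier_vecD)
  define c where "c = sqrt ((2 * pi) ^ d * det S)"
  have dens: "mvn_density m S x = exp (- ((x - m) \<bullet> (A *\<^sub>v (x - m))) / 2) / c" for x
    using m by (simp add: mvn_density_def A_def c_def)
  have fm[measurable]: "(\<lambda>x. ennreal (mvn_density m S x)) \<in> borel_measurable (lborel_vec d)"
    using X by (rule distributed_borel_measurable)
  have Xm[measurable]: "X \<in> measurable M (lborel_vec d)" using X by (rule distributed_measurable)
  have lin: "(\<lambda>x. s \<bullet> x - s \<bullet> m) \<in> borel_measurable (lborel_vec d)"
    using measurable_scalar_prod_lborel_vec[OF s] by simp
  have expm[measurable]: "(\<lambda>x. ennreal (exp (s \<bullet> x - s \<bullet> m))) \<in> borel_measurable (lborel_vec d)"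
    using measurable_compose[OF lin, of "\<lambda>t. ennreal (exp t)" borel] by simp
  have sx: "s \<bullet> (x - m) = s \<bullet> x - s \<bullet> m" if "x \<in> carrier_vec d" for x
    by (rule scalar_prod_minus_distrib) (use that s m in auto)
  have vA: "v \<bullet> (A *\<^sub>v y) = s \<bullet> y" if y: "y \<in> carrier_vec d" for y
  proof -
    have "v \<bullet> (A *\<^sub>v y) = (transpose_mat S *\<^sub>v s) \<bullet> (A *\<^sub>v y)" by (simp add: v_def ST)
    also have "\<dots> = s \<bullet> (S *\<^sub>v (A *\<^sub>v y))"
      using transpose_vec_mult_scalar[OF S _ s, of "A *\<^sub>v y"] A(1) y by simp
    also have "S *\<^sub>v (A *\<^sub>v y) = y"
      using assoc_mult_mat_vec[OF S A(1) y] A(3) y by simp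
    finally show ?thesis .
  qed
  have Av: "A *\<^sub>v v = s"
    unfolding v_def using assoc_mult_mat_vec[OF A(1) S s] A(2) s by simp
  have quad: "(y - v) \<bullet> (A *\<^sub>v (y - v)) = y \<bullet> (A *\<^sub>v y) - 2 * (s \<bullet> y) + s \<bullet> v"
    if y: "y \<in> carrier_vec d" for y
  proof -
    have Ay: "A *\<^sub>v y \<in> carrier_vec d" using A(1) y by simp
    have "(y - v) \<bullet> (A *\<^sub>v (y - v)) = (y - v) \<bullet> (A *\<^sub>v y - s)"
      using mult_minus_distrib_mat_vec[OF A(1) y v] Av by simp
    also have "\<dots> = (y \<bullet> (A *\<^sub>v y) - y \<bullet> s) - (v \<bullet> (A *\<^sub>v y) - v \<bullet> s)"
      using y Ay s by (subst minus_scalar_prod_distrib[of _ d]) (auto simp: scalar_prod_minus_distrib[of _ d])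
    also have "y \<bullet> s = s \<bullet> y" using y s by (rule comm_scalar_prod)
    also have "v \<bullet> s = s \<bullet> v" using v s by (rule comm_scalar_prod)
    finally show ?thesis using vA[OF y] by simp
  qed
  have shift: "mvn_density m S x * exp (s \<bullet> (x - m)) = exp (s \<bullet> v / 2) * mvn_density m S (x - v)"
    if x: "x \<in> carrier_vec d" for x
  proof -
    have "x - v - m = (x - m) - v" using x m by (intro eq_vecI) (auto simp: dv)
    then have Q: "(x - v - m) \<bullet> (A *\<^sub>v (x - v - m))
        = (x - m) \<bullet> (A *\<^sub>v (x - m)) - 2 * (s \<bullet> (x - m)) + s \<bullet> v"
      using quad[of "x - m"] x m by simp
    have "exp (- Q / 2) / c * exp L = exp (w / 2) * (exp (- (Q - 2 * L + w) / 2) / c)" for Q L w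
    proof -
      have "- Q / 2 + L = w / 2 + - (Q - 2 * L + w) / 2" by (simp add: field_simps)
      then have "exp (- Q / 2) * exp L = exp (w / 2) * exp (- (Q - 2 * L + w) / 2)"
        by (simp only: exp_add[symmetric])
      then show ?thesis by simp
    qed
    then show ?thesis by (simp only: dens Q)
  qed
  have "(\<integral>\<^sup>+\<omega>. ennreal (exp (s \<bullet> (X \<omega> - m))) \<partial>M) = (\<integral>\<^sup>+\<omega>. ennreal (exp (s \<bullet> X \<omega> - s \<bullet> m)) \<partial>M)"
    using measurable_space[OF Xm] by (intro nn_integral_cong) (simp add: sx space_lborel_vec)
  also have "\<dots> = (\<integral>\<^sup>+x. ennreal (mvn_density m S x) * ennreal (exp (s \<bullet> x - s \<bullet> m)) \<partial>lborel_vec d)"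
    by (rule distributed_nn_integral[OF X, symmetric]) (rule expm)
  also have "\<dots> = (\<integral>\<^sup>+x. ennreal (exp (s \<bullet> v / 2)) * ennreal (mvn_density m S (x - v)) \<partial>lborel_vec d)"
    using shift by (intro nn_integral_cong) (simp add: space_lborel_vec sx ennreal_mult''[symmetric] ennreal_mult'[symmetric])
  also have "\<dots> = ennreal (exp (s \<bullet> v / 2)) * (\<integral>\<^sup>+x. ennreal (mvn_density m S (x - v)) \<partial>lborel_vec d)"
  proof (rule nn_integral_cmult)
    have "(\<lambda>x. x - v) \<in> measurable (lborel_vec d) (lborel_vec d)"
      using v by (rule measurable_minus_vec)
    then show "(\<lambda>x. ennreal (mvn_density m S (x - v))) \<in> borel_measurable (lborel_vec d)"
      using fm by (rule measurable_compose)
  qed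
  also have "(\<integral>\<^sup>+x. ennreal (mvn_density m S (x - v)) \<partial>lborel_vec d) = (\<integral>\<^sup>+x. ennreal (mvn_density m S x) \<partial>lborel_vec d)"
    by (rule nn_integral_lborel_vec_translate) simp_all
  also have "\<dots> = (\<integral>\<^sup>+\<omega>. 1 \<partial>M)"
    using distributed_nn_integral[OF X, of "\<lambda>_. 1"] by simp
  finally show ?thesis by (simp add: v_def emeasure_space_1)
qed

section \<open>Rotating the sample index\<close>

text \<open>The reflection that exchanges the first unit vector with the normalised all-ones vector. It
  reflects in the hyperplane orthogonal to the difference \<open>v\<close> of these two unit vectors, and
  \<open>1 - 1 / sqrt n\<close> is half the squared length of \<open>v\<close>.\<close>

definition householder :: "nat \<Rightarrow> nat \<Rightarrow> nat \<Rightarrow> real" where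
  "householder n j k = (if j = k then 1 else 0) -
     (let v = (\<lambda>i. (if i = 0 then 1 else 0) - 1 / sqrt n) in v j * v k / (1 - 1 / sqrt n))"

lemma householder_sym: "householder n j k = householder n k j"
  by (simp add: householder_def Let_def mult.commute)

lemma householder_orthonormal:
  assumes n: "2 \<le> n" and "j < n" "k < n"
  shows "(\<Sum>i<n. householder n i j * householder n i k) = (if j = k then 1 else 0)"
proof -
  define r where "r = 1 / sqrt (real n)"
  define q where "q = 1 / (1 - r)"
  define v where "v i = (if i = 0 then 1 else 0) - r" for i :: nat
  have r: "r < 1" "real n * r\<^sup>2 = 1" using n by (auto simp: r_def power_divide)
  have H: "householder n i j = (if i = j then 1 else 0) - v i * v j * q" for i j
    by (simp add: householder_def v_def r_def q_def)
  have q: "(1 - r) * q = 1" using r by (simp add: q_def)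
  have "(\<Sum>i<n. (v i)\<^sup>2) = (1 - r)\<^sup>2 + (\<Sum>i\<in>{..<n}-{0}. r\<^sup>2)"
    using n by (subst sum.remove[of _ 0]) (auto simp: v_def)
  also have "\<dots> = 2 * (1 - r)"
    using n r by (simp add: algebra_simps power2_eq_square)
  finally have norm_v: "(\<Sum>i<n. (v i)\<^sup>2) = 2 * (1 - r)" .
  have delta: "(\<Sum>i<n. (if i = m then 1 else 0) * F i) = F m" if "m < n" for m and F :: "nat \<Rightarrow> real"
    using that by (simp add: if_distrib[of "\<lambda>x. x * _"] cong: if_cong)
  have "(\<Sum>i<n. householder n i j * householder n i k)
      = (\<Sum>i<n. (if i = j then 1 else 0) * ((if i = k then 1 else 0) - v i * v k * q)
          - (if i = k then 1 else 0) * (v i * v j * q) + (v i)\<^sup>2 * (v j * v k * q\<^sup>2))"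
    unfolding H by (rule sum.cong[OF refl]) (simp add: algebra_simps power2_eq_square)
  also have "\<dots> = (if j = k then 1 else 0) - v j * v k * q - v k * v j * q
      + 2 * (1 - r) * (v j * v k * q\<^sup>2)"
    unfolding sum.distrib sum_subtractf delta[OF \<open>j < n\<close>] delta[OF \<open>k < n\<close>] sum_distrib_right[symmetric] norm_v ..
  also have "2 * (1 - r) * (v j * v k * q\<^sup>2) = v j * v k * q + v k * v j * q"
  proof -
    have "2 * (1 - r) * (v j * v k * q\<^sup>2) = 2 * ((1 - r) * q) * (v j * v k * q)"
      by (simp add: power2_eq_square)
    then show ?thesis unfolding q by simp
  qed
  finally show ?thesis by simp
qed

lemma householder_row_0:
  assumes "2 \<le> n" shows "householder n 0 j = 1 / sqrt (real n)"
proof -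
  have "1 - 1 / sqrt (real n) \<noteq> 0" using assms by simp
  then show ?thesis by (auto simp: householder_def Let_def)
qed

lemma sum_householder_products:
  assumes n: "2 \<le> n"
  shows "(\<Sum>k<n. (\<Sum>j<n. householder n k j * a j) * (\<Sum>j<n. householder n k j * b j)) = (\<Sum>j<n. a j * b j)"
proof -
  have "(\<Sum>k<n. (\<Sum>j<n. householder n k j * a j) * (\<Sum>i<n. householder n k i * b i))
      = (\<Sum>k<n. \<Sum>j<n. \<Sum>i<n. a j * b i * (householder n k j * householder n k i))"
    by (simp add: sum_product mult_ac)
  also have "\<dots> = (\<Sum>j<n. \<Sum>i<n. a j * b i * (\<Sum>k<n. householder n k j * householder n k i))"
    by (subst sum.swap, rule sum.cong[OF refl], subst sum.swap) (simp only: sum_distrib_left)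
  also have "\<dots> = (\<Sum>j<n. \<Sum>i<n. a j * b i * (if j = i then 1 else 0))"
    using householder_orthonormal[OF n] by (intro sum.cong refl) simp
  also have "\<dots> = (\<Sum>j<n. a j * b j)"
    by (intro sum.cong refl) (simp add: if_distrib cong: if_cong)
  finally show ?thesis .
qed

text \<open>The coordinate along the all-ones direction carries exactly the means, so that removing the
  means from two samples amounts to dropping coordinate 0 after the rotation.\<close>

lemma sum_centred_products:
  assumes n: "2 \<le> n"
  defines "mean \<equiv> (\<lambda>a :: nat \<Rightarrow> real. (\<Sum>j<n. a j) / real n)"
  shows "(\<Sum>j<n. (a j - mean a) * (b j - mean b))
     = (\<Sum>k\<in>{1..<n}. (\<Sum>j<n. householder n k j * a j) * (\<Sum>j<n. householder n k j * b j))"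
proof -
  have row0: "(\<Sum>j<n. householder n 0 j * a j) = sqrt (real n) * mean a" for a
  proof -
    have "1 / sqrt (real n) = sqrt (real n) / real n" using n by (simp add: field_simps)
    then show ?thesis
      using n by (simp add: householder_row_0 mean_def sum_divide_distrib[symmetric] sum_distrib_left[symmetric])
  qed
  have sm: "(\<Sum>j<n. a j) = real n * mean a" for a using n by (simp add: mean_def)
  have "(\<Sum>j<n. (a j - mean a) * (b j - mean b))
      = (\<Sum>j<n. a j * b j) - mean b * (\<Sum>j<n. a j) - mean a * (\<Sum>j<n. b j) + real n * (mean a * mean b)"
    by (simp add: algebra_simps sum.distrib sum_subtractf sum_distrib_left sum_distrib_right)
  also have "\<dots> = (\<Sum>j<n. a j * b j) - real n * (mean a * mean b)"
    by (simp add: sm)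
  also have "\<dots> = (\<Sum>k<n. (\<Sum>j<n. householder n k j * a j) * (\<Sum>j<n. householder n k j * b j))
      - (\<Sum>j<n. householder n 0 j * a j) * (\<Sum>j<n. householder n 0 j * b j)"
    unfolding sum_householder_products[OF n] row0 by simp
  also have "\<dots> = (\<Sum>k\<in>{..<n}-{0}. (\<Sum>j<n. householder n k j * a j) * (\<Sum>j<n. householder n k j * b j))"
    using n by (subst sum.remove[of "{..<n}" 0]) auto
  also have "{..<n}-{0} = {1..<n}" by auto
  finally show ?thesis .
qed

section \<open>Linear functionals of a standard normal vector and their products\<close>

lemma std_normal_prob_space: "prob_space std_normal_distribution"
  by (rule prob_space_normal_density) simp

lemma std_normal_char: "(LINT x|std_normal_distribution. iexp (t * x)) = complex_of_real (exp (- (t\<^sup>2) / 2))"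
  using char_std_normal_distribution unfolding char_def by metis

lemma gaussian_linear_functional:
  fixes A :: "'i \<Rightarrow> real"
  assumes I: "finite I"
  shows "distr (PiM I (\<lambda>_. std_normal_distribution)) borel (\<lambda>w. \<Sum>i\<in>I. A i * w i)
     = distr std_normal_distribution borel (\<lambda>x. sqrt (\<Sum>i\<in>I. (A i)\<^sup>2) * x)"
proof -
  interpret N: prob_space std_normal_distribution by (rule std_normal_prob_space)
  interpret PN: product_prob_space "\<lambda>_::'i. std_normal_distribution" by unfold_locales
  let ?P = "PiM I (\<lambda>_. std_normal_distribution)"
  have P: "prob_space ?P" by (rule prob_space_PiM) (rule std_normal_prob_space)
  have [measurable]: "(\<lambda>w. \<Sum>i\<in>I. A i * w i) \<in> borel_measurable ?P" by simp
  show ?thesis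
  proof (rule Levy_uniqueness)
    show "real_distribution (distr ?P borel (\<lambda>w. \<Sum>i\<in>I. A i * w i))"
      by (rule prob_space.real_distribution_distr[OF P]) simp
    show "real_distribution (distr std_normal_distribution borel (\<lambda>x. sqrt (\<Sum>i\<in>I. (A i)\<^sup>2) * x))"
      by (rule prob_space.real_distribution_distr[OF std_normal_prob_space]) simp
    show "char (distr ?P borel (\<lambda>w. \<Sum>i\<in>I. A i * w i)) = char (distr std_normal_distribution borel (\<lambda>x. sqrt (\<Sum>i\<in>I. (A i)\<^sup>2) * x))"
    proof
      fix t
      have "char (distr ?P borel (\<lambda>w. \<Sum>i\<in>I. A i * w i)) t = (LINT w|?P. (\<Prod>i\<in>I. iexp ((t * A i) * w i)))"
        using I by (simp add: char_def integral_distr exp_sum[symmetric] sum_distrib_left mult_ac)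
      also have "\<dots> = (\<Prod>i\<in>I. LINT x|std_normal_distribution. iexp ((t * A i) * x))"
        using I by (intro PN.product_integral_prod N.integrable_const_bound[where B=1]) auto
      also have "\<dots> = (\<Prod>i\<in>I. complex_of_real (exp (- ((t * A i)\<^sup>2) / 2)))"
        by (simp only: std_normal_char)
      also have "\<dots> = complex_of_real (exp (\<Sum>i\<in>I. - ((t * A i)\<^sup>2) / 2))"
        using I by (simp add: exp_sum)
      also have "(\<Sum>i\<in>I. - ((t * A i)\<^sup>2) / 2) = - ((t * sqrt (\<Sum>i\<in>I. (A i)\<^sup>2))\<^sup>2) / 2"
        by (simp add: power_mult_distrib sum_nonneg sum_negf sum_divide_distrib[symmetric] sum_distrib_left[symmetric])
      also have "complex_of_real (exp \<dots>) = (LINT x|std_normal_distribution. iexp ((t * sqrt (\<Sum>i\<in>I. (A i)\<^sup>2)) * x))"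
        by (simp only: std_normal_char)
      also have "\<dots> = char (distr std_normal_distribution borel (\<lambda>x. sqrt (\<Sum>i\<in>I. (A i)\<^sup>2) * x)) t"
        by (simp add: char_def integral_distr mult_ac)
      finally show "char (distr ?P borel (\<lambda>w. \<Sum>i\<in>I. A i * w i)) t = char (distr std_normal_distribution borel (\<lambda>x. sqrt (\<Sum>i\<in>I. (A i)\<^sup>2) * x)) t" .
    qed
  qed
qed

lemma
  fixes A :: "'i \<Rightarrow> real"
  assumes I: "finite I"
  shows gaussian_linear_even_moment: "(LINT w|PiM I (\<lambda>_. std_normal_distribution). (\<Sum>i\<in>I. A i * w i) ^ (2 * k))
      = (\<Sum>i\<in>I. (A i)\<^sup>2) ^ k * (fact (2 * k) / (2 ^ k * fact k))"
    and gaussian_linear_integrable_moment: "integrable (PiM I (\<lambda>_. std_normal_distribution)) (\<lambda>w. (\<Sum>i\<in>I. A i * w i) ^ m)"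
    and gaussian_linear_char: "(LINT w|PiM I (\<lambda>_. std_normal_distribution). iexp (t * (\<Sum>i\<in>I. A i * w i)))
      = complex_of_real (exp (- (t\<^sup>2 * (\<Sum>i\<in>I. (A i)\<^sup>2)) / 2))"
proof -
  let ?P = "PiM I (\<lambda>_. std_normal_distribution)"
  let ?f = "\<lambda>w. \<Sum>i\<in>I. A i * w i"
  define r where "r = sqrt (\<Sum>i\<in>I. (A i)\<^sup>2)"
  have r2: "r\<^sup>2 = (\<Sum>i\<in>I. (A i)\<^sup>2)" by (simp add: r_def sum_nonneg)
  have [measurable]: "?f \<in> borel_measurable ?P" by simp
  note law = gaussian_linear_functional[OF I, of A, folded r_def]
  have law_real: "(LINT w|?P. g (?f w)) = (LINT x|std_normal_distribution. g (r * x))"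
    if [measurable]: "g \<in> borel_measurable borel" for g :: "real \<Rightarrow> real"
    using arg_cong[OF law, of "\<lambda>M. integral\<^sup>L M g"] by (simp add: integral_distr)
  show "(LINT w|?P. ?f w ^ (2 * k)) = (\<Sum>i\<in>I. (A i)\<^sup>2) ^ k * (fact (2 * k) / (2 ^ k * fact k))"
    by (subst law_real[of "\<lambda>y. y ^ (2 * k)"])
      (simp_all add: power_mult_distrib std_normal_distribution_even_moments power_mult[of r 2 k] r2 del: power_mult_numeral)
  show "integrable ?P (\<lambda>w. ?f w ^ m)"
  proof -
    have "integrable std_normal_distribution (\<lambda>x. (r * x) ^ m)"
      unfolding power_mult_distrib by (intro integrable_mult_right integrable_std_normal_distribution_moment)
    then have "integrable (distr std_normal_distribution borel (\<lambda>x. r * x)) (\<lambda>y. y ^ m)"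
      by (subst integrable_distr_eq) auto
    then show ?thesis
      unfolding law[symmetric] by (subst (asm) integrable_distr_eq) auto
  qed
  have "(LINT w|?P. iexp (t * ?f w)) = (LINT y|distr ?P borel ?f. iexp (t * y))"
    by (subst integral_distr) auto
  also have "\<dots> = (LINT x|std_normal_distribution. iexp ((t * r) * x))"
    unfolding law by (subst integral_distr) (auto simp: mult_ac)
  also have "\<dots> = complex_of_real (exp (- (t\<^sup>2 * (\<Sum>i\<in>I. (A i)\<^sup>2)) / 2))"
    by (simp only: std_normal_char power_mult_distrib r2)
  finally show "(LINT w|?P. iexp (t * ?f w)) = complex_of_real (exp (- (t\<^sup>2 * (\<Sum>i\<in>I. (A i)\<^sup>2)) / 2))" .
qed

text \<open>Mixed moments follow from those of the single normal variables \<open>x a + y b\<close> by polarisation.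
  The fourth moment is only bounded: after rescaling \<open>a\<close> and \<open>b\<close> to equal variance, the
  arithmetic-geometric mean inequality reduces it to the eighth moments, which are 105 times the
  fourth power of the variance.\<close>

lemma
  fixes A B :: "'i \<Rightarrow> real"
  assumes I: "finite I"
  defines "\<alpha> \<equiv> (\<Sum>i\<in>I. (A i)\<^sup>2)" and "\<beta> \<equiv> (\<Sum>i\<in>I. A i * B i)" and "\<gamma> \<equiv> (\<Sum>i\<in>I. (B i)\<^sup>2)"
  defines "P \<equiv> PiM I (\<lambda>_. std_normal_distribution)"
  defines "a \<equiv> (\<lambda>w. \<Sum>i\<in>I. A i * w i)" and "b \<equiv> (\<lambda>w. \<Sum>i\<in>I. B i * w i)"
  shows gaussian_product_mean: "(LINT w|P. a w * b w) = \<beta>"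
    and gaussian_product_square: "(LINT w|P. (a w * b w)\<^sup>2) = \<alpha> * \<gamma> + 2 * \<beta>\<^sup>2"
    and gaussian_product_fourth: "(LINT w|P. (a w * b w) ^ 4) \<le> 105 * (\<alpha> * \<gamma>)\<^sup>2"
    and gaussian_product_integrable: "integrable P (\<lambda>w. (a w * b w) ^ m)"
proof -
  have lin: "(\<Sum>i\<in>I. (x * A i + y * B i) * w i) = x * a w + y * b w" for x y w
    by (simp add: a_def b_def algebra_simps sum.distrib sum_distrib_left)
  have sq: "(\<Sum>i\<in>I. (x * A i + y * B i)\<^sup>2) = x\<^sup>2 * \<alpha> + 2 * x * y * \<beta> + y\<^sup>2 * \<gamma>" for x y
    by (simp add: \<alpha>_def \<beta>_def \<gamma>_def algebra_simps power2_eq_square sum.distrib sum_distrib_left)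
  have mom: "(LINT w|P. (x * a w + y * b w) ^ (2 * k)) = (x\<^sup>2 * \<alpha> + 2 * x * y * \<beta> + y\<^sup>2 * \<gamma>) ^ k * (fact (2 * k) / (2 ^ k * fact k))" for x y k
    using gaussian_linear_even_moment[OF I, of "\<lambda>i. x * A i + y * B i" k] by (simp only: lin sq P_def)
  have int: "integrable P (\<lambda>w. (x * a w + y * b w) ^ m)" for x y m
    using gaussian_linear_integrable_moment[OF I, of "\<lambda>i. x * A i + y * B i" m] by (simp only: lin P_def)
  have inta: "integrable P (\<lambda>w. a w ^ m)" and intb: "integrable P (\<lambda>w. b w ^ m)" for m
    using int[of 1 0 m] int[of 0 1 m] by simp_all
  have [measurable]: "a \<in> borel_measurable P" "b \<in> borel_measurable P"
    using inta[of 1] intb[of 1] by auto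
  have ab_le: "\<bar>(a w * b w) ^ m\<bar> \<le> a w ^ (2 * m) + b w ^ (2 * m)" for w m
  proof -
    have "0 \<le> (\<bar>a w ^ m\<bar> - \<bar>b w ^ m\<bar>)\<^sup>2 + (a w ^ m)\<^sup>2 + (b w ^ m)\<^sup>2" by simp
    then show ?thesis by (simp add: power2_diff power_mult_distrib abs_mult power_mult[symmetric] algebra_simps)
  qed
  show int_ab: "integrable P (\<lambda>w. (a w * b w) ^ m)" for m
    by (rule Bochner_Integration.integrable_bound[OF Bochner_Integration.integrable_add[OF inta[of "2*m"] intb[of "2*m"]]])
      (use ab_le in \<open>auto intro!: AE_I2 order_trans[OF ab_le]\<close>)
  have fct: "fact (2 * 1) / (2 ^ 1 * fact 1) = (1::real)" "fact (2 * 2) / (2 ^ 2 * fact 2) = (3::real)" "fact (2 * 4) / (2 ^ 4 * fact 4) = (105::real)"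
    by (simp_all add: fact_numeral)
  have "(LINT w|P. a w * b w) = (LINT w|P. ((1 * a w + 1 * b w) ^ (2 * 1) - (1 * a w + (-1) * b w) ^ (2 * 1)) / 4)"
    by (intro Bochner_Integration.integral_cong) (auto simp: algebra_simps power2_eq_square)
  also have "\<dots> = \<beta>"
    by (simp only: integral_divide_zero Bochner_Integration.integral_diff[OF int int] mom fct) simp
  finally show "(LINT w|P. a w * b w) = \<beta>" .
  have "(LINT w|P. (a w * b w)\<^sup>2) = (LINT w|P. ((1 * a w + 1 * b w) ^ (2 * 2) + (1 * a w + (-1) * b w) ^ (2 * 2)
      - (2 * (1 * a w + 0 * b w) ^ (2 * 2) + 2 * (0 * a w + 1 * b w) ^ (2 * 2))) / 12)"
    by (intro Bochner_Integration.integral_cong) (auto simp: algebra_simps power2_eq_square power4_eq_xxxx)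
  also have "\<dots> = \<alpha> * \<gamma> + 2 * \<beta>\<^sup>2"
    by (simp only: integral_divide_zero Bochner_Integration.integral_diff Bochner_Integration.integral_add
        Bochner_Integration.integrable_add Bochner_Integration.integrable_diff integrable_mult_right int mom fct integral_mult_right_zero)
      (simp add: power2_eq_square algebra_simps)
  finally show "(LINT w|P. (a w * b w)\<^sup>2) = \<alpha> * \<gamma> + 2 * \<beta>\<^sup>2" .
  have nn: "0 \<le> \<alpha>" "0 \<le> \<gamma>" by (auto simp: \<alpha>_def \<gamma>_def intro: sum_nonneg)
  show "(LINT w|P. (a w * b w) ^ 4) \<le> 105 * (\<alpha> * \<gamma>)\<^sup>2"
  proof (cases "\<alpha> * \<gamma> = 0")
    case True
    then have "(\<forall>i\<in>I. A i = 0) \<or> (\<forall>i\<in>I. B i = 0)"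
      using I by (auto simp: \<alpha>_def \<gamma>_def sum_nonneg_eq_0_iff)
    then have "a w * b w = 0" for w by (auto simp: a_def b_def)
    then have "(LINT w|P. (a w * b w) ^ 4) = 0" by (simp only:) simp
    then show ?thesis by simp
  next
    case False
    then have pos: "0 < (\<alpha> * \<gamma>)\<^sup>2" by simp
    have "(\<alpha> * \<gamma>)\<^sup>2 * (LINT w|P. (a w * b w) ^ 4) = (LINT w|P. (\<alpha> * \<gamma>)\<^sup>2 * (a w * b w) ^ 4)"
      by simp
    also have "\<dots> \<le> (LINT w|P. ((sqrt \<gamma> * a w + 0 * b w) ^ (2 * 4) + (0 * a w + sqrt \<alpha> * b w) ^ (2 * 4)) / 2)"
    proof (rule integral_mono)
      show "integrable P (\<lambda>w. (\<alpha> * \<gamma>)\<^sup>2 * (a w * b w) ^ 4)" by (intro integrable_mult_right int_ab)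
      show "integrable P (\<lambda>w. ((sqrt \<gamma> * a w + 0 * b w) ^ (2 * 4) + (0 * a w + sqrt \<alpha> * b w) ^ (2 * 4)) / 2)"
        by (intro integrable_divide_zero Bochner_Integration.integrable_add int)
      fix w
      have s: "sqrt x ^ 4 = x\<^sup>2" "sqrt x ^ 8 = x ^ 4" if "0 \<le> x" for x
        using power_mult[of "sqrt x" 2 2] power_mult[of "sqrt x" 2 4] that by simp_all
      have "0 \<le> ((sqrt \<gamma> * a w) ^ 4 - (sqrt \<alpha> * b w) ^ 4)\<^sup>2" by simp
      also have "\<dots> = (sqrt \<gamma> * a w) ^ 8 + (sqrt \<alpha> * b w) ^ 8 - 2 * ((sqrt \<gamma> * a w) ^ 4 * (sqrt \<alpha> * b w) ^ 4)"
        by (simp add: power2_diff power_mult[symmetric])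
      also have "(sqrt \<gamma> * a w) ^ 4 * (sqrt \<alpha> * b w) ^ 4 = (\<alpha> * \<gamma>)\<^sup>2 * (a w * b w) ^ 4"
        using nn by (simp add: power_mult_distrib s)
      finally show "(\<alpha> * \<gamma>)\<^sup>2 * (a w * b w) ^ 4 \<le> ((sqrt \<gamma> * a w + 0 * b w) ^ (2 * 4) + (0 * a w + sqrt \<alpha> * b w) ^ (2 * 4)) / 2"
        by simp
    qed
    also have "\<dots> = ((\<gamma> * \<alpha>) ^ 4 * 105 + (\<alpha> * \<gamma>) ^ 4 * 105) / 2"
      unfolding integral_divide_zero Bochner_Integration.integral_add[OF int int] mom fct using nn by simp
    also have "\<dots> = (\<alpha> * \<gamma>)\<^sup>2 * (105 * (\<alpha> * \<gamma>)\<^sup>2)"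
      by (simp add: power_mult_distrib power4_eq_xxxx power2_eq_square)
    finally show ?thesis using pos by (rule mult_left_le_imp_le)
  qed
qed

text \<open>A second-order expansion whose error is governed by the variance alone. The third absolute moment
  of the centred product is bounded through its second and fourth moments, and the latter is
  at most a constant times the square of the variance. This comparability of moments, whatever the
  coefficients, is the source of all uniformity.\<close>

lemma gaussian_product_char_approx:
  fixes A B :: "'i \<Rightarrow> real"
  assumes I: "finite I"
  defines "\<alpha> \<equiv> (\<Sum>i\<in>I. (A i)\<^sup>2)" and "\<beta> \<equiv> (\<Sum>i\<in>I. A i * B i)" and "\<gamma> \<equiv> (\<Sum>i\<in>I. (B i)\<^sup>2)"
  defines "V \<equiv> \<alpha> * \<gamma> + \<beta>\<^sup>2"
  shows "cmod ((LINT w|PiM I (\<lambda>_. std_normal_distribution). iexp (s * ((\<Sum>i\<in>I. A i * w i) * (\<Sum>i\<in>I. B i * w i) - \<beta>)))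
      - (1 - s\<^sup>2 * V / 2)) \<le> 71 * (\<bar>s\<bar> * sqrt V) ^ 3"
proof -
  define P where "P = PiM I (\<lambda>_. std_normal_distribution)"
  interpret P: prob_space P unfolding P_def by (rule prob_space_PiM) (rule std_normal_prob_space)
  define Z where "Z w = (\<Sum>i\<in>I. A i * w i) * (\<Sum>i\<in>I. B i * w i)" for w
  note mom = gaussian_product_mean[OF I, of A B, folded P_def \<beta>_def Z_def]
    gaussian_product_square[OF I, of A B, folded P_def \<alpha>_def \<beta>_def \<gamma>_def Z_def]
    gaussian_product_fourth[OF I, of A B, folded P_def \<alpha>_def \<gamma>_def Z_def]
  have int: "integrable P (\<lambda>w. Z w ^ m)" for m
    using gaussian_product_integrable[OF I, of A B] by (simp add: P_def Z_def)
  have int1: "integrable P Z" using int[of 1] by simp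
  have [measurable]: "Z \<in> borel_measurable P" using int1 by auto
  have nn: "0 \<le> \<alpha> * \<gamma>" "0 \<le> V" by (auto simp: \<alpha>_def \<gamma>_def V_def intro!: mult_nonneg_nonneg add_nonneg_nonneg sum_nonneg)
  define X where "X w = Z w - \<beta>" for w
  have intX1: "integrable P X" unfolding X_def using int1 by simp
  have X2: "(X w)\<^sup>2 = (Z w)\<^sup>2 - 2 * \<beta> * Z w + \<beta>\<^sup>2" for w by (simp add: X_def power2_diff)
  have intX2: "integrable P (\<lambda>w. (X w)\<^sup>2)" unfolding X2 using int1 int[of 2] by simp
  have EX: "P.expectation X = 0" unfolding X_def using int1 by (simp add: P.prob_space mom)
  have EX2: "P.expectation (\<lambda>w. (X w)\<^sup>2) = V"
    unfolding X2 using int1 int[of 2] by (simp add: P.prob_space mom V_def) (simp add: power2_eq_square)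
  have X4_le: "X w ^ 4 \<le> 8 * (Z w ^ 4 + \<beta> ^ 4)" for w
  proof -
    have "(X w)\<^sup>2 \<le> 2 * ((Z w)\<^sup>2 + \<beta>\<^sup>2)"
      using zero_le_power2[of "Z w + \<beta>"] by (simp add: X_def power2_diff power2_sum)
    then have "((X w)\<^sup>2)\<^sup>2 \<le> (2 * ((Z w)\<^sup>2 + \<beta>\<^sup>2))\<^sup>2" by (rule power_mono) simp
    also have "\<dots> \<le> 8 * (((Z w)\<^sup>2)\<^sup>2 + (\<beta>\<^sup>2)\<^sup>2)"
      using zero_le_power2[of "(Z w)\<^sup>2 - \<beta>\<^sup>2"] by (simp add: power2_diff power2_sum power_mult_distrib)
    finally show ?thesis by (simp add: power_mult[symmetric])
  qed
  have intX4: "integrable P (\<lambda>w. X w ^ 4)"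
    by (rule Bochner_Integration.integrable_bound[of P "\<lambda>w. 8 * (Z w ^ 4 + \<beta> ^ 4)"])
      (use int[of 4] X4_le in \<open>auto simp: X_def\<close>)
  have "P.expectation (\<lambda>w. X w ^ 4) \<le> P.expectation (\<lambda>w. 8 * (Z w ^ 4 + \<beta> ^ 4))"
    by (rule integral_mono) (use intX4 X4_le int[of 4] in auto)
  also have "\<dots> = 8 * (P.expectation (\<lambda>w. Z w ^ 4) + \<beta> ^ 4)"
    using int[of 4] by (simp add: P.prob_space)
  also have "\<dots> \<le> 840 * V\<^sup>2"
  proof -
    have "V\<^sup>2 = (\<alpha> * \<gamma>)\<^sup>2 + 2 * (\<alpha> * \<gamma>) * \<beta>\<^sup>2 + \<beta> ^ 4"
      by (simp add: V_def power2_sum power_mult[symmetric])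
    moreover have "0 \<le> (\<alpha> * \<gamma>) * \<beta>\<^sup>2" using nn by simp
    moreover have "0 \<le> \<beta> ^ 4" by simp
    moreover have "8 * (E + b) \<le> 840 * (x + 2 * y + b)" if "E \<le> 105 * x" "0 \<le> y" "0 \<le> b" for E b x y :: real
      using that by (simp add: algebra_simps)
    ultimately show ?thesis using mom(3) by (simp only: mult.assoc)
  qed
  finally have EX4: "P.expectation (\<lambda>w. X w ^ 4) \<le> 840 * V\<^sup>2" .
  define \<delta> where "\<delta> = sqrt V"
  have \<delta>: "0 \<le> \<delta>" "\<delta>\<^sup>2 = V" using nn by (auto simp: \<delta>_def)
  (* The arithmetic-geometric mean inequality, balanced by the standard deviation *)
  have cube: "2 * \<delta> * \<bar>X w\<bar> ^ 3 \<le> V * (X w)\<^sup>2 + X w ^ 4" for w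
  proof -
    have "0 \<le> (X w)\<^sup>2 * (\<delta> - \<bar>X w\<bar>)\<^sup>2" by simp
    also have "\<dots> = V * (X w)\<^sup>2 + X w ^ 4 - 2 * \<delta> * \<bar>X w\<bar> ^ 3"
      by (cases "0 \<le> X w") (simp_all add: \<delta>(2)[symmetric] power2_diff algebra_simps power2_eq_square power3_eq_cube power4_eq_xxxx)
    finally show ?thesis by simp
  qed
  have intX3: "integrable P (\<lambda>w. \<bar>X w\<bar> ^ 3)"
  proof (rule Bochner_Integration.integrable_bound[of P "\<lambda>w. (X w)\<^sup>2 + X w ^ 4"])
    show "AE w in P. norm (\<bar>X w\<bar> ^ 3) \<le> norm ((X w)\<^sup>2 + X w ^ 4)"
    proof (rule AE_I2)
      fix w
      have "0 \<le> (X w)\<^sup>2 * (1 - \<bar>X w\<bar>)\<^sup>2 + (X w)\<^sup>2 + X w ^ 4" by simp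
      also have "\<dots> = 2 * ((X w)\<^sup>2 + X w ^ 4) - 2 * \<bar>X w\<bar> ^ 3"
        by (cases "0 \<le> X w") (simp_all add: power2_diff algebra_simps power2_eq_square power3_eq_cube power4_eq_xxxx)
      finally show "norm (\<bar>X w\<bar> ^ 3) \<le> norm ((X w)\<^sup>2 + X w ^ 4)" by simp
    qed
  qed (use intX2 intX4 in \<open>auto simp: X_def\<close>)
  have EX3: "P.expectation (\<lambda>w. \<bar>X w\<bar> ^ 3) \<le> 421 * \<delta> ^ 3"
  proof (cases "\<delta> = 0")
    case True
    then have "P.expectation (\<lambda>w. (X w)\<^sup>2) = 0" using EX2 \<delta> by simp
    then have "AE w in P. (X w)\<^sup>2 = 0" using intX2 by (subst (asm) integral_nonneg_eq_0_iff_AE) auto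
    then have "P.expectation (\<lambda>w. \<bar>X w\<bar> ^ 3) = P.expectation (\<lambda>w. 0)"
      by (intro integral_cong_AE) (auto simp: X_def)
    then show ?thesis using \<delta> by simp
  next
    case False
    have "2 * \<delta> * P.expectation (\<lambda>w. \<bar>X w\<bar> ^ 3) = P.expectation (\<lambda>w. 2 * \<delta> * \<bar>X w\<bar> ^ 3)" by simp
    also have "\<dots> \<le> P.expectation (\<lambda>w. V * (X w)\<^sup>2 + X w ^ 4)"
      by (rule integral_mono) (use intX2 intX3 intX4 cube in auto)
    also have "\<dots> = V * V + P.expectation (\<lambda>w. X w ^ 4)"
      using intX2 intX4 by (simp add: EX2)
    also have "\<dots> \<le> 841 * V\<^sup>2" using EX4 by (simp add: power2_eq_square)
    also have "\<dots> \<le> 2 * \<delta> * (421 * \<delta> ^ 3)"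
      using \<delta>(1) by (simp add: \<delta>(2)[symmetric] power2_eq_square power3_eq_cube)
    finally show ?thesis using False \<delta>(1) by (simp add: mult_le_cancel_left)
  qed
  have chX: "char (distr P borel X) s = (LINT w|P. iexp (s * X w))"
    using intX1 by (simp add: char_def integral_distr)
  have "cmod (char (distr P borel X) s - (1 - s\<^sup>2 * V / 2))
      \<le> (s\<^sup>2 / 6) * P.expectation (\<lambda>w. min (6 * (X w)\<^sup>2) (\<bar>s\<bar> * \<bar>X w\<bar> ^ 3))"
    using intX1 intX2 EX EX2 by (intro P.char_approx3') auto
  also have "\<dots> \<le> (s\<^sup>2 / 6) * P.expectation (\<lambda>w. \<bar>s\<bar> * \<bar>X w\<bar> ^ 3)"
  proof (intro mult_left_mono integral_mono)
    show "integrable P (\<lambda>w. min (6 * (X w)\<^sup>2) (\<bar>s\<bar> * \<bar>X w\<bar> ^ 3))"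
      using intX2 intX3 by simp
  qed (use intX3 in auto)
  also have "\<dots> = (\<bar>s\<bar> ^ 3 / 6) * P.expectation (\<lambda>w. \<bar>X w\<bar> ^ 3)"
    by (cases "0 \<le> s") (simp_all add: power2_eq_square power3_eq_cube)
  (* 421 is rounded up to a multiple of 6. *)
  also have "\<dots> \<le> (\<bar>s\<bar> ^ 3 / 6) * (426 * \<delta> ^ 3)"
  proof (intro mult_left_mono)
    have "0 \<le> \<delta> ^ 3" using \<delta>(1) by simp
    then show "P.expectation (\<lambda>w. \<bar>X w\<bar> ^ 3) \<le> 426 * \<delta> ^ 3" using EX3 by linarith
  qed simp
  also have "\<dots> = 71 * (\<bar>s\<bar> * sqrt V) ^ 3" by (simp add: \<delta>_def power_mult_distrib)
  finally show ?thesis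
    unfolding chX by (simp only: X_def Z_def P_def)
qed

abbreviation gauss_vec :: "nat \<Rightarrow> (nat \<Rightarrow> real) measure" where
  "gauss_vec p \<equiv> PiM {..<p} (\<lambda>_. std_normal_distribution)"

lemma prob_space_gauss_vec: "prob_space (gauss_vec p)"
  by (rule prob_space_PiM) (rule std_normal_prob_space)

lemma (in prob_space) expectation_abs_le_sqrt:
  assumes "integrable M (\<lambda>x. (f x)\<^sup>2)" and [measurable]: "f \<in> borel_measurable M"
  shows "integrable M f" "expectation (\<lambda>x. \<bar>f x\<bar>) \<le> sqrt (expectation (\<lambda>x. (f x)\<^sup>2))"
proof -
  show int: "integrable M f"
  proof (rule Bochner_Integration.integrable_bound[of M "\<lambda>x. 1 + (f x)\<^sup>2"])
    have "\<bar>y\<bar> \<le> 1 + y\<^sup>2" for y :: real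
    proof -
      have "0 \<le> (\<bar>y\<bar> - 1)\<^sup>2 + y\<^sup>2 + 1" by simp
      then show ?thesis by (simp add: power2_diff)
    qed
    then show "AE x in M. norm (f x) \<le> norm (1 + (f x)\<^sup>2)" by auto
  qed (use assms in auto)
  have "0 \<le> variance (\<lambda>x. \<bar>f x\<bar>)" by (rule variance_positive)
  also have "\<dots> = expectation (\<lambda>x. (f x)\<^sup>2) - (expectation (\<lambda>x. \<bar>f x\<bar>))\<^sup>2"
    using int assms by (subst variance_eq) auto
  finally show "expectation (\<lambda>x. \<bar>f x\<bar>) \<le> sqrt (expectation (\<lambda>x. (f x)\<^sup>2))"
    by (intro real_le_rsqrt) simp
qed

lemma measurable_gauss_vec_entry: "i < p \<Longrightarrow> (\<lambda>x. x i) \<in> borel_measurable (gauss_vec p)"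
  by simp

lemma gauss_vec_linear_abs:
  "integrable (gauss_vec p) (\<lambda>x. \<Sum>i<p. a i * x i)"
  "(LINT x|gauss_vec p. \<bar>\<Sum>i<p. a i * x i\<bar>) \<le> sqrt (\<Sum>i<p. (a i)\<^sup>2)"
  "integrable (gauss_vec p) (\<lambda>x. (\<Sum>i<p. a i * x i)\<^sup>2)"
  "(LINT x|gauss_vec p. (\<Sum>i<p. a i * x i)\<^sup>2) = (\<Sum>i<p. (a i)\<^sup>2)"
proof -
  interpret prob_space "gauss_vec p" by (rule prob_space_gauss_vec)
  show sq: "integrable (gauss_vec p) (\<lambda>x. (\<Sum>i<p. a i * x i)\<^sup>2)"
    by (rule gaussian_linear_integrable_moment) simp
  show E: "(LINT x|gauss_vec p. (\<Sum>i<p. a i * x i)\<^sup>2) = (\<Sum>i<p. (a i)\<^sup>2)"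
    using gaussian_linear_even_moment[of "{..<p}" a 1] by (simp add: fact_numeral)
  show "integrable (gauss_vec p) (\<lambda>x. \<Sum>i<p. a i * x i)"
    "(LINT x|gauss_vec p. \<bar>\<Sum>i<p. a i * x i\<bar>) \<le> sqrt (\<Sum>i<p. (a i)\<^sup>2)"
    using expectation_abs_le_sqrt[OF sq] by (simp_all add: E)
qed

text \<open>The variables \<open>(x i)\<^sup>2 - 1\<close> are centred and orthogonal with second moment 2. Their products are
  evaluated as products of two coordinate functionals.\<close>

lemma gauss_vec_chi_square_abs:
  "integrable (gauss_vec p) (\<lambda>x. \<Sum>i<p. a i * ((x i)\<^sup>2 - 1))"
  "(LINT x|gauss_vec p. \<bar>\<Sum>i<p. a i * ((x i)\<^sup>2 - 1)\<bar>) \<le> sqrt (2 * (\<Sum>i<p. (a i)\<^sup>2))"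
proof -
  interpret prob_space "gauss_vec p" by (rule prob_space_gauss_vec)
  have unit: "(\<Sum>k<p. (if k = i then 1 else 0) * x k) = x i" if "i < p" for i and x :: "nat \<Rightarrow> real"
    using that by (simp add: if_distrib[of "\<lambda>y. y * _"] cong: if_cong)
  have unit2: "(\<Sum>k<p. (if k = i then 1 else 0)\<^sup>2) = (1::real)" if "i < p" for i
    using that by (simp add: if_distrib[of "\<lambda>y. y\<^sup>2"] cong: if_cong)
  have int2: "integrable (gauss_vec p) (\<lambda>x. (x i)\<^sup>2)" and E2: "expectation (\<lambda>x. (x i)\<^sup>2) = 1" if "i < p" for i
    using gauss_vec_linear_abs(3,4)[of p "\<lambda>k. if k = i then 1 else 0"] that by (simp_all only: unit unit2)
  have int4: "integrable (gauss_vec p) (\<lambda>x. (x i * x j)\<^sup>2)"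
    and E4: "expectation (\<lambda>x. (x i * x j)\<^sup>2) = 1 + 2 * (if i = j then 1 else 0)" if "i < p" "j < p" for i j
  proof -
    have "(\<Sum>k<p. (if k = i then 1 else 0) * (if k = j then 1 else 0)) = (if i = j then 1 else (0::real))"
      using unit[OF that(1), of "\<lambda>k. if k = j then 1 else 0"] by simp
    then show "integrable (gauss_vec p) (\<lambda>x. (x i * x j)\<^sup>2)"
      "expectation (\<lambda>x. (x i * x j)\<^sup>2) = 1 + 2 * (if i = j then 1 else 0)"
      using gaussian_product_integrable[of "{..<p}" "\<lambda>k. if k = i then 1 else 0" "\<lambda>k. if k = j then 1 else 0" 2]
        gaussian_product_square[of "{..<p}" "\<lambda>k. if k = i then 1 else 0" "\<lambda>k. if k = j then 1 else 0"] that
      by (simp_all only: unit unit2 finite_lessThan) simp_all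
  qed
  define g where "g i j x = a i * a j * ((x i * x j)\<^sup>2 - (x i)\<^sup>2 - (x j)\<^sup>2 + 1)" for i j and x :: "nat \<Rightarrow> real"
  have sq: "(\<Sum>i<p. a i * ((x i)\<^sup>2 - 1))\<^sup>2 = (\<Sum>i<p. \<Sum>j<p. g i j x)" for x
    unfolding power2_eq_square[of "sum _ _"] sum_product g_def
    by (intro sum.cong refl) (simp add: algebra_simps power_mult_distrib)
  have intg: "integrable (gauss_vec p) (g i j)" if "i < p" "j < p" for i j
    unfolding g_def using int2 int4 that by simp
  have Eg: "expectation (g i j) = a i * a j * (2 * (if i = j then 1 else 0))" if "i < p" "j < p" for i j
    unfolding g_def using int2 int4 E2 E4 that by (simp add: prob_space)
  have int_sq: "integrable (gauss_vec p) (\<lambda>x. (\<Sum>i<p. a i * ((x i)\<^sup>2 - 1))\<^sup>2)"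
    unfolding sq using intg by (intro Bochner_Integration.integrable_sum) simp
  have "expectation (\<lambda>x. (\<Sum>i<p. a i * ((x i)\<^sup>2 - 1))\<^sup>2) = (\<Sum>i<p. \<Sum>j<p. expectation (g i j))"
  proof -
    have "expectation (\<lambda>x. \<Sum>i<p. \<Sum>j<p. g i j x) = (\<Sum>i<p. expectation (\<lambda>x. \<Sum>j<p. g i j x))"
      by (rule Bochner_Integration.integral_sum) (intro Bochner_Integration.integrable_sum intg; simp)
    also have "\<dots> = (\<Sum>i<p. \<Sum>j<p. expectation (g i j))"
      by (intro sum.cong[OF refl] Bochner_Integration.integral_sum) (simp add: intg)
    finally show ?thesis unfolding sq .
  qed
  also have "\<dots> = (\<Sum>i<p. \<Sum>j<p. a i * a j * (2 * (if i = j then 1 else 0)))"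
    using Eg by (intro sum.cong refl) simp
  also have "\<dots> = 2 * (\<Sum>i<p. (a i)\<^sup>2)"
    by (simp add: if_distrib[of "\<lambda>y. _ * y"] sum_distrib_left power2_eq_square mult_ac cong: if_cong)
  finally have E: "expectation (\<lambda>x. (\<Sum>i<p. a i * ((x i)\<^sup>2 - 1))\<^sup>2) = 2 * (\<Sum>i<p. (a i)\<^sup>2)" .
  have [measurable]: "(\<lambda>x. \<Sum>i<p. a i * ((x i)\<^sup>2 - 1)) \<in> borel_measurable (gauss_vec p)" by simp
  show "integrable (gauss_vec p) (\<lambda>x. \<Sum>i<p. a i * ((x i)\<^sup>2 - 1))"
    "expectation (\<lambda>x. \<bar>\<Sum>i<p. a i * ((x i)\<^sup>2 - 1)\<bar>) \<le> sqrt (2 * (\<Sum>i<p. (a i)\<^sup>2))"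
    using expectation_abs_le_sqrt[OF int_sq] by (simp_all add: E)
qed

text \<open>The central limit theorem for sums of independent copies of the centred product, in the form of a
  comparison with the characteristic function of a normal variable of the same variance. Powers of
  numbers in the unit disc differ at most by the exponent times the difference of the bases.\<close>

lemma product_sum_char_approx:
  fixes p :: nat and s :: real and A B :: "nat \<Rightarrow> real" and K :: "nat set"
  assumes K: "finite K"
  defines "\<alpha> \<equiv> (\<Sum>i<p. (A i)\<^sup>2)" and "\<beta> \<equiv> (\<Sum>i<p. A i * B i)" and "\<gamma> \<equiv> (\<Sum>i<p. (B i)\<^sup>2)"
  defines "V \<equiv> \<alpha> * \<gamma> + \<beta>\<^sup>2"
  defines "\<Psi> \<equiv> (LINT w|PiM K (\<lambda>_. gauss_vec p). iexp (s * (\<Sum>k\<in>K. (\<Sum>i<p. A i * w k i) * (\<Sum>i<p. B i * w k i) - \<beta>)))"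
  shows "cmod (\<Psi> - of_real (exp (- (real (card K) * (s\<^sup>2 * V)) / 2)))
      \<le> real (card K) * (71 * (\<bar>s\<bar> * sqrt V) ^ 3 + (\<bar>s\<bar> * sqrt V) ^ 4)"
    and "cmod \<Psi> \<le> 1"
proof -
  interpret G: prob_space "gauss_vec p" by (rule prob_space_gauss_vec)
  interpret PG: product_prob_space "\<lambda>_::nat. gauss_vec p" by unfold_locales
  define z where "z w = (\<Sum>i<p. A i * w i) * (\<Sum>i<p. B i * w i) - \<beta>" for w :: "nat \<Rightarrow> real"
  have [measurable]: "z \<in> borel_measurable (gauss_vec p)" unfolding z_def by simp
  define \<psi> where "\<psi> = (LINT w|gauss_vec p. iexp (s * z w))"
  have "\<Psi> = (LINT w|PiM K (\<lambda>_. gauss_vec p). (\<Prod>k\<in>K. iexp (s * z (w k))))"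
    unfolding \<Psi>_def z_def using K by (simp add: exp_sum[symmetric] sum_distrib_left)
  also have "\<dots> = (\<Prod>k\<in>K. \<psi>)"
    unfolding \<psi>_def using K by (intro PG.product_integral_prod G.integrable_const_bound[where B=1]) auto
  finally have \<Psi>: "\<Psi> = \<psi> ^ card K" by simp
  have \<psi>1: "cmod \<psi> \<le> 1"
  proof -
    have "cmod \<psi> \<le> (LINT w|gauss_vec p. cmod (iexp (s * z w)))" unfolding \<psi>_def by (rule integral_norm_bound)
    then show ?thesis by (simp add: G.prob_space)
  qed
  then show "cmod \<Psi> \<le> 1" by (simp add: \<Psi> norm_power power_le_one)
  define r where "r = \<bar>s\<bar> * sqrt V"
  have V: "0 \<le> V" by (auto simp: V_def \<alpha>_def \<gamma>_def intro!: add_nonneg_nonneg mult_nonneg_nonneg sum_nonneg)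
  then have r: "0 \<le> r" "r\<^sup>2 = s\<^sup>2 * V" by (auto simp: r_def power_mult_distrib)
  have 1: "cmod (\<psi> - of_real (1 - r\<^sup>2 / 2)) \<le> 71 * r ^ 3"
    using gaussian_product_char_approx[OF finite_lessThan, where A=A and B=B and s=s]
    by (simp add: \<psi>_def z_def r_def V_def \<alpha>_def \<beta>_def \<gamma>_def r(2)[unfolded r_def V_def \<alpha>_def \<beta>_def \<gamma>_def])
  have 2: "\<bar>(1 - r\<^sup>2 / 2) - exp (- (r\<^sup>2 / 2))\<bar> \<le> r ^ 4"
  proof -
    define x where "x = r\<^sup>2 / 2"
    have x: "0 \<le> x" by (simp add: x_def)
    have "1 - x \<le> exp (- x)" using exp_ge_add_one_self[of "-x"] by simp
    moreover have "exp (- x) \<le> 1 - x + x\<^sup>2"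
    proof -
      have "exp (- x) \<le> inverse (1 + x)"
        using x exp_ge_add_one_self[of x] by (simp add: exp_minus le_imp_inverse_le)
      also have "\<dots> \<le> 1 - x + x\<^sup>2"
        using x by (simp add: field_simps power2_eq_square power3_eq_cube)
      finally show ?thesis .
    qed
    moreover have "x\<^sup>2 \<le> r ^ 4" by (simp add: x_def power_divide power_mult[symmetric])
    ultimately show ?thesis by (simp add: x_def[symmetric])
  qed
  have "cmod (\<psi> - of_real (exp (- (r\<^sup>2 / 2)))) \<le> cmod (\<psi> - of_real (1 - r\<^sup>2 / 2)) + cmod (of_real (1 - r\<^sup>2 / 2) - of_real (exp (- (r\<^sup>2 / 2))))"
    using dist_triangle[of \<psi> "of_real (exp (- (r\<^sup>2 / 2)))" "of_real (1 - r\<^sup>2 / 2)"] by (simp only: dist_norm)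
  also have "cmod (of_real (1 - r\<^sup>2 / 2) - of_real (exp (- (r\<^sup>2 / 2)))) = \<bar>(1 - r\<^sup>2 / 2) - exp (- (r\<^sup>2 / 2))\<bar>"
    by (simp only: of_real_diff[symmetric] norm_of_real)
  finally have 3: "cmod (\<psi> - of_real (exp (- (r\<^sup>2 / 2)))) \<le> 71 * r ^ 3 + r ^ 4" using 1 2 by linarith
  have "cmod (\<psi> ^ card K - of_real (exp (- (r\<^sup>2 / 2))) ^ card K) \<le> real (card K) * cmod (\<psi> - of_real (exp (- (r\<^sup>2 / 2))))"
    by (rule norm_power_diff) (use \<psi>1 in auto)
  also have "\<dots> \<le> real (card K) * (71 * r ^ 3 + r ^ 4)"
    using 3 by (rule mult_left_mono) simp
  also have "of_real (exp (- (r\<^sup>2 / 2))) ^ card K = complex_of_real (exp (- (real (card K) * (s\<^sup>2 * V)) / 2))"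
    by (simp only: of_real_power[symmetric] exp_of_nat_mult[symmetric] r(2)) simp
  finally show "cmod (\<Psi> - of_real (exp (- (real (card K) * (s\<^sup>2 * V)) / 2)))
      \<le> real (card K) * (71 * (\<bar>s\<bar> * sqrt V) ^ 3 + (\<bar>s\<bar> * sqrt V) ^ 4)"
    by (simp only: \<Psi> r_def)
qed

section \<open>A central limit theorem with explicit error for the rotated sample\<close>

text \<open>The statistic given the mixing vector, in spectral coordinates. With \<open>u i\<close> an eigenvector for
  the eigenvalue \<open>lam i\<close>, the parameters stand for \<open>A i = sqrt (lam i) * (u i \<bullet> l)\<close> and
  \<open>U i = sqrt (lam i) * (u i \<bullet> m)\<close>, where \<open>m\<close> is the conditional mean vector.\<close>

locale gaussian_sample_model =
  fixes p n :: nat and A U lam :: "nat \<Rightarrow> real" and c m1 M1 :: real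
  assumes n: "2 \<le> n" and p: "0 < p" and c: "0 \<le> c" and m1: "0 < m1"
    and lam: "\<And>i. i < p \<Longrightarrow> m1 \<le> lam i \<and> lam i \<le> M1"
    and A: "\<exists>i<p. A i \<noteq> 0"
begin

text \<open>In the original terms, \<open>\<alpha>\<close>, \<open>\<beta>0\<close> and \<open>\<gamma>0\<close> are \<open>l \<bullet> \<Sigma> l\<close>, \<open>l \<bullet> \<Sigma> m\<close> and \<open>m \<bullet> \<Sigma> m\<close>, \<open>\<kappa>\<close> is the trace of
  \<open>\<Sigma>\<^sup>2\<close>, and \<open>\<tau>2\<close> is \<open>l \<bullet> \<Sigma>\<^sup>3 l\<close>.\<close>

definition "\<alpha> = (\<Sum>i<p. (A i)\<^sup>2)"
definition "\<beta>0 = (\<Sum>i<p. A i * U i)"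
definition "\<gamma>0 = (\<Sum>i<p. (U i)\<^sup>2)"
definition "\<kappa> = (\<Sum>i<p. (lam i)\<^sup>2)"
definition "\<tau>2 = (\<Sum>i<p. (A i * lam i)\<^sup>2)"
text \<open>The squared scale \<open>\<sigma>2\<close> splits into \<open>V0\<close>, the deterministic approximation to the
  conditional variance of the products, and \<open>\<tau>2\<close>, the variance contributed by the fluctuation of the sample mean.\<close>

definition "V0 = \<alpha> * (\<gamma>0 + c * (\<kappa> / p)) + \<beta>0\<^sup>2"
definition "\<sigma>2 = V0 + \<tau>2"
text \<open>The vector \<open>Xv x\<close> plays the role of \<open>U\<close> for the sample mean in place of \<open>m\<close>, where \<open>x\<close> is
  row 0 of the rotated array. Likewise \<open>\<beta>\<close> and \<open>\<gamma>\<close> are the random counterparts of \<open>\<beta>0\<close> and \<open>\<gamma>0\<close>, and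
  \<open>D\<close> is the rescaled fluctuation of \<open>\<beta>\<close> around \<open>\<beta>0\<close>.\<close>

definition "Xv x i = U i + lam i * x i / sqrt n"
definition "\<beta> x = (\<Sum>i<p. A i * Xv x i)"
definition "\<gamma> x = (\<Sum>i<p. (Xv x i)\<^sup>2)"
definition "V x = \<alpha> * \<gamma> x + (\<beta> x)\<^sup>2"
definition "D x = (\<Sum>i<p. (A i * lam i) * x i)"
text \<open>The statistic as a function of the rotated array; row 0 is the mean direction.\<close>

definition "T w = sqrt n / sqrt \<sigma>2 *
   ((\<Sum>k\<in>{1..<n}. (\<Sum>i<p. A i * w k i) * (\<Sum>i<p. Xv (w 0) i * w k i)) / (real n - 1) - \<beta>0)"
definition "err = M1 / (m1 * sqrt n) + (sqrt (2 * p) / n + \<bar>p / n - c\<bar>) * (M1\<^sup>2 / m1\<^sup>2) + 1 / sqrt n + 1 / n"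

lemma M1: "0 < M1"
  using lam[of 0] p m1 by simp

lemma alpha_pos: "0 < \<alpha>"
  using A unfolding \<alpha>_def by (auto intro!: sum_pos2)

lemma tau2_ge: "m1\<^sup>2 * \<alpha> \<le> \<tau>2"
  unfolding \<alpha>_def \<tau>2_def sum_distrib_left
proof (rule sum_mono)
  fix i assume "i \<in> {..<p}"
  then have "m1\<^sup>2 \<le> (lam i)\<^sup>2" using lam[of i] m1 by (intro power_mono) auto
  then show "m1\<^sup>2 * (A i)\<^sup>2 \<le> (A i * lam i)\<^sup>2"
    using mult_right_mono[OF _ zero_le_power2, of "m1\<^sup>2" "(lam i)\<^sup>2" "A i"]
    by (simp add: power_mult_distrib mult.commute)
qed

lemma nonneg: "0 \<le> \<gamma>0" "0 \<le> \<kappa>" "0 \<le> \<tau>2" "0 \<le> \<gamma> x" "0 \<le> V x"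
  using alpha_pos by (auto simp: \<gamma>0_def \<kappa>_def \<tau>2_def \<gamma>_def V_def intro!: sum_nonneg add_nonneg_nonneg mult_nonneg_nonneg)

lemma V0_nonneg: "0 \<le> V0"
  using alpha_pos nonneg c unfolding V0_def by (intro add_nonneg_nonneg mult_nonneg_nonneg divide_nonneg_nonneg) auto

lemma sigma2_pos: "0 < \<sigma>2"
proof -
  have "0 < m1\<^sup>2 * \<alpha>" using m1 alpha_pos by simp
  then show ?thesis using tau2_ge V0_nonneg by (simp add: \<sigma>2_def)
qed

lemma sigma2_ge: "\<alpha> * (\<gamma>0 + m1\<^sup>2) \<le> \<sigma>2" "\<beta>0\<^sup>2 + \<tau>2 \<le> \<sigma>2" "\<tau>2 \<le> \<sigma>2"
proof -
  have k: "0 \<le> \<alpha> * (c * (\<kappa> / p))" "0 \<le> \<alpha> * \<gamma>0" using alpha_pos nonneg c by (auto intro!: mult_nonneg_nonneg)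
  have eq: "\<sigma>2 = \<alpha> * \<gamma>0 + \<alpha> * (c * (\<kappa> / p)) + \<beta>0\<^sup>2 + \<tau>2"
    by (simp add: \<sigma>2_def V0_def distrib_left)
  have "\<alpha> * m1\<^sup>2 \<le> \<tau>2" using tau2_ge by (simp add: mult.commute)
  with k zero_le_power2[of \<beta>0] show "\<alpha> * (\<gamma>0 + m1\<^sup>2) \<le> \<sigma>2"
    unfolding eq distrib_left by linarith
  from k show "\<beta>0\<^sup>2 + \<tau>2 \<le> \<sigma>2" unfolding eq by linarith
  then show "\<tau>2 \<le> \<sigma>2" using zero_le_power2[of \<beta>0] by linarith
qed

lemma beta_eq: "\<beta> x = \<beta>0 + D x / sqrt n"
  by (simp add: \<beta>_def \<beta>0_def D_def Xv_def algebra_simps sum.distrib sum_divide_distrib)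

lemma gamma_eq: "\<gamma> x = \<gamma>0 + 2 / sqrt n * (\<Sum>i<p. (U i * lam i) * x i) + (\<Sum>i<p. (lam i)\<^sup>2 * ((x i)\<^sup>2 - 1)) / n + \<kappa> / n"
proof -
  have "(Xv x i)\<^sup>2 = (U i)\<^sup>2 + 2 / sqrt n * (U i * lam i * x i) + (lam i)\<^sup>2 * (x i)\<^sup>2 / n" for i
    using n by (simp add: Xv_def power2_sum power_mult_distrib power_divide)
  then have "\<gamma> x = \<gamma>0 + 2 / sqrt n * (\<Sum>i<p. U i * lam i * x i) + (\<Sum>i<p. (lam i)\<^sup>2 * (x i)\<^sup>2) / n"
    by (simp add: \<gamma>_def \<gamma>0_def sum.distrib sum_distrib_left sum_divide_distrib)
  moreover have "(\<Sum>i<p. (lam i)\<^sup>2 * (x i)\<^sup>2) = (\<Sum>i<p. (lam i)\<^sup>2 * ((x i)\<^sup>2 - 1)) + \<kappa>"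
    by (simp add: \<kappa>_def algebra_simps sum_subtractf)
  ultimately show ?thesis by (simp add: add_divide_distrib)
qed

lemma measurable_V: "V \<in> borel_measurable (gauss_vec p)"
  unfolding V_def[abs_def] \<gamma>_def \<beta>_def Xv_def by simp

text \<open>The uniform concentration of the conditional variance. First absolute moments are bounded by
  standard deviations, and each resulting term is absorbed by a part of the squared scale. The terms
  proportional to \<open>\<alpha>\<close> use \<open>\<alpha> * (\<gamma>0 + m1\<^sup>2) \<le> \<sigma>2\<close>: the deviation of the order \<open>sqrt \<gamma>0\<close> is dominated because
  \<open>2 * m1 * sqrt \<gamma>0 \<le> \<gamma>0 + m1\<^sup>2\<close>, however large the conditional mean is. The terms from \<open>\<beta>\<close> use
  \<open>\<beta>0\<^sup>2 + \<tau>2 \<le> \<sigma>2\<close> in the same manner.\<close>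

lemma expectation_V_close:
  "integrable (gauss_vec p) (\<lambda>x. \<bar>V x / \<sigma>2 - V0 / \<sigma>2\<bar>)"
  "(LINT x|gauss_vec p. \<bar>V x / \<sigma>2 - V0 / \<sigma>2\<bar>) \<le> err"
proof -
  interpret G: prob_space "gauss_vec p" by (rule prob_space_gauss_vec)
  define S1 where "S1 x = (\<Sum>i<p. (U i * lam i) * x i)" for x :: "nat \<Rightarrow> real"
  define S2 where "S2 x = (\<Sum>i<p. (lam i)\<^sup>2 * ((x i)\<^sup>2 - 1))" for x :: "nat \<Rightarrow> real"
  note S1 = gauss_vec_linear_abs(1,2)[of p "\<lambda>i. U i * lam i", folded S1_def]
  note S2 = gauss_vec_chi_square_abs[of p "\<lambda>i. (lam i)\<^sup>2", folded S2_def]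
  note D = gauss_vec_linear_abs[of p "\<lambda>i. A i * lam i", folded D_def \<tau>2_def]
  define K where "K = \<bar>p / n - c\<bar> * M1\<^sup>2"
  define g where "g x = \<alpha> * (2 / sqrt n * \<bar>S1 x\<bar> + \<bar>S2 x\<bar> / n + K) + (2 * \<bar>\<beta>0\<bar> / sqrt n * \<bar>D x\<bar> + (D x)\<^sup>2 / n)" for x
  have bound: "\<bar>V x - V0\<bar> \<le> g x" for x
  proof -
    have "\<kappa> \<le> (\<Sum>i<p. M1\<^sup>2)" unfolding \<kappa>_def
      using lam m1 by (intro sum_mono power_mono) (auto intro: order_trans less_imp_le)
    then have k: "\<kappa> / p \<le> M1\<^sup>2" "0 \<le> \<kappa> / p" using p nonneg by (auto simp: field_simps)
    have "\<bar>\<kappa> / n - c * (\<kappa> / p)\<bar> = \<bar>p / n - c\<bar> * (\<kappa> / p)"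
    proof -
      have "\<kappa> / n - c * (\<kappa> / p) = (p / n - c) * (\<kappa> / p)" using p by (simp add: field_simps)
      then show ?thesis using nonneg(2) by (simp add: abs_mult)
    qed
    also have "\<dots> \<le> K" unfolding K_def using k by (intro mult_left_mono) auto
    finally have K: "\<bar>\<kappa> / n - c * (\<kappa> / p)\<bar> \<le> K" .
    have "\<bar>\<gamma> x - (\<gamma>0 + c * (\<kappa> / p))\<bar> = \<bar>2 / sqrt n * S1 x + S2 x / n + (\<kappa> / n - c * (\<kappa> / p))\<bar>"
      by (simp add: gamma_eq S1_def S2_def)
    also have "\<dots> \<le> \<bar>2 / sqrt n * S1 x\<bar> + \<bar>S2 x / n\<bar> + \<bar>\<kappa> / n - c * (\<kappa> / p)\<bar>"
      by (rule order_trans[OF abs_triangle_ineq add_mono[OF abs_triangle_ineq order_refl]])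
    also have "\<dots> \<le> 2 / sqrt n * \<bar>S1 x\<bar> + \<bar>S2 x\<bar> / n + K"
      using K by (simp add: abs_mult)
    finally have 1: "\<bar>\<gamma> x - (\<gamma>0 + c * (\<kappa> / p))\<bar> \<le> 2 / sqrt n * \<bar>S1 x\<bar> + \<bar>S2 x\<bar> / n + K" .
    have "(\<beta> x)\<^sup>2 - \<beta>0\<^sup>2 = 2 * \<beta>0 / sqrt n * D x + (D x)\<^sup>2 / n"
      using n by (simp add: beta_eq power2_sum power_divide)
    then have "\<bar>(\<beta> x)\<^sup>2 - \<beta>0\<^sup>2\<bar> \<le> \<bar>2 * \<beta>0 / sqrt n * D x\<bar> + \<bar>(D x)\<^sup>2 / n\<bar>" by linarith
    then have 2: "\<bar>(\<beta> x)\<^sup>2 - \<beta>0\<^sup>2\<bar> \<le> 2 * \<bar>\<beta>0\<bar> / sqrt n * \<bar>D x\<bar> + (D x)\<^sup>2 / n" by (simp add: abs_mult)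
    have "\<bar>V x - V0\<bar> = \<bar>\<alpha> * (\<gamma> x - (\<gamma>0 + c * (\<kappa> / p))) + ((\<beta> x)\<^sup>2 - \<beta>0\<^sup>2)\<bar>"
      by (simp add: V_def V0_def algebra_simps)
    also have "\<dots> \<le> \<alpha> * \<bar>\<gamma> x - (\<gamma>0 + c * (\<kappa> / p))\<bar> + \<bar>(\<beta> x)\<^sup>2 - \<beta>0\<^sup>2\<bar>"
      using alpha_pos by (metis abs_mult abs_of_pos abs_triangle_ineq)
    also have "\<dots> \<le> g x"
      unfolding g_def using 1 2 alpha_pos by (intro add_mono mult_left_mono) auto
    finally show ?thesis .
  qed
  have intg: "integrable (gauss_vec p) g"
    unfolding g_def using S1(1) S2(1) D by simp
  have ptw: "\<bar>V x / \<sigma>2 - V0 / \<sigma>2\<bar> \<le> g x / \<sigma>2" for x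
  proof -
    have "\<bar>V x / \<sigma>2 - V0 / \<sigma>2\<bar> = \<bar>V x - V0\<bar> / \<sigma>2"
      using sigma2_pos by (simp add: diff_divide_distrib[symmetric] abs_divide)
    then show ?thesis using bound[of x] sigma2_pos by (simp add: divide_right_mono)
  qed
  have [measurable]: "V \<in> borel_measurable (gauss_vec p)" by (rule measurable_V)
  show int: "integrable (gauss_vec p) (\<lambda>x. \<bar>V x / \<sigma>2 - V0 / \<sigma>2\<bar>)"
  proof (rule Bochner_Integration.integrable_bound[of _ "\<lambda>x. g x / \<sigma>2"])
    show "AE x in gauss_vec p. norm \<bar>V x / \<sigma>2 - V0 / \<sigma>2\<bar> \<le> norm (g x / \<sigma>2)"
      unfolding real_norm_def abs_idempotent by (intro AE_I2 order_trans[OF ptw abs_ge_self])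
  qed (use intg in auto)
  have "(LINT x|gauss_vec p. \<bar>V x / \<sigma>2 - V0 / \<sigma>2\<bar>) \<le> (LINT x|gauss_vec p. g x / \<sigma>2)"
    by (rule integral_mono) (use int intg ptw in auto)
  also have "\<dots> = (\<alpha> * (2 / sqrt n * G.expectation (\<lambda>x. \<bar>S1 x\<bar>) + G.expectation (\<lambda>x. \<bar>S2 x\<bar>) / n + K)
      + (2 * \<bar>\<beta>0\<bar> / sqrt n * G.expectation (\<lambda>x. \<bar>D x\<bar>) + \<tau>2 / n)) / \<sigma>2"
    unfolding g_def using S1(1) S2(1) D by (simp add: G.prob_space)
  also have "\<dots> \<le> (\<alpha> * (2 / sqrt n * (M1 * sqrt \<gamma>0) + sqrt (2 * p) * M1\<^sup>2 / n + K)
      + (2 * \<bar>\<beta>0\<bar> / sqrt n * sqrt \<tau>2 + \<tau>2 / n)) / \<sigma>2"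
  proof (intro divide_right_mono add_mono mult_left_mono order_refl)
    have "(\<Sum>i<p. (U i * lam i)\<^sup>2) \<le> M1\<^sup>2 * \<gamma>0"
      unfolding \<gamma>0_def sum_distrib_left power_mult_distrib
    proof (rule sum_mono)
      fix i assume "i \<in> {..<p}"
      then have "(lam i)\<^sup>2 \<le> M1\<^sup>2" using lam[of i] m1 by (intro power_mono) auto
      then show "(U i)\<^sup>2 * (lam i)\<^sup>2 \<le> M1\<^sup>2 * (U i)\<^sup>2" using mult_right_mono[OF _ zero_le_power2, of "(lam i)\<^sup>2" "M1\<^sup>2" "U i"] by (simp add: mult.commute)
    qed
    then have "sqrt (\<Sum>i<p. (U i * lam i)\<^sup>2) \<le> sqrt (M1\<^sup>2 * \<gamma>0)" by simp
    also have "\<dots> = M1 * sqrt \<gamma>0" using M1 by (simp add: real_sqrt_mult)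
    finally show "G.expectation (\<lambda>x. \<bar>S1 x\<bar>) \<le> M1 * sqrt \<gamma>0" using S1(2) by linarith
    have "(\<Sum>i<p. ((lam i)\<^sup>2)\<^sup>2) \<le> (\<Sum>i<p. (M1\<^sup>2)\<^sup>2)"
      using lam m1 by (intro sum_mono power_mono) (auto intro: order_trans less_imp_le)
    then have "sqrt (2 * (\<Sum>i<p. ((lam i)\<^sup>2)\<^sup>2)) \<le> sqrt (2 * p * (M1\<^sup>2)\<^sup>2)" by simp
    also have "\<dots> = sqrt (2 * p) * M1\<^sup>2"
      by (simp only: real_sqrt_mult real_sqrt_abs abs_power2)
    finally show "G.expectation (\<lambda>x. \<bar>S2 x\<bar>) \<le> sqrt (2 * p) * M1\<^sup>2" using S2(2) by linarith
    show "G.expectation (\<lambda>x. \<bar>D x\<bar>) \<le> sqrt \<tau>2" by (rule D(2))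
  qed (use alpha_pos sigma2_pos in auto)
  also have "\<dots> \<le> err"
  proof -
    have 1: "\<alpha> * (2 / sqrt n * (M1 * sqrt \<gamma>0)) \<le> \<sigma>2 * (M1 / (m1 * sqrt n))"
    proof -
      have "2 * sqrt \<gamma>0 * m1 \<le> \<gamma>0 + m1\<^sup>2"
        using zero_le_power2[of "sqrt \<gamma>0 - m1"] nonneg by (simp add: power2_diff)
      then have "\<alpha> * (2 * sqrt \<gamma>0 * m1) \<le> \<alpha> * (\<gamma>0 + m1\<^sup>2)" using alpha_pos by (intro mult_left_mono) auto
      then have "\<alpha> * (2 * sqrt \<gamma>0 * m1) \<le> \<sigma>2" using sigma2_ge(1) by linarith
      then have "\<alpha> * (2 * sqrt \<gamma>0 * m1) * (M1 / (m1 * sqrt n)) \<le> \<sigma>2 * (M1 / (m1 * sqrt n))"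
        using M1 m1 by (intro mult_right_mono) auto
      also have "\<alpha> * (2 * sqrt \<gamma>0 * m1) * (M1 / (m1 * sqrt n)) = \<alpha> * (2 / sqrt n * (M1 * sqrt \<gamma>0))"
        using m1 by simp
      finally show ?thesis .
    qed
    have 2: "\<alpha> * (sqrt (2 * p) * M1\<^sup>2 / n + K) \<le> \<sigma>2 * ((sqrt (2 * p) / n + \<bar>p / n - c\<bar>) * (M1\<^sup>2 / m1\<^sup>2))"
    proof -
      have "\<alpha> * m1\<^sup>2 \<le> \<alpha> * (\<gamma>0 + m1\<^sup>2)" using alpha_pos nonneg by (intro mult_left_mono) auto
      then have "\<alpha> * m1\<^sup>2 \<le> \<sigma>2" using sigma2_ge(1) by linarith
      then have "\<alpha> * m1\<^sup>2 * ((sqrt (2 * p) / n + \<bar>p / n - c\<bar>) * (M1\<^sup>2 / m1\<^sup>2)) \<le> \<sigma>2 * ((sqrt (2 * p) / n + \<bar>p / n - c\<bar>) * (M1\<^sup>2 / m1\<^sup>2))"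
        by (intro mult_right_mono) auto
      also have "\<alpha> * m1\<^sup>2 * ((sqrt (2 * p) / n + \<bar>p / n - c\<bar>) * (M1\<^sup>2 / m1\<^sup>2)) = \<alpha> * (sqrt (2 * p) * M1\<^sup>2 / n + K)"
        using m1 by (simp add: K_def algebra_simps)
      finally show ?thesis .
    qed
    have 3: "2 * \<bar>\<beta>0\<bar> / sqrt n * sqrt \<tau>2 \<le> \<sigma>2 * (1 / sqrt n)"
    proof -
      have "2 * \<bar>\<beta>0\<bar> * sqrt \<tau>2 \<le> \<beta>0\<^sup>2 + \<tau>2"
        using zero_le_power2[of "\<bar>\<beta>0\<bar> - sqrt \<tau>2"] nonneg by (simp add: power2_diff)
      then have "2 * \<bar>\<beta>0\<bar> * sqrt \<tau>2 \<le> \<sigma>2" using sigma2_ge(2) by linarith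
      then have "2 * \<bar>\<beta>0\<bar> * sqrt \<tau>2 * (1 / sqrt n) \<le> \<sigma>2 * (1 / sqrt n)" by (intro mult_right_mono) auto
      then show ?thesis by simp
    qed
    have 4: "\<tau>2 / n \<le> \<sigma>2 * (1 / n)" using sigma2_ge(3) by (simp add: divide_right_mono)
    have "\<alpha> * (2 / sqrt n * (M1 * sqrt \<gamma>0) + sqrt (2 * p) * M1\<^sup>2 / n + K) + (2 * \<bar>\<beta>0\<bar> / sqrt n * sqrt \<tau>2 + \<tau>2 / n)
       = \<alpha> * (2 / sqrt n * (M1 * sqrt \<gamma>0)) + \<alpha> * (sqrt (2 * p) * M1\<^sup>2 / n + K) + 2 * \<bar>\<beta>0\<bar> / sqrt n * sqrt \<tau>2 + \<tau>2 / n"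
      by (simp only: distrib_left add.assoc)
    also have "\<dots> \<le> \<sigma>2 * (M1 / (m1 * sqrt n)) + \<sigma>2 * ((sqrt (2 * p) / n + \<bar>p / n - c\<bar>) * (M1\<^sup>2 / m1\<^sup>2))
        + \<sigma>2 * (1 / sqrt n) + \<sigma>2 * (1 / n)"
      by (intro add_mono 1 2 3 4)
    also have "\<dots> = err * \<sigma>2"
    proof -
      have "d * a1 + d * a2 + d * a3 + d * a4 = (a1 + a2 + a3 + a4) * d" for d a1 a2 a3 a4 :: real
        by (simp add: algebra_simps)
      then show ?thesis unfolding err_def .
    qed
    finally show ?thesis using sigma2_pos by (simp only: pos_divide_le_eq)
  qed
  finally show "(LINT x|gauss_vec p. \<bar>V x / \<sigma>2 - V0 / \<sigma>2\<bar>) \<le> err" .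
qed


lemma measurable_T: "T \<in> borel_measurable (PiM {..<n} (\<lambda>_. gauss_vec p))"
proof -
  have entry: "(\<lambda>w. w k i) \<in> borel_measurable (PiM {..<n} (\<lambda>_. gauss_vec p))" if "k < n" "i < p" for k i
    using that by (intro measurable_compose[OF measurable_component_singleton[of k "{..<n}" "\<lambda>_. gauss_vec p"] measurable_gauss_vec_entry[of i p]]) auto
  show ?thesis unfolding T_def[abs_def] Xv_def
    by (intro borel_measurable_times borel_measurable_sum borel_measurable_diff borel_measurable_add borel_measurable_divide
        borel_measurable_const entry) (use n in auto)
qed

text \<open>The frequency at which each single product enters the characteristic function of \<open>T\<close> at \<open>t\<close>.\<close>

definition "freq t = t * sqrt n / (sqrt \<sigma>2 * (real n - 1))"

text \<open>The conditional characteristic function of the centred sum of products, given that row 0 of the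
  array is \<open>x\<close>.\<close>

definition "\<Psi> t x = (LINT w|PiM {1..<n} (\<lambda>_. gauss_vec p).
   iexp (freq t * (\<Sum>k\<in>{1..<n}. (\<Sum>i<p. A i * w k i) * (\<Sum>i<p. Xv x i * w k i) - \<beta> x)))"

lemma measurable_\<Psi>: "\<Psi> t \<in> borel_measurable (gauss_vec p)"
proof -
  let ?J = "PiM {1..<n} (\<lambda>_. gauss_vec p)"
  interpret G: prob_space "gauss_vec p" by (rule prob_space_gauss_vec)
  interpret J: prob_space ?J by (rule prob_space_PiM) (rule prob_space_gauss_vec)
  have c1: "(\<lambda>z. snd z k i) \<in> borel_measurable (gauss_vec p \<Otimes>\<^sub>M ?J)" if "k \<in> {1..<n}" "i < p" for k i
  proof -
    have "(\<lambda>z. snd z k) \<in> measurable (gauss_vec p \<Otimes>\<^sub>M ?J) (gauss_vec p)"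
      by (rule measurable_compose[OF measurable_snd]) (rule measurable_component_singleton[OF that(1)])
    from measurable_compose[OF this measurable_gauss_vec_entry[OF that(2)]] show ?thesis .
  qed
  have c2: "(\<lambda>z. fst z i) \<in> borel_measurable (gauss_vec p \<Otimes>\<^sub>M ?J)" if "i < p" for i
    using measurable_compose[OF measurable_fst measurable_gauss_vec_entry[OF that]] .
  have "(\<lambda>z. freq t * (\<Sum>k\<in>{1..<n}. (\<Sum>i<p. A i * snd z k i) * (\<Sum>i<p. Xv (fst z) i * snd z k i) - \<beta> (fst z)))
      \<in> borel_measurable (gauss_vec p \<Otimes>\<^sub>M ?J)"
    unfolding \<beta>_def Xv_def
    by (intro borel_measurable_times borel_measurable_sum borel_measurable_diff borel_measurable_add borel_measurable_divide borel_measurable_const c1 c2) auto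
  then have "(\<lambda>z. iexp (freq t * (\<Sum>k\<in>{1..<n}. (\<Sum>i<p. A i * snd z k i) * (\<Sum>i<p. Xv (fst z) i * snd z k i) - \<beta> (fst z))))
      \<in> borel_measurable (gauss_vec p \<Otimes>\<^sub>M ?J)"
    by measurable
  then have "(\<lambda>(x, w). iexp (freq t * (\<Sum>k\<in>{1..<n}. (\<Sum>i<p. A i * w k i) * (\<Sum>i<p. Xv x i * w k i) - \<beta> x)))
      \<in> borel_measurable (gauss_vec p \<Otimes>\<^sub>M ?J)"
    by (simp add: case_prod_beta')
  then show ?thesis unfolding \<Psi>_def[abs_def] by (rule J.borel_measurable_lebesgue_integral)
qed

text \<open>Conditioning on row 0: the centring at \<open>\<beta>0\<close> is replaced by the one at the conditional mean \<open>\<beta> x\<close>, at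
  the price of the factor with \<open>D x\<close>.\<close>

lemma char_T_conditional:
  "(LINT w|PiM {..<n} (\<lambda>_. gauss_vec p). iexp (t * T w)) = (LINT x|gauss_vec p. iexp (t / sqrt \<sigma>2 * D x) * \<Psi> t x)"
proof -
  interpret G: prob_space "gauss_vec p" by (rule prob_space_gauss_vec)
  interpret PG: product_prob_space "\<lambda>_::nat. gauss_vec p" by unfold_locales
  interpret Q: prob_space "PiM {..<n} (\<lambda>_. gauss_vec p)" by (rule prob_space_PiM) (rule prob_space_gauss_vec)
  let ?J = "{1..<n}"
  have un: "{..<n} = {0} \<union> ?J" using n by auto
  have N: "real n - 1 \<noteq> 0" using n by simp
  have tT: "t * T w = t / sqrt \<sigma>2 * D (w 0)
      + freq t * (\<Sum>k\<in>?J. (\<Sum>i<p. A i * w k i) * (\<Sum>i<p. Xv (w 0) i * w k i) - \<beta> (w 0))" for w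
  proof -
    define S where "S = (\<Sum>k\<in>?J. (\<Sum>i<p. A i * w k i) * (\<Sum>i<p. Xv (w 0) i * w k i))"
    have s: "freq t * (real n - 1) = t * sqrt n / sqrt \<sigma>2" using N by (simp add: freq_def)
    have "freq t * (\<Sum>k\<in>?J. (\<Sum>i<p. A i * w k i) * (\<Sum>i<p. Xv (w 0) i * w k i) - \<beta> (w 0))
        = freq t * S - freq t * (real n - 1) * \<beta> (w 0)"
      using n by (simp add: sum_subtractf S_def algebra_simps of_nat_diff)
    also have "\<dots> = freq t * S - t * sqrt n / sqrt \<sigma>2 * \<beta>0 - t / sqrt \<sigma>2 * D (w 0)"
      unfolding s using n by (simp add: beta_eq algebra_simps)
    also have "freq t * S - t * sqrt n / sqrt \<sigma>2 * \<beta>0 = t * T w"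
      by (simp add: T_def S_def freq_def algebra_simps)
    finally show ?thesis by simp
  qed
  have [measurable]: "T \<in> borel_measurable (PiM {..<n} (\<lambda>_. gauss_vec p))" by (rule measurable_T)
  have int: "integrable (PiM {..<n} (\<lambda>_. gauss_vec p)) (\<lambda>w. iexp (t * T w))"
    by (rule Q.integrable_const_bound[where B=1]) auto
  have "(LINT w|PiM {..<n} (\<lambda>_. gauss_vec p). iexp (t * T w))
      = (LINT x|PiM {0} (\<lambda>_. gauss_vec p). LINT y|PiM ?J (\<lambda>_. gauss_vec p). iexp (t * T (merge {0} ?J (x, y))))"
    unfolding un by (rule PG.product_integral_fold) (use int un in auto)
  also have "\<dots> = (LINT x|PiM {0::nat} (\<lambda>_. gauss_vec p). iexp (t / sqrt \<sigma>2 * D (x 0)) * \<Psi> t (x 0))"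
  proof (rule Bochner_Integration.integral_cong)
    fix x :: "nat \<Rightarrow> nat \<Rightarrow> real"
    have m: "merge {0} ?J (x, y) 0 = x 0" "k \<in> ?J \<Longrightarrow> merge {0} ?J (x, y) k = y k" for y k
      by (auto simp: merge_def)
    have "iexp (t * T (merge {0} ?J (x, y))) = iexp (t / sqrt \<sigma>2 * D (x 0))
      * iexp (freq t * (\<Sum>k\<in>?J. (\<Sum>i<p. A i * y k i) * (\<Sum>i<p. Xv (x 0) i * y k i) - \<beta> (x 0)))" for y
      unfolding tT m(1) of_real_add distrib_left exp_add
      by (intro arg_cong2[where f="(*)"] refl arg_cong[where f=exp] arg_cong[where f="(*) \<i>"] arg_cong[where f=complex_of_real] arg_cong[where f="(*) (freq t)"] sum.cong)
        (auto simp: m(2))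
    then show "(LINT y|PiM ?J (\<lambda>_. gauss_vec p). iexp (t * T (merge {0} ?J (x, y)))) = iexp (t / sqrt \<sigma>2 * D (x 0)) * \<Psi> t (x 0)"
      unfolding \<Psi>_def by (simp only: integral_mult_right_zero)
  qed (rule refl)
  also have "\<dots> = (LINT x|gauss_vec p. iexp (t / sqrt \<sigma>2 * D x) * \<Psi> t x)"
  proof (rule PG.product_integral_singleton)
    have [measurable]: "D \<in> borel_measurable (gauss_vec p)" unfolding D_def[abs_def] by simp
    show "(\<lambda>x. iexp (t / sqrt \<sigma>2 * D x) * \<Psi> t x) \<in> borel_measurable (gauss_vec p)"
      using measurable_\<Psi>[of t] by measurable
  qed
  finally show ?thesis .
qed

text \<open>If the conditional variance is at most twice the squared scale, the central limit theorem above
  applies with a standardised frequency of order \<open>1 / sqrt n\<close>. Otherwise the conditional variance is far from \<open>V0\<close>, and the trivial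
  bound 2 for the difference of two characteristic functions is already of the right form. What
  is left is the distance of two normal characteristic functions with different variances.\<close>

lemma \<Psi>_close:
  "cmod (\<Psi> t x - of_real (exp (- (t\<^sup>2 * (V0 / \<sigma>2)) / 2)))
    \<le> (568 * \<bar>t\<bar> ^ 3 + 16 * t ^ 4 + t\<^sup>2) / sqrt (real n - 1) + (2 + t\<^sup>2) * \<bar>V x / \<sigma>2 - V0 / \<sigma>2\<bar>"
proof -
  define N where "N = real n - 1"
  have N: "1 \<le> N" "real n \<le> 2 * N" "real (card {1..<n}) = N" "real n / N = 1 + 1 / N"
    using n by (auto simp: N_def of_nat_diff field_simps)
  define R where "R = V x / \<sigma>2"
  define R0 where "R0 = V0 / \<sigma>2"
  have R: "0 \<le> R" "0 \<le> R0" "R0 \<le> 1"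
    using nonneg V0_nonneg sigma2_pos by (auto simp: R_def R0_def \<sigma>2_def)
  have "(freq t)\<^sup>2 = t\<^sup>2 * real n / (\<sigma>2 * N\<^sup>2)"
    using sigma2_pos by (simp add: freq_def N_def power_divide power_mult_distrib)
  then have sV: "(freq t)\<^sup>2 * V x = t\<^sup>2 * (real n / N) * R / N"
    by (simp add: R_def power2_eq_square)
  let ?e1 = "exp (- (N * ((freq t)\<^sup>2 * V x)) / 2)"
  let ?e2 = "exp (- (t\<^sup>2 * R0) / 2)"
  note approx = product_sum_char_approx[where K="{1..<n}" and p=p and A=A and B="Xv x" and s="freq t", OF finite_atLeastLessThan,
      folded \<alpha>_def \<beta>_def \<gamma>_def, folded V_def \<Psi>_def, unfolded N(3)]
  have exp_lip: "\<bar>exp (- a) - exp (- b)\<bar> \<le> \<bar>a - b\<bar>" if "0 \<le> a" "0 \<le> b" for a b :: real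
  proof -
    have "exp (- a) - exp (- b) \<le> b - a" if "0 \<le> a" "a \<le> b" for a b :: real
    proof -
      have "exp (- a) - exp (- b) = exp (- a) * (1 - exp (- (b - a)))"
        by (simp add: algebra_simps exp_add[symmetric])
      also have "\<dots> \<le> 1 * (1 - exp (- (b - a)))"
        using that by (intro mult_right_mono) auto
      also have "\<dots> = 1 - exp (- (b - a))" by (rule mult_1_left)
      also have "\<dots> \<le> b - a" using exp_ge_add_one_self[of "- (b - a)"] by linarith
      finally show ?thesis .
    qed
    from this[of a b] this[of b a] that show ?thesis by (cases "a \<le> b") auto
  qed
  have first: "cmod (\<Psi> t x - of_real ?e1) \<le> (568 * \<bar>t\<bar> ^ 3 + 16 * t ^ 4) / sqrt N + 2 * \<bar>R - R0\<bar>"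
  (* 568 = 71 * 2 ^ 3 and 16 = 2 ^ 4, from r \<le> 2 * \<bar>t\<bar> / sqrt N in the error 71 * r ^ 3 + r ^ 4 *)
  proof (cases "R \<le> 2")
    case True
    define r where "r = \<bar>freq t\<bar> * sqrt (V x)"
    have r0: "0 \<le> r" using nonneg by (simp add: r_def)
    have "r\<^sup>2 = t\<^sup>2 * (real n / N) * R / N"
      using sV nonneg by (simp add: r_def power_mult_distrib)
    also have "\<dots> \<le> t\<^sup>2 * 2 * 2 / N"
      using N True R by (intro divide_right_mono mult_mono) (auto simp: field_simps)
    also have "\<dots> = (2 * \<bar>t\<bar> / sqrt N)\<^sup>2" using N by (simp add: power_divide power_mult_distrib)
    finally have r: "r \<le> 2 * \<bar>t\<bar> / sqrt N" by (rule power2_le_imp_le) (use N in auto)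
    have sN: "sqrt N * sqrt N = N" "1 \<le> sqrt N" using N by auto
    have "N * (71 * r ^ 3 + r ^ 4) \<le> N * (71 * (2 * \<bar>t\<bar> / sqrt N) ^ 3 + (2 * \<bar>t\<bar> / sqrt N) ^ 4)"
      using r r0 N by (intro mult_left_mono add_mono power_mono) auto
    also have "\<dots> = 568 * \<bar>t\<bar> ^ 3 / sqrt N + 16 * t ^ 4 / N"
    proof -
      have "N * (71 * (2 * a / q) ^ 3 + (2 * a / q) ^ 4) = 568 * a ^ 3 / q + 16 * a ^ 4 / N"
        if "q * q = N" "0 < q" for a q :: real
        using that(2) unfolding that(1)[symmetric] by (simp add: field_simps power3_eq_cube power4_eq_xxxx)
      from this[OF sN(1), of "\<bar>t\<bar>"] N show ?thesis by simp
    qed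
    also have "\<dots> \<le> 568 * \<bar>t\<bar> ^ 3 / sqrt N + 16 * t ^ 4 / sqrt N"
    proof (intro add_left_mono divide_left_mono)
      show "sqrt N \<le> N" using sN mult_left_mono[of 1 "sqrt N" "sqrt N"] by simp
    qed (use N in auto)
    also have "\<dots> = (568 * \<bar>t\<bar> ^ 3 + 16 * t ^ 4) / sqrt N" by (simp add: add_divide_distrib)
    finally have "cmod (\<Psi> t x - of_real ?e1) \<le> (568 * \<bar>t\<bar> ^ 3 + 16 * t ^ 4) / sqrt N"
      unfolding r_def by (rule order_trans[OF approx(1)])
    also have "\<dots> \<le> (568 * \<bar>t\<bar> ^ 3 + 16 * t ^ 4) / sqrt N + 2 * \<bar>R - R0\<bar>" by simp
    finally show ?thesis .
  next
    case False
    have "cmod (\<Psi> t x - of_real ?e1) \<le> cmod (\<Psi> t x) + cmod (of_real ?e1)" by (rule norm_triangle_ineq4)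
    also have "\<dots> \<le> 1 + 1"
      using approx(2) nonneg(5)[of x] N by (intro add_mono) auto
    also have "\<dots> \<le> 2 * \<bar>R - R0\<bar>"
    proof -
      have "1 \<le> R - R0" using False R by simp
      then show ?thesis by simp
    qed
    also have "\<dots> \<le> (568 * \<bar>t\<bar> ^ 3 + 16 * t ^ 4) / sqrt N + 2 * \<bar>R - R0\<bar>" using N by simp
    finally show ?thesis .
  qed
  have "N * ((freq t)\<^sup>2 * V x) = t\<^sup>2 * (real n / N) * R" unfolding sV using N by simp
  then have e1: "?e1 = exp (- (t\<^sup>2 * (real n / N) * R / 2))" by simp
  have "\<bar>?e1 - ?e2\<bar> \<le> \<bar>t\<^sup>2 * (real n / N) * R / 2 - t\<^sup>2 * R0 / 2\<bar>"
    unfolding e1 using exp_lip[of "t\<^sup>2 * (real n / N) * R / 2" "t\<^sup>2 * R0 / 2"] R N by simp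
  also have "t\<^sup>2 * (real n / N) * R / 2 - t\<^sup>2 * R0 / 2 = t\<^sup>2 / 2 * ((real n / N) * (R - R0) + R0 / N)"
  proof -
    have "t\<^sup>2 * (1 + w) * R / 2 - t\<^sup>2 * R0 / 2 = t\<^sup>2 / 2 * ((1 + w) * (R - R0) + R0 * w)" for w
      by (simp add: algebra_simps)
    from this[of "1 / N"] show ?thesis unfolding N(4) by simp
  qed
  also have "\<bar>\<dots>\<bar> \<le> t\<^sup>2 / 2 * (2 * \<bar>R - R0\<bar> + 1 / sqrt N)"
  proof -
    have "\<bar>(real n / N) * (R - R0) + R0 / N\<bar> \<le> \<bar>(real n / N) * (R - R0)\<bar> + \<bar>R0 / N\<bar>" by (rule abs_triangle_ineq)
    also have "\<dots> = (real n / N) * \<bar>R - R0\<bar> + R0 / N" using R N by (simp add: abs_mult)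
    also have "\<dots> \<le> 2 * \<bar>R - R0\<bar> + 1 / sqrt N"
    proof (intro add_mono mult_right_mono frac_le)
      show "sqrt N \<le> N" using N by (simp add: real_le_lsqrt power2_eq_square)
      show "real n / N \<le> 2" using N by (simp add: field_simps)
    qed (use N R in auto)
    finally have "\<bar>(real n / N) * (R - R0) + R0 / N\<bar> \<le> 2 * \<bar>R - R0\<bar> + 1 / sqrt N" .
    then show ?thesis by (simp only: abs_mult) (intro mult_mono, auto)
  qed
  also have "\<dots> \<le> t\<^sup>2 * \<bar>R - R0\<bar> + t\<^sup>2 / sqrt N"
  proof -
    have "0 \<le> t\<^sup>2 / sqrt N" using N by simp
    moreover have "t\<^sup>2 / 2 * (2 * \<bar>R - R0\<bar> + 1 / sqrt N) = t\<^sup>2 * \<bar>R - R0\<bar> + t\<^sup>2 / sqrt N / 2"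
      by (simp add: distrib_left)
    ultimately show ?thesis by simp
  qed
  finally have second: "\<bar>?e1 - ?e2\<bar> \<le> t\<^sup>2 * \<bar>R - R0\<bar> + t\<^sup>2 / sqrt N" .
  have "cmod (\<Psi> t x - of_real ?e2) \<le> cmod (\<Psi> t x - of_real ?e1) + cmod (of_real ?e1 - of_real ?e2)"
    using dist_triangle[of "\<Psi> t x" "of_real ?e2" "of_real ?e1"] by (simp only: dist_norm)
  also have "cmod (of_real ?e1 - of_real ?e2) = \<bar>?e1 - ?e2\<bar>"
    by (simp only: of_real_diff[symmetric] norm_of_real)
  also have "cmod (\<Psi> t x - of_real ?e1) + \<bar>?e1 - ?e2\<bar>
      \<le> ((568 * \<bar>t\<bar> ^ 3 + 16 * t ^ 4) / sqrt N + 2 * \<bar>R - R0\<bar>) + (t\<^sup>2 * \<bar>R - R0\<bar> + t\<^sup>2 / sqrt N)"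
    by (rule add_mono[OF first second])
  also have "\<dots> = (568 * \<bar>t\<bar> ^ 3 + 16 * t ^ 4 + t\<^sup>2) / sqrt N + (2 + t\<^sup>2) * \<bar>R - R0\<bar>"
    by (simp add: add_divide_distrib algebra_simps)
  finally show ?thesis by (simp only: R_def R0_def N_def)
qed

text \<open>The variable \<open>D\<close> is exactly normal with variance \<open>\<tau>2\<close>. With the conditional
  characteristic function replaced by the normal one for the variance \<open>V0 / \<sigma>2\<close>, the remaining integral is therefore explicit, and
  \<open>\<tau>2\<close> completes \<open>V0\<close> to \<open>\<sigma>2\<close>.\<close>

lemma char_T_bound:
  "cmod ((LINT w|PiM {..<n} (\<lambda>_. gauss_vec p). iexp (t * T w)) - of_real (exp (- (t\<^sup>2) / 2)))
    \<le> (568 * \<bar>t\<bar> ^ 3 + 16 * t ^ 4 + t\<^sup>2) / sqrt (real n - 1) + (2 + t\<^sup>2) * err"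
proof -
  interpret G: prob_space "gauss_vec p" by (rule prob_space_gauss_vec)
  let ?c = "complex_of_real (exp (- (t\<^sup>2 * (V0 / \<sigma>2)) / 2))"
  let ?K = "(568 * \<bar>t\<bar> ^ 3 + 16 * t ^ 4 + t\<^sup>2) / sqrt (real n - 1)"
  have [measurable]: "D \<in> borel_measurable (gauss_vec p)" unfolding D_def[abs_def] by simp
  have [measurable]: "\<Psi> t \<in> borel_measurable (gauss_vec p)" by (rule measurable_\<Psi>)
  have \<Psi>1: "cmod (\<Psi> t x) \<le> 1" for x
    unfolding \<Psi>_def \<beta>_def by (rule product_sum_char_approx(2)) simp
  have int: "integrable (gauss_vec p) (\<lambda>x. iexp (t / sqrt \<sigma>2 * D x) * \<Psi> t x)"
    "integrable (gauss_vec p) (\<lambda>x. iexp (t / sqrt \<sigma>2 * D x) * ?c)"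
  proof -
    show "integrable (gauss_vec p) (\<lambda>x. iexp (t / sqrt \<sigma>2 * D x) * \<Psi> t x)"
      by (rule G.integrable_const_bound[where B=1]) (use \<Psi>1 in \<open>auto simp: norm_mult\<close>)
    show "integrable (gauss_vec p) (\<lambda>x. iexp (t / sqrt \<sigma>2 * D x) * ?c)"
      by (intro integrable_mult_left G.integrable_const_bound[where B=1]) auto
  qed
  have "(LINT x|gauss_vec p. iexp (t / sqrt \<sigma>2 * D x) * ?c) = of_real (exp (- ((t / sqrt \<sigma>2)\<^sup>2 * \<tau>2) / 2)) * ?c"
    using gaussian_linear_char[where I="{..<p}" and A="\<lambda>i. A i * lam i" and t="t / sqrt \<sigma>2", OF finite_lessThan, folded D_def \<tau>2_def]
    by (simp only: integral_mult_left_zero)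
  also have "\<dots> = of_real (exp (- (t\<^sup>2) / 2))"
  proof -
    have "- ((t / sqrt \<sigma>2)\<^sup>2 * \<tau>2) / 2 + - (t\<^sup>2 * (V0 / \<sigma>2)) / 2 = - (t\<^sup>2 * ((\<tau>2 + V0) / \<sigma>2)) / 2"
      using sigma2_pos by (simp add: power_divide field_simps)
    also have "(\<tau>2 + V0) / \<sigma>2 = 1" using sigma2_pos by (simp add: \<sigma>2_def)
    finally show ?thesis by (simp only: of_real_mult[symmetric] exp_add[symmetric] mult_1_right)
  qed
  finally have lim: "(LINT x|gauss_vec p. iexp (t / sqrt \<sigma>2 * D x) * ?c) = of_real (exp (- (t\<^sup>2) / 2))" .
  have "cmod ((LINT w|PiM {..<n} (\<lambda>_. gauss_vec p). iexp (t * T w)) - of_real (exp (- (t\<^sup>2) / 2)))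
     = cmod (LINT x|gauss_vec p. iexp (t / sqrt \<sigma>2 * D x) * \<Psi> t x - iexp (t / sqrt \<sigma>2 * D x) * ?c)"
    unfolding char_T_conditional lim[symmetric] by (subst Bochner_Integration.integral_diff[OF int]) (rule refl)
  also have "\<dots> \<le> (LINT x|gauss_vec p. cmod (iexp (t / sqrt \<sigma>2 * D x) * \<Psi> t x - iexp (t / sqrt \<sigma>2 * D x) * ?c))"
    by (rule integral_norm_bound)
  also have "\<dots> \<le> (LINT x|gauss_vec p. ?K + (2 + t\<^sup>2) * \<bar>V x / \<sigma>2 - V0 / \<sigma>2\<bar>)"
  proof (rule integral_mono)
    show "integrable (gauss_vec p) (\<lambda>x. cmod (iexp (t / sqrt \<sigma>2 * D x) * \<Psi> t x - iexp (t / sqrt \<sigma>2 * D x) * ?c))"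
      by (intro integrable_norm Bochner_Integration.integrable_diff int)
    show "integrable (gauss_vec p) (\<lambda>x. ?K + (2 + t\<^sup>2) * \<bar>V x / \<sigma>2 - V0 / \<sigma>2\<bar>)"
      using expectation_V_close(1) by simp
    show "cmod (iexp (t / sqrt \<sigma>2 * D x) * \<Psi> t x - iexp (t / sqrt \<sigma>2 * D x) * ?c) \<le> ?K + (2 + t\<^sup>2) * \<bar>V x / \<sigma>2 - V0 / \<sigma>2\<bar>" for x
    proof -
      have "cmod (iexp (t / sqrt \<sigma>2 * D x) * \<Psi> t x - iexp (t / sqrt \<sigma>2 * D x) * ?c) = cmod (\<Psi> t x - ?c)"
        by (simp only: right_diff_distrib[symmetric] norm_mult norm_exp_i_times mult_1_left)
      then show ?thesis using \<Psi>_close[of t x] by simp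
    qed
  qed
  also have "\<dots> = ?K + (2 + t\<^sup>2) * (LINT x|gauss_vec p. \<bar>V x / \<sigma>2 - V0 / \<sigma>2\<bar>)"
    using expectation_V_close(1) by (simp add: G.prob_space)
  also have "\<dots> \<le> ?K + (2 + t\<^sup>2) * err"
    using expectation_V_close(2) by (intro add_left_mono mult_left_mono) auto
  finally show ?thesis .
qed

end

section \<open>Laws of random arrays and independent pairs\<close>

text \<open>The one-index criterion applied to the pairs of indices and then regrouped into rows, so that
  each row can be integrated as a unit.\<close>

lemma (in prob_space) iid_gauss_vec_if_mgf:
  fixes h :: "nat \<Rightarrow> nat \<Rightarrow> 'a \<Rightarrow> real"
  assumes n: "0 < n" and p: "0 < p"
    and h: "\<And>k i. k < n \<Longrightarrow> i < p \<Longrightarrow> h k i \<in> borel_measurable M"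
    and mgf: "\<And>s. (\<integral>\<^sup>+\<omega>. ennreal (exp (\<Sum>k<n. \<Sum>i<p. s k i * h k i \<omega>)) \<partial>M)
      = ennreal (exp ((\<Sum>k<n. \<Sum>i<p. (s k i)\<^sup>2) / 2))"
  shows "distr M (PiM {..<n} (\<lambda>_. PiM {..<p} (\<lambda>_. borel))) (\<lambda>\<omega>. \<lambda>k\<in>{..<n}. \<lambda>i\<in>{..<p}. h k i \<omega>)
    = PiM {..<n} (\<lambda>_. gauss_vec p)"
proof -
  define I where "I = {..<n} \<times> {..<p}"
  define g where "g = (\<lambda>(k, i). h k i)"
  have g: "g x \<in> borel_measurable M" if "x \<in> I" for x
    using that h by (auto simp: I_def g_def)
  have I: "finite I" "I \<noteq> {}" using n p by (auto simp: I_def)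
  have row: "distr M (PiM {..<p} (\<lambda>_. borel)) (\<lambda>\<omega>. \<lambda>i\<in>{..<p}. h k i \<omega>) = gauss_vec p" if k: "k < n" for k
  proof (rule iid_std_normal_if_mgf)
    fix s :: "nat \<Rightarrow> real"
    show "(\<integral>\<^sup>+\<omega>. ennreal (exp (\<Sum>i<p. s i * h k i \<omega>)) \<partial>M) = ennreal (exp ((\<Sum>i<p. (s i)\<^sup>2) / 2))"
    proof -
      have pick: "(\<Sum>k'<n. \<Sum>i<p. f (if k' = k then s i else 0) k' i) = (\<Sum>i<p. f (s i) k i)"
        if "\<And>k' i. f 0 k' i = 0" for f :: "real \<Rightarrow> nat \<Rightarrow> nat \<Rightarrow> real"
      proof -
        have "(\<Sum>k'<n. \<Sum>i<p. f (if k' = k then s i else 0) k' i) = (\<Sum>k'<n. if k' = k then \<Sum>i<p. f (s i) k i else 0)"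
          by (intro sum.cong refl) (simp add: that)
        then show ?thesis using k by simp
      qed
      show ?thesis
        using mgf[of "\<lambda>k' i. if k' = k then s i else 0"] by (simp add: pick[of "\<lambda>c k' i. c * h k' i _"] pick[of "\<lambda>c k' i. c\<^sup>2"])
    qed
  qed (use h k in auto)
  have joint: "distr M (PiM I (\<lambda>_. borel)) (\<lambda>\<omega>. \<lambda>x\<in>I. g x \<omega>) = PiM I (\<lambda>_. std_normal_distribution)"
  proof (rule iid_std_normal_if_mgf)
    fix s :: "nat \<times> nat \<Rightarrow> real"
    show "(\<integral>\<^sup>+\<omega>. ennreal (exp (\<Sum>x\<in>I. s x * g x \<omega>)) \<partial>M) = ennreal (exp ((\<Sum>x\<in>I. (s x)\<^sup>2) / 2))"
      using mgf[of "\<lambda>k i. s (k, i)"] by (simp add: I_def g_def sum.cartesian_product case_prod_beta')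
  qed (use I g in auto)
  have entry: "distr M borel (g x) = std_normal_distribution" if x: "x \<in> I" for x
  proof -
    obtain k i where ki: "x = (k, i)" "k < n" "i < p" using x by (auto simp: I_def)
    have "distr (gauss_vec p) std_normal_distribution (\<lambda>f. f i) = std_normal_distribution"
      using ki by (intro distr_PiM_component) (auto intro: std_normal_prob_space)
    then have "std_normal_distribution = distr (distr M (PiM {..<p} (\<lambda>_. borel)) (\<lambda>\<omega>. \<lambda>i\<in>{..<p}. h k i \<omega>)) std_normal_distribution (\<lambda>f. f i)"
      unfolding row[OF ki(2)] by simp
    also have "\<dots> = distr M std_normal_distribution (\<lambda>\<omega>. h k i \<omega>)"
      using ki h by (subst distr_distr) (auto simp: comp_def intro!: measurable_restrict)
    also have "\<dots> = distr M borel (h k i)" by (rule distr_cong) auto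
    finally show ?thesis by (simp add: ki g_def)
  qed
  have "indep_vars (\<lambda>_. borel) g I"
  proof (subst indep_vars_iff_distr_eq_PiM'[OF I(2)])
    show "distr M (PiM I (\<lambda>_. borel)) (\<lambda>\<omega>. \<lambda>x\<in>I. g x \<omega>) = PiM I (\<lambda>x. distr M borel (g x))"
      unfolding joint by (rule PiM_cong) (simp_all add: entry)
  qed (rule g)
  then have "indep_vars (\<lambda>k. PiM ({k} \<times> {..<p}) (\<lambda>_. borel)) (\<lambda>k \<omega>. \<lambda>x\<in>{k} \<times> {..<p}. g x \<omega>) {..<n}"
    by (rule indep_vars_restrict) (auto simp: I_def disjoint_family_on_def)
  then have "indep_vars (\<lambda>_. PiM {..<p} (\<lambda>_. borel)) (\<lambda>k \<omega>. (\<lambda>y. \<lambda>i\<in>{..<p}. y (k, i)) (\<lambda>x\<in>{k} \<times> {..<p}. g x \<omega>)) {..<n}"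
    by (rule indep_vars_compose2) (intro measurable_restrict measurable_component_singleton, simp)
  then have "indep_vars (\<lambda>_. PiM {..<p} (\<lambda>_. borel)) (\<lambda>k \<omega>. \<lambda>i\<in>{..<p}. h k i \<omega>) {..<n}"
    by (rule indep_vars_cong[THEN iffD1, rotated -1]) (auto simp: g_def fun_eq_iff)
  then have "distr M (PiM {..<n} (\<lambda>_. PiM {..<p} (\<lambda>_. borel))) (\<lambda>\<omega>. \<lambda>k\<in>{..<n}. \<lambda>i\<in>{..<p}. h k i \<omega>)
    = PiM {..<n} (\<lambda>k. distr M (PiM {..<p} (\<lambda>_. borel)) (\<lambda>\<omega>. \<lambda>i\<in>{..<p}. h k i \<omega>))"
    using n h by (subst (asm) indep_vars_iff_distr_eq_PiM') (auto intro!: measurable_restrict)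
  also have "\<dots> = PiM {..<n} (\<lambda>_. gauss_vec p)"
    by (rule PiM_cong) (simp_all add: row)
  finally show ?thesis .
qed

lemma (in prob_space) distr_pair_if_indep_events:
  assumes X: "X \<in> measurable M S" and Y: "Y \<in> measurable M T"
    and indep: "\<And>A B. A \<in> sets S \<Longrightarrow> B \<in> sets T \<Longrightarrow>
      prob ((X -` A \<inter> space M) \<inter> (Y -` B \<inter> space M)) = prob (X -` A \<inter> space M) * prob (Y -` B \<inter> space M)"
  shows "distr M (S \<Otimes>\<^sub>M T) (\<lambda>\<omega>. (X \<omega>, Y \<omega>)) = distr M S X \<Otimes>\<^sub>M distr M T Y"
proof (rule pair_measure_eqI[symmetric])
  interpret X: prob_space "distr M S X" by (rule prob_space_distr) fact
  interpret Y: prob_space "distr M T Y" by (rule prob_space_distr) fact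
  show "sigma_finite_measure (distr M S X)" "sigma_finite_measure (distr M T Y)" ..
  have XY: "(\<lambda>\<omega>. (X \<omega>, Y \<omega>)) \<in> measurable M (S \<Otimes>\<^sub>M T)" using X Y by (rule measurable_Pair)
  fix A B assume "A \<in> sets (distr M S X)" "B \<in> sets (distr M T Y)"
  then have AB: "A \<in> sets S" "B \<in> sets T" by auto
  have "emeasure (distr M (S \<Otimes>\<^sub>M T) (\<lambda>\<omega>. (X \<omega>, Y \<omega>))) (A \<times> B) = emeasure M ((X -` A \<inter> space M) \<inter> (Y -` B \<inter> space M))"
    using AB by (subst emeasure_distr[OF XY]) (auto intro!: arg_cong[where f="emeasure M"])
  also have "\<dots> = emeasure M (X -` A \<inter> space M) * emeasure M (Y -` B \<inter> space M)"
    using indep[OF AB] by (simp add: emeasure_eq_measure ennreal_mult)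
  finally show "emeasure (distr M S X) A * emeasure (distr M T Y) B = emeasure (distr M (S \<Otimes>\<^sub>M T) (\<lambda>\<omega>. (X \<omega>, Y \<omega>))) (A \<times> B)"
    using AB X Y by (simp add: emeasure_distr)
qed simp

section \<open>Spectral coordinates\<close>

text \<open>Orthonormality of the eigenvectors is a one-sided inverse relation for the square matrix with these
  rows; the inverse being two-sided is completeness.\<close>

lemma orthonormal_eigensystem_parseval:
  assumes pd: "pos_def_mat d S" and es: "orthonormal_eigensystem d S lam u"
    and x: "x \<in> carrier_vec d" and y: "y \<in> carrier_vec d"
  shows "x \<bullet> y = (\<Sum>i<d. (u i \<bullet> x) * (u i \<bullet> y))"
proof -
  have S: "S \<in> carrier_mat d d" using pd by (simp add: pos_def_mat_def)
  have u: "u i \<in> carrier_vec d" if "i < d" for i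
    using es S that by (auto simp: orthonormal_eigensystem_def eigenvector_def)
  define Q where "Q = mat d d (\<lambda>(i, r). u i $ r)"
  have Q: "Q \<in> carrier_mat d d" by (simp add: Q_def)
  have rowQ: "row Q i = u i" if "i < d" for i using that u[OF that] by (intro eq_vecI) (auto simp: Q_def)
  have "Q * transpose_mat Q = 1\<^sub>m d"
  proof (rule eq_matI)
    fix i j assume "i < dim_row (1\<^sub>m d :: real mat)" "j < dim_col (1\<^sub>m d :: real mat)"
    then have ij: "i < d" "j < d" by auto
    then have "(Q * transpose_mat Q) $$ (i, j) = row Q i \<bullet> row Q j" using Q by simp
    also have "\<dots> = (if i = j then 1 else 0)"
      using ij es by (simp add: rowQ orthonormal_eigensystem_def)
    finally show "(Q * transpose_mat Q) $$ (i, j) = 1\<^sub>m d $$ (i, j)" using ij by simp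
  qed (use Q in auto)
  then have QQ: "transpose_mat Q * Q = 1\<^sub>m d"
    using mat_mult_left_right_inverse[OF Q, of "transpose_mat Q"] Q by simp
  have Qx: "(Q *\<^sub>v z) $ i = u i \<bullet> z" if "i < d" for z i using that Q rowQ by simp
  have "x \<bullet> y = x \<bullet> ((transpose_mat Q * Q) *\<^sub>v y)" using y by (simp add: QQ)
  also have "\<dots> = x \<bullet> (transpose_mat Q *\<^sub>v (Q *\<^sub>v y))" using Q y by simp
  also have "\<dots> = (transpose_mat Q *\<^sub>v (Q *\<^sub>v y)) \<bullet> x" using Q x y by (intro comm_scalar_prod[of _ d]) auto
  also have "\<dots> = (Q *\<^sub>v y) \<bullet> (Q *\<^sub>v x)" using transpose_vec_mult_scalar[OF Q x, of "Q *\<^sub>v y"] Q y by simp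
  also have "\<dots> = (\<Sum>i<d. (u i \<bullet> x) * (u i \<bullet> y))"
    using Q Qx by (simp add: scalar_prod_def[of "Q *\<^sub>v y"] atLeast0LessThan mult.commute)
  finally show ?thesis .
qed

lemma eigen_coord_pow:
  assumes pd: "pos_def_mat d S" and es: "orthonormal_eigensystem d S lam u"
    and i: "i < d" and y: "y \<in> carrier_vec d"
  shows "u i \<bullet> (S ^\<^sub>m k *\<^sub>v y) = lam i ^ k * (u i \<bullet> y)" "u i \<bullet> (S *\<^sub>v y) = lam i * (u i \<bullet> y)"
proof -
  have S: "S \<in> carrier_mat d d" "transpose_mat S = S" using pd by (auto simp: pos_def_mat_def)
  have u: "u i \<in> carrier_vec d" and ev: "S *\<^sub>v u i = lam i \<cdot>\<^sub>v u i"
    using es S i by (auto simp: orthonormal_eigensystem_def eigenvector_def)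
  have one: "u i \<bullet> (S *\<^sub>v y) = lam i * (u i \<bullet> y)" if y: "y \<in> carrier_vec d" for y
  proof -
    have "u i \<bullet> (S *\<^sub>v y) = (transpose_mat S *\<^sub>v u i) \<bullet> y"
      using transpose_vec_mult_scalar[OF S(1) y u] by simp
    then show ?thesis using u y by (simp add: S ev)
  qed
  then show "u i \<bullet> (S *\<^sub>v y) = lam i * (u i \<bullet> y)" using y by simp
  show "u i \<bullet> (S ^\<^sub>m k *\<^sub>v y) = lam i ^ k * (u i \<bullet> y)"
    using y
  proof (induction k arbitrary: y)
    case 0
    then show ?case using S by simp
  next
    case (Suc k)
    have "S ^\<^sub>m Suc k *\<^sub>v y = S ^\<^sub>m k *\<^sub>v (S *\<^sub>v y)"
      using S Suc.prems by (simp add: assoc_mult_mat_vec[OF pow_carrier_mat[OF S(1)] S(1)])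
    then show ?case using Suc.IH[of "S *\<^sub>v y"] Suc.prems S one by simp
  qed
qed

text \<open>The diagonal entries are quadratic forms in the unit vectors; in spectral coordinates
  their sum collects the squared lengths of the eigenvectors.\<close>

lemma eigen_trace_square:
  assumes pd: "pos_def_mat d S" and es: "orthonormal_eigensystem d S lam u"
  shows "trace_mat (S ^\<^sub>m 2) = (\<Sum>i<d. (lam i)\<^sup>2)"
proof -
  have S: "S \<in> carrier_mat d d" using pd by (auto simp: pos_def_mat_def)
  have u: "u i \<in> carrier_vec d" if "i < d" for i
    using es S that by (auto simp: orthonormal_eigensystem_def eigenvector_def)
  have S2: "S ^\<^sub>m 2 \<in> carrier_mat d d" using pow_carrier_mat[OF S] .
  have ue: "u i \<bullet> unit_vec d r = u i $ r" if "i < d" "r < d" for i r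
    using that u by simp
  have "(S ^\<^sub>m 2) $$ (r, r) = (\<Sum>i<d. (lam i)\<^sup>2 * (u i $ r * u i $ r))" if r: "r < d" for r
  proof -
    have "(S ^\<^sub>m 2) $$ (r, r) = unit_vec d r \<bullet> (S ^\<^sub>m 2 *\<^sub>v unit_vec d r)"
    proof -
      have "unit_vec d r \<bullet> (S ^\<^sub>m 2 *\<^sub>v unit_vec d r) = (S ^\<^sub>m 2 *\<^sub>v unit_vec d r) $ r"
        using S2 r by (intro scalar_prod_left_unit) auto
      also have "\<dots> = row (S ^\<^sub>m 2) r \<bullet> unit_vec d r"
        using carrier_matD(1)[OF S2] r by (intro index_mult_mat_vec) simp
      also have "\<dots> = row (S ^\<^sub>m 2) r $ r"
        using S2 r by (intro scalar_prod_right_unit) auto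
      also have "\<dots> = (S ^\<^sub>m 2) $$ (r, r)" using S2 r S by (subst index_row) auto
      finally show ?thesis ..
    qed
    also have "\<dots> = (\<Sum>i<d. (u i \<bullet> unit_vec d r) * (u i \<bullet> (S ^\<^sub>m 2 *\<^sub>v unit_vec d r)))"
      using S2 by (intro orthonormal_eigensystem_parseval[OF pd es]) auto
    also have "\<dots> = (\<Sum>i<d. (lam i)\<^sup>2 * (u i $ r * u i $ r))"
      using r by (intro sum.cong refl) (simp add: eigen_coord_pow(1)[OF pd es] ue)
    finally show ?thesis .
  qed
  then have "trace_mat (S ^\<^sub>m 2) = (\<Sum>r<d. \<Sum>i<d. (lam i)\<^sup>2 * (u i $ r * u i $ r))"
    using S by (simp add: trace_mat_def)
  also have "\<dots> = (\<Sum>i<d. (lam i)\<^sup>2 * (u i \<bullet> u i))"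
    by (subst sum.swap, rule sum.cong[OF refl]) (simp add: scalar_prod_def sum_distrib_left atLeast0LessThan carrier_vecD[OF u])
  also have "\<dots> = (\<Sum>i<d. (lam i)\<^sup>2)"
    using es by (simp add: orthonormal_eigensystem_def)
  finally show ?thesis .
qed

section \<open>The law of the statistic\<close>

lemma scalar_prod_sample_cov:
  assumes X: "X \<in> carrier_mat p n" and l: "l \<in> carrier_vec p" and v: "v \<in> carrier_vec p"
  shows "l \<bullet> (sample_cov X *\<^sub>v v)
    = (\<Sum>j<n. (l \<bullet> (col X j - sample_mean X)) * (v \<bullet> (col X j - sample_mean X))) / (real n - 1)"
proof -
  define e where "e r j = X $$ (r, j) - sample_mean X $ r" for r j
  have dims: "dim_row X = p" "dim_col X = n" using X by auto
  have ld: "w \<bullet> (col X j - sample_mean X) = (\<Sum>r<p. w $ r * e r j)" if "j < n" "w \<in> carrier_vec p" for w j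
    using that dims by (simp add: scalar_prod_def e_def sample_mean_def atLeast0LessThan)
  have "l \<bullet> (sample_cov X *\<^sub>v v) = (\<Sum>r<p. l $ r * (\<Sum>s<p. ((\<Sum>j<n. e r j * e s j) / (real n - 1)) * v $ s))"
    using l v dims by (simp add: scalar_prod_def sample_cov_def e_def atLeast0LessThan)
  also have "\<dots> = (\<Sum>r<p. \<Sum>s<p. \<Sum>j<n. (l $ r * e r j) * (v $ s * e s j) / (real n - 1))"
    by (simp add: sum_distrib_left sum_distrib_right sum_divide_distrib mult_ac)
  also have "\<dots> = (\<Sum>j<n. \<Sum>r<p. \<Sum>s<p. (l $ r * e r j) * (v $ s * e s j) / (real n - 1))"
  proof -
    have "(\<Sum>r<p. \<Sum>s<p. \<Sum>j<n. (l $ r * e r j) * (v $ s * e s j) / (real n - 1))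
        = (\<Sum>r<p. \<Sum>j<n. \<Sum>s<p. (l $ r * e r j) * (v $ s * e s j) / (real n - 1))"
      by (rule sum.cong[OF refl], rule sum.swap)
    also have "\<dots> = (\<Sum>j<n. \<Sum>r<p. \<Sum>s<p. (l $ r * e r j) * (v $ s * e s j) / (real n - 1))"
      by (rule sum.swap)
    finally show ?thesis .
  qed
  also have "\<dots> = (\<Sum>j<n. (\<Sum>r<p. l $ r * e r j) * (\<Sum>s<p. v $ s * e s j)) / (real n - 1)"
    by (simp add: sum_product sum_divide_distrib)
  also have "\<dots> = (\<Sum>j<n. (l \<bullet> (col X j - sample_mean X)) * (v \<bullet> (col X j - sample_mean X))) / (real n - 1)"
    using l v by (simp add: ld)
  finally show ?thesis .
qed

lemma measurable_mat_entry: "r < p \<Longrightarrow> j < n \<Longrightarrow> (\<lambda>y. y $$ (r, j)) \<in> borel_measurable (lborel_mat p n)"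
  unfolding lborel_mat_def by (intro measurable_embed_measure1) simp

lemma measurable_scalar_prod_col:
  assumes "s \<in> carrier_vec p" "j < n"
  shows "(\<lambda>y. s \<bullet> col y j) \<in> borel_measurable (lborel_mat p n)"
proof -
  have "(\<lambda>y. \<Sum>r<p. s $ r * y $$ (r, j)) \<in> borel_measurable (lborel_mat p n)"
    using assms by (intro borel_measurable_sum borel_measurable_times measurable_mat_entry) auto
  then show ?thesis
    by (rule measurable_cong[THEN iffD1, rotated])
      (use assms in \<open>auto simp: space_lborel_mat scalar_prod_def atLeast0LessThan\<close>)
qed

locale eigen_covariance =
  fixes p :: nat and S :: "real mat" and lam :: "nat \<Rightarrow> real" and u :: "nat \<Rightarrow> real vec"
  assumes pd: "pos_def_mat p S" and es: "orthonormal_eigensystem p S lam u"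
    and lam_pos: "\<And>i. i < p \<Longrightarrow> 0 < lam i"
begin

lemma S: "S \<in> carrier_mat p p"
  using pd by (simp add: pos_def_mat_def)

lemma u: "i < p \<Longrightarrow> u i \<in> carrier_vec p"
  using es S by (auto simp: orthonormal_eigensystem_def eigenvector_def)

text \<open>The standardised spectral coordinates of \<open>x\<close> for the normal law with mean \<open>m\<close> and covariance \<open>S\<close>.\<close>

definition "coord m x i = u i \<bullet> (x - m) / sqrt (lam i)"

text \<open>The linear functional of the coordinates with coefficients \<open>t\<close> is \<open>s \<bullet> (X - m)\<close> for the vector \<open>s\<close> with
  spectral coefficients \<open>t i / sqrt (lam i)\<close>, and \<open>s \<bullet> S s\<close> is the squared length of \<open>t\<close>.\<close>

lemma mgf_coord:
  assumes M: "prob_space M" and m: "m \<in> carrier_vec p"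
    and X: "distributed M (lborel_vec p) X (\<lambda>x. ennreal (mvn_density m S x))"
  shows "(\<integral>\<^sup>+\<omega>. ennreal (exp (\<Sum>i<p. t i * coord m (X \<omega>) i)) \<partial>M) = ennreal (exp ((\<Sum>i<p. (t i)\<^sup>2) / 2))"
proof -
  interpret prob_space M by fact
  define s where "s = vec p (\<lambda>r. \<Sum>i<p. t i / sqrt (lam i) * u i $ r)"
  have s: "s \<in> carrier_vec p" by (simp add: s_def)
  have sx: "s \<bullet> x = (\<Sum>i<p. t i / sqrt (lam i) * (u i \<bullet> x))" if x: "x \<in> carrier_vec p" for x
  proof -
    have "s \<bullet> x = (\<Sum>r<p. \<Sum>i<p. t i / sqrt (lam i) * (u i $ r * x $ r))"
      using x by (simp add: scalar_prod_def s_def atLeast0LessThan sum_distrib_right mult.assoc)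
    also have "\<dots> = (\<Sum>i<p. \<Sum>r<p. t i / sqrt (lam i) * (u i $ r * x $ r))" by (rule sum.swap)
    also have "\<dots> = (\<Sum>i<p. t i / sqrt (lam i) * (u i \<bullet> x))"
      using x by (simp add: scalar_prod_def atLeast0LessThan sum_distrib_left)
    finally show ?thesis .
  qed
  have us: "u i \<bullet> s = t i / sqrt (lam i)" if i: "i < p" for i
  proof -
    have "u i \<bullet> s = s \<bullet> u i" using u[OF i] s by (rule comm_scalar_prod)
    also have "\<dots> = (\<Sum>k<p. t k / sqrt (lam k) * (if k = i then 1 else 0))"
      using es i by (simp add: sx u orthonormal_eigensystem_def)
    finally show ?thesis using i by (simp add: if_distrib cong: if_cong)
  qed
  have "s \<bullet> (S *\<^sub>v s) = (\<Sum>i<p. t i / sqrt (lam i) * (lam i * (t i / sqrt (lam i))))"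
    using S s by (subst sx) (auto simp: eigen_coord_pow(2)[OF pd es] us)
  also have "\<dots> = (\<Sum>i<p. (t i)\<^sup>2)"
  proof (rule sum.cong[OF refl])
    fix i assume "i \<in> {..<p}"
    then have "0 < lam i" using lam_pos by simp
    then show "t i / sqrt (lam i) * (lam i * (t i / sqrt (lam i))) = (t i)\<^sup>2"
      by (simp add: power2_eq_square field_simps)
  qed
  finally have q: "s \<bullet> (S *\<^sub>v s) = (\<Sum>i<p. (t i)\<^sup>2)" .
  have "(\<integral>\<^sup>+\<omega>. ennreal (exp (\<Sum>i<p. t i * coord m (X \<omega>) i)) \<partial>M) = (\<integral>\<^sup>+\<omega>. ennreal (exp (s \<bullet> (X \<omega> - m))) \<partial>M)"
  proof (rule nn_integral_cong)
    fix \<omega> assume "\<omega> \<in> space M"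
    then have "X \<omega> \<in> carrier_vec p"
      using measurable_space[OF distributed_measurable[OF X]] by (simp add: space_lborel_vec)
    then have "X \<omega> - m \<in> carrier_vec p" using m by simp
    then show "ennreal (exp (\<Sum>i<p. t i * coord m (X \<omega>) i)) = ennreal (exp (s \<bullet> (X \<omega> - m)))"
      by (simp add: sx coord_def)
  qed
  then show ?thesis using mgf_mvn[OF pd m s X] q by simp
qed

text \<open>The coordinates after rotation of the sample index. Row 0 is \<open>sqrt n\<close> times the mean coordinate, the
  other rows are insensitive to a common shift of the columns.\<close>

definition "contrast n m y k i = (\<Sum>j<n. householder n k j * coord m (col y j) i)"

definition "contrasts n m y = (\<lambda>k\<in>{..<n}. \<lambda>i\<in>{..<p}. contrast n m y k i)"

lemma measurable_coord_col:
  assumes m: "m \<in> carrier_vec p" and "i < p" "j < n"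
  shows "(\<lambda>y. coord m (col y j) i) \<in> borel_measurable (lborel_mat p n)"
proof -
  have "(\<lambda>y. (u i \<bullet> col y j - u i \<bullet> m) / sqrt (lam i)) \<in> borel_measurable (lborel_mat p n)"
    using measurable_scalar_prod_col[OF u[OF assms(2)] assms(3)] by measurable
  then show ?thesis
  proof (rule measurable_cong[THEN iffD1, rotated])
    fix y assume "y \<in> space (lborel_mat p n)"
    then have "col y j \<in> carrier_vec p" by (auto simp: space_lborel_mat)
    then show "(u i \<bullet> col y j - u i \<bullet> m) / sqrt (lam i) = coord m (col y j) i"
      using m u[OF assms(2)] by (simp add: coord_def scalar_prod_minus_distrib[of _ p])
  qed
qed

lemma measurable_contrasts:
  assumes m: "m \<in> carrier_vec p"
  shows "contrasts n m \<in> measurable (lborel_mat p n) (PiM {..<n} (\<lambda>_. PiM {..<p} (\<lambda>_. borel)))"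
  unfolding contrasts_def[abs_def] contrast_def
  by (intro measurable_restrict borel_measurable_sum borel_measurable_times borel_measurable_const measurable_coord_col[OF m]) auto

text \<open>The moment generating function of the independent columns is that of an array of independent
  standard normal variables. It depends on the coefficients only through their sum of squares,
  which the rotation preserves.\<close>

lemma contrasts_law:
  assumes M: "prob_space M" and m: "m \<in> carrier_vec p" and n: "2 \<le> n" and p: "0 < p"
    and Y: "iid_normal_columns M p n m S Y"
  shows "distr M (PiM {..<n} (\<lambda>_. PiM {..<p} (\<lambda>_. borel))) (\<lambda>\<omega>. contrasts n m (Y \<omega>)) = PiM {..<n} (\<lambda>_. gauss_vec p)"
  unfolding contrasts_def
proof (rule prob_space.iid_gauss_vec_if_mgf[OF M])
  interpret prob_space M by fact
  have Ym: "Y \<in> measurable M (lborel_mat p n)"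
    and ind: "indep_vars (\<lambda>_. lborel_vec p) (\<lambda>j \<omega>. col (Y \<omega>) j) {..<n}"
    and dist: "\<And>j. j < n \<Longrightarrow> distributed M (lborel_vec p) (\<lambda>\<omega>. col (Y \<omega>) j) (\<lambda>x. ennreal (mvn_density m S x))"
    using Y by (auto simp: iid_normal_columns_def)
  have cm: "(\<lambda>\<omega>. coord m (col (Y \<omega>) j) i) \<in> borel_measurable M" if "i < p" "j < n" for i j
    using measurable_compose[OF Ym measurable_coord_col[OF m that]] .
  show "(\<lambda>\<omega>. contrast n m (Y \<omega>) k i) \<in> borel_measurable M" if "k < n" "i < p" for k i
    unfolding contrast_def using that cm by (intro borel_measurable_sum borel_measurable_times) auto
  have coord_meas: "(\<lambda>x. coord m x i) \<in> borel_measurable (lborel_vec p)" if i: "i < p" for i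
  proof -
    have "(\<lambda>x. u i \<bullet> (x - m)) \<in> borel_measurable (lborel_vec p)"
      by (rule measurable_compose[OF measurable_minus_vec[OF m] measurable_scalar_prod_lborel_vec[OF u[OF i]]])
    then show ?thesis unfolding coord_def by measurable
  qed
  have joint: "(\<integral>\<^sup>+\<omega>. ennreal (exp (\<Sum>j<n. \<Sum>i<p. t j i * coord m (col (Y \<omega>) j) i)) \<partial>M)
      = ennreal (exp ((\<Sum>j<n. \<Sum>i<p. (t j i)\<^sup>2) / 2))" for t
  proof -
    have "indep_vars (\<lambda>_. borel) (\<lambda>j \<omega>. ennreal (exp (\<Sum>i<p. t j i * coord m (col (Y \<omega>) j) i))) {..<n}"
      by (rule indep_vars_compose2[OF ind, of "\<lambda>j x. ennreal (exp (\<Sum>i<p. t j i * coord m x i))"])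
        (use coord_meas in \<open>auto intro!: measurable_compose[OF _ measurable_ennreal] measurable_compose[OF _ borel_measurable_exp] borel_measurable_sum borel_measurable_times\<close>)
    then have "(\<integral>\<^sup>+\<omega>. (\<Prod>j<n. ennreal (exp (\<Sum>i<p. t j i * coord m (col (Y \<omega>) j) i))) \<partial>M)
        = (\<Prod>j<n. \<integral>\<^sup>+\<omega>. ennreal (exp (\<Sum>i<p. t j i * coord m (col (Y \<omega>) j) i)) \<partial>M)"
      by (intro indep_vars_nn_integral) auto
    also have "\<dots> = (\<Prod>j<n. ennreal (exp ((\<Sum>i<p. (t j i)\<^sup>2) / 2)))"
      using mgf_coord[OF M m dist] by (intro prod.cong refl) simp
    finally show ?thesis
      by (simp add: prod_ennreal exp_sum[symmetric] sum_divide_distrib)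
  qed
  show "(\<integral>\<^sup>+\<omega>. ennreal (exp (\<Sum>k<n. \<Sum>i<p. s k i * contrast n m (Y \<omega>) k i)) \<partial>M)
      = ennreal (exp ((\<Sum>k<n. \<Sum>i<p. (s k i)\<^sup>2) / 2))" for s
  proof -
    define t where "t j i = (\<Sum>k<n. householder n j k * s k i)" for j i
    have "(\<Sum>k<n. \<Sum>i<p. s k i * contrast n m y k i) = (\<Sum>j<n. \<Sum>i<p. t j i * coord m (col y j) i)" for y
    proof -
      have "(\<Sum>k<n. \<Sum>i<p. s k i * contrast n m y k i)
          = (\<Sum>k<n. \<Sum>j<n. \<Sum>i<p. householder n j k * s k i * coord m (col y j) i)"
        unfolding contrast_def sum_distrib_left
        by (rule sum.cong[OF refl], subst sum.swap) (simp add: mult_ac householder_sym)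
      also have "\<dots> = (\<Sum>j<n. \<Sum>k<n. \<Sum>i<p. householder n j k * s k i * coord m (col y j) i)" by (rule sum.swap)
      also have "\<dots> = (\<Sum>j<n. \<Sum>i<p. t j i * coord m (col y j) i)"
        unfolding t_def sum_distrib_right by (rule sum.cong[OF refl], rule sum.swap)
      finally show ?thesis .
    qed
    moreover have "(\<Sum>j<n. \<Sum>i<p. (t j i)\<^sup>2) = (\<Sum>k<n. \<Sum>i<p. (s k i)\<^sup>2)"
    proof -
      have "(\<Sum>j<n. \<Sum>i<p. (t j i)\<^sup>2) = (\<Sum>i<p. \<Sum>j<n. (t j i)\<^sup>2)" by (rule sum.swap)
      also have "\<dots> = (\<Sum>i<p. \<Sum>k<n. (s k i)\<^sup>2)"
        unfolding t_def power2_eq_square by (intro sum.cong refl sum_householder_products[OF n])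
      also have "\<dots> = (\<Sum>k<n. \<Sum>i<p. (s k i)\<^sup>2)" by (rule sum.swap)
      finally show ?thesis .
    qed
    ultimately show ?thesis using joint[of t] by simp
  qed
qed (use n p in auto)

end

lemma scalar_prod_sample_mean:
  assumes X: "X \<in> carrier_mat p n" and s: "s \<in> carrier_vec p"
  shows "s \<bullet> sample_mean X = (\<Sum>j<n. s \<bullet> col X j) / real n"
proof -
  have "s \<bullet> sample_mean X = (\<Sum>r<p. \<Sum>j<n. s $ r * X $$ (r, j) / real n)"
    using X by (simp add: scalar_prod_def sample_mean_def atLeast0LessThan sum_distrib_left sum_divide_distrib)
  also have "\<dots> = (\<Sum>j<n. \<Sum>r<p. s $ r * X $$ (r, j) / real n)" by (rule sum.swap)
  also have "\<dots> = (\<Sum>j<n. s \<bullet> col X j) / real n"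
    using X by (simp add: scalar_prod_def atLeast0LessThan sum_divide_distrib)
  finally show ?thesis .
qed

context eigen_covariance
begin

text \<open>The link between the matrix statistic and the model: Parseval's identity turns both scalar products
  with the centred columns into centred linear functionals of the coordinates, and the rotation
  turns the centred sum of products into the sum over the rows from 1 on.\<close>

lemma statistic_eq:
  assumes n: "2 \<le> n" and y: "y \<in> carrier_mat p n" and mu: "mu \<in> carrier_vec p" and b: "b \<in> carrier_vec p"
    and l: "l \<in> carrier_vec p"
  defines "A \<equiv> (\<lambda>i. sqrt (lam i) * (u i \<bullet> l))" and "U \<equiv> (\<lambda>i. sqrt (lam i) * (u i \<bullet> (mu + b)))"
    and "X \<equiv> y + mat p n (\<lambda>(i, j). b $ i)"
  assumes model: "gaussian_sample_model p n A lam c m1 M1"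
  shows "sqrt (real n) * inverse (sqrt (LMN_var c p S l (mu + b))) *
      (l \<bullet> (sample_cov X *\<^sub>v sample_mean X) - l \<bullet> (S *\<^sub>v (mu + b)))
    = gaussian_sample_model.T p n A U lam c (contrasts n mu y)"
proof -
  interpret G: gaussian_sample_model p n A U lam c m1 M1 by (rule model)
  define m where "m = mu + b"
  have m: "m \<in> carrier_vec p" using mu b by (simp add: m_def)
  note parseval = orthonormal_eigensystem_parseval[OF pd es]
  have sq: "sqrt (lam i) * sqrt (lam i) = lam i" if "i < p" for i using lam_pos[OF that] by simp
  have form: "x \<bullet> (S ^\<^sub>m k *\<^sub>v z) = (\<Sum>i<p. lam i ^ k * (u i \<bullet> x) * (u i \<bullet> z))"
    if "x \<in> carrier_vec p" "z \<in> carrier_vec p" for x z k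
    using mult_mat_vec_carrier[OF pow_carrier_mat[OF S] that(2)] that
    by (subst parseval) (auto simp: eigen_coord_pow(1)[OF pd es] mult_ac intro!: sum.cong)
  have form1: "x \<bullet> (S *\<^sub>v z) = (\<Sum>i<p. lam i * (u i \<bullet> x) * (u i \<bullet> z))"
    if "x \<in> carrier_vec p" "z \<in> carrier_vec p" for x z
    using that S by (subst parseval) (auto simp: eigen_coord_pow(2)[OF pd es] mult_ac intro!: sum.cong)
  have sq2: "(sqrt (lam i) * a)\<^sup>2 = lam i * a * a" if "i < p" for i a
    using lam_pos[OF that] by (simp add: power_mult_distrib power2_eq_square)
  have sqm: "sqrt (lam i) * a * (sqrt (lam i) * a') = lam i * a * a'" if "i < p" for i a a'
  proof -
    have "sqrt (lam i) * a * (sqrt (lam i) * a') = sqrt (lam i) * sqrt (lam i) * a * a'" by (simp only: mult_ac)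
    then show ?thesis by (simp only: sq[OF that])
  qed
  have sq3: "(sqrt (lam i) * a * lam i)\<^sup>2 = lam i ^ 3 * a * a" if "i < p" for i a
    unfolding power_mult_distrib[of _ "lam i"] sq2[OF that] by (simp add: power2_eq_square power3_eq_cube)
  have lm: "l \<bullet> (S *\<^sub>v m) = G.\<beta>0"
    unfolding G.\<beta>0_def unfolding U_def A_def m_def[symmetric] form1[OF l m]
    by (rule sum.cong[OF refl], rule sqm[symmetric]) simp
  have var: "LMN_var c p S l m = G.\<sigma>2"
  proof -
    have "m \<bullet> (S *\<^sub>v m) = G.\<gamma>0" "l \<bullet> (S *\<^sub>v l) = G.\<alpha>"
      unfolding G.\<gamma>0_def G.\<alpha>_def unfolding U_def A_def m_def[symmetric] form1[OF m m] form1[OF l l]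
      by (simp_all add: sq2)
    moreover have "l \<bullet> (S ^\<^sub>m 3 *\<^sub>v l) = G.\<tau>2"
      unfolding G.\<tau>2_def unfolding A_def form[OF l l]
      by (rule sum.cong[OF refl], rule sq3[symmetric]) simp
    moreover have "trace_mat (S ^\<^sub>m 2) = G.\<kappa>"
      unfolding G.\<kappa>_def by (rule eigen_trace_square[OF pd es])
    ultimately show ?thesis
      unfolding LMN_var_def lm G.\<sigma>2_def G.V0_def by (simp add: mult_ac)
  qed
  have X: "X \<in> carrier_mat p n" using y by (simp add: X_def)
  define z where "z j i = coord mu (col y j) i" for j i
  define zbar where "zbar i = (\<Sum>j<n. z j i) / real n" for i
  have colX: "u i \<bullet> col X j = u i \<bullet> m + sqrt (lam i) * z j i" if "i < p" "j < n" for i j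
  proof -
    have cy: "col y j \<in> carrier_vec p" using y that by auto
    have "col X j = col y j + b" using y b that by (intro eq_vecI) (auto simp: X_def)
    then have "u i \<bullet> col X j = u i \<bullet> col y j + u i \<bullet> b" using u[OF that(1)] cy b by (simp add: scalar_prod_add_distrib[of _ p])
    moreover have "u i \<bullet> m = u i \<bullet> mu + u i \<bullet> b" using u[OF that(1)] mu b by (simp add: m_def scalar_prod_add_distrib[of _ p])
    moreover have "sqrt (lam i) * z j i = u i \<bullet> col y j - u i \<bullet> mu"
      using lam_pos[OF that(1)] u[OF that(1)] cy mu by (simp add: z_def coord_def scalar_prod_minus_distrib[of _ p])
    ultimately show ?thesis by simp
  qed
  define xbar where "xbar = sample_mean X"
  have xbar: "xbar \<in> carrier_vec p" by (rule carrier_vecI) (simp only: xbar_def sample_mean_def dim_vec carrier_matD(1)[OF X])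
  have uxbar: "u i \<bullet> xbar = u i \<bullet> m + sqrt (lam i) * zbar i" if "i < p" for i
    using n that unfolding xbar_def scalar_prod_sample_mean[OF X u[OF that]]
    by (simp add: colX sum.distrib zbar_def sum_distrib_left[symmetric] add_divide_distrib)
  have udev: "u i \<bullet> (col X j - xbar) = sqrt (lam i) * (z j i - zbar i)" if "i < p" "j < n" for i j
    using that u[OF that(1)] X xbar by (simp add: scalar_prod_minus_distrib[of _ p] colX uxbar algebra_simps)
  have wkz: "contrasts n mu y k i = (\<Sum>j<n. householder n k j * z j i)" if "k < n" "i < p" for k i
    using that by (simp add: contrasts_def contrast_def z_def)
  have w0: "contrasts n mu y 0 i = sqrt (real n) * zbar i" if "i < p" for i
  proof -
    have "contrasts n mu y 0 i = (1 / sqrt (real n)) * (\<Sum>j<n. z j i)"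
      using n that by (simp add: wkz householder_row_0 sum_distrib_left)
    also have "1 / sqrt (real n) = sqrt (real n) / real n" using n by (simp add: field_simps)
    finally show ?thesis by (simp add: zbar_def)
  qed
  define B where "B = G.Xv (contrasts n mu y 0)"
  have B: "B i = sqrt (lam i) * (u i \<bullet> xbar)" if "i < p" for i
  proof -
    have "B i = U i + lam i * (sqrt (real n) * zbar i) / sqrt (real n)"
      unfolding B_def G.Xv_def w0[OF that] ..
    also have "\<dots> = sqrt (lam i) * (u i \<bullet> m) + sqrt (lam i) * sqrt (lam i) * zbar i"
      using n unfolding U_def m_def[symmetric] sq[OF that] by simp
    finally show ?thesis unfolding uxbar[OF that] by (simp only: distrib_left mult.assoc)
  qed
  define lin where "lin C j = (\<Sum>i<p. C i * z j i)" for C :: "nat \<Rightarrow> real" and j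
  have centred: "(\<Sum>i<p. C i * (z j i - zbar i)) = lin C j - (\<Sum>j<n. lin C j) / real n" for C j
  proof -
    have "(\<Sum>j<n. lin C j) / real n = (\<Sum>i<p. C i * zbar i)"
      unfolding lin_def by (subst sum.swap) (simp add: zbar_def sum_divide_distrib sum_distrib_left)
    then show ?thesis by (simp add: lin_def right_diff_distrib sum_subtractf)
  qed
  have rotated: "(\<Sum>j<n. householder n k j * lin C j) = (\<Sum>i<p. C i * contrasts n mu y k i)" if "k < n" for C k
  proof -
    have "(\<Sum>j<n. householder n k j * lin C j) = (\<Sum>j<n. \<Sum>i<p. C i * (householder n k j * z j i))"
      by (simp add: lin_def sum_distrib_left mult_ac)
    also have "\<dots> = (\<Sum>i<p. \<Sum>j<n. C i * (householder n k j * z j i))" by (rule sum.swap)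
    also have "\<dots> = (\<Sum>i<p. C i * contrasts n mu y k i)" using that by (simp add: wkz sum_distrib_left)
    finally show ?thesis .
  qed
  have dev: "v \<bullet> (col X j - xbar) = lin C j - (\<Sum>j<n. lin C j) / real n"
    if "j < n" "v \<in> carrier_vec p" "\<And>i. i < p \<Longrightarrow> C i = sqrt (lam i) * (u i \<bullet> v)" for v C j
  proof -
    have "v \<bullet> (col X j - xbar) = (\<Sum>i<p. (u i \<bullet> v) * (u i \<bullet> (col X j - xbar)))"
      using X xbar that(1,2) by (intro parseval) auto
    also have "\<dots> = (\<Sum>i<p. C i * (z j i - zbar i))"
      using that by (intro sum.cong refl) (simp add: udev mult_ac)
    finally show ?thesis by (simp only: centred)
  qed
  have "l \<bullet> (sample_cov X *\<^sub>v xbar)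
      = (\<Sum>j<n. (lin A j - (\<Sum>j<n. lin A j) / real n) * (lin B j - (\<Sum>j<n. lin B j) / real n)) / (real n - 1)"
    using scalar_prod_sample_cov[OF X l xbar] dev[OF _ l, of _ A] dev[OF _ xbar, of _ B] B
    by (simp add: xbar_def[symmetric] A_def)
  also have "\<dots> = (\<Sum>k\<in>{1..<n}. (\<Sum>i<p. A i * contrasts n mu y k i) * (\<Sum>i<p. B i * contrasts n mu y k i)) / (real n - 1)"
    unfolding sum_centred_products[OF n] by (intro arg_cong[where f="\<lambda>s. s / (real n - 1)"] sum.cong refl) (simp add: rotated)
  finally have quad: "l \<bullet> (sample_cov X *\<^sub>v xbar) = \<dots>" .
  show ?thesis
    unfolding m_def[symmetric] var lm xbar_def[symmetric] quad G.T_def B_def by (simp add: divide_inverse)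
qed

lemma measurable_LMN_mean_coord:
  assumes mu: "mu \<in> carrier_vec p" and B: "B \<in> carrier_mat p q" and i: "i < p"
  shows "(\<lambda>v. u i \<bullet> LMN_mean mu B v) \<in> borel_measurable (lborel_vec q)"
proof -
  have s: "transpose_mat B *\<^sub>v u i \<in> carrier_vec q" using B u[OF i] by simp
  have "(\<lambda>v. u i \<bullet> mu + (transpose_mat B *\<^sub>v u i) \<bullet> v) \<in> borel_measurable (lborel_vec q)"
    using measurable_scalar_prod_lborel_vec[OF s] by measurable
  then show ?thesis
  proof (rule measurable_cong[THEN iffD1, rotated])
    fix v assume "v \<in> space (lborel_vec q)"
    then have v: "v \<in> carrier_vec q" by (simp add: space_lborel_vec)
    then show "u i \<bullet> mu + (transpose_mat B *\<^sub>v u i) \<bullet> v = u i \<bullet> LMN_mean mu B v"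
      using transpose_vec_mult_scalar[OF B v u[OF i]] u[OF i] mu B
      by (simp add: LMN_mean_def scalar_prod_add_distrib[of _ p])
  qed
qed

text \<open>The mixing vector is independent of the rotated array, a function of the normal matrix. So the
  characteristic function of the statistic is an average of those for a fixed mixing vector,
  and a bound free of the mixing vector survives the averaging.\<close>

lemma LMN_statistic_char_bound:
  assumes rep: "LMN_representation M p n q mu S B f X Y nu"
    and n: "2 \<le> n" and p: "0 < p" and c: "0 \<le> c" and m1: "0 < m1"
    and lam: "\<And>i. i < p \<Longrightarrow> m1 \<le> lam i \<and> lam i \<le> M1"
    and l: "l \<in> carrier_vec p" and l0: "l \<noteq> 0\<^sub>v p"
  defines "Z \<equiv> (\<lambda>\<omega>. sqrt (real n) * inverse (sqrt (LMN_var c p S l (LMN_mean mu B (nu \<omega>)))) *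
      (l \<bullet> (sample_cov (X \<omega>) *\<^sub>v sample_mean (X \<omega>)) - l \<bullet> (S *\<^sub>v LMN_mean mu B (nu \<omega>))))"
  shows "Z \<in> borel_measurable M"
    and "cmod ((LINT \<omega>|M. iexp (t * Z \<omega>)) - of_real (exp (- (t\<^sup>2) / 2)))
      \<le> (568 * \<bar>t\<bar> ^ 3 + 16 * t ^ 4 + t\<^sup>2) / sqrt (real n - 1)
        + (2 + t\<^sup>2) * (M1 / (m1 * sqrt n) + (sqrt (2 * p) / n + \<bar>p / n - c\<bar>) * (M1\<^sup>2 / m1\<^sup>2) + 1 / sqrt n + 1 / n)"
proof -
  have M: "prob_space M" and mu: "mu \<in> carrier_vec p" and B: "B \<in> carrier_mat p q"
    and Y: "iid_normal_columns M p n mu S Y"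
    and nu: "distributed M (lborel_vec q) nu (\<lambda>x. ennreal (f x))"
    and ind: "prob_space.indep_set M {Y -` A \<inter> space M |A. A \<in> sets (lborel_mat p n)} {nu -` A \<inter> space M |A. A \<in> sets (lborel_vec q)}"
    and X: "\<And>\<omega>. \<omega> \<in> space M \<Longrightarrow> X \<omega> = Y \<omega> + mat p n (\<lambda>(i, j). (B *\<^sub>v nu \<omega>) $ i)"
    using rep by (auto simp: LMN_representation_def)
  interpret prob_space M by (rule M)
  have Ym: "Y \<in> measurable M (lborel_mat p n)" using Y by (simp add: iid_normal_columns_def)
  have num: "nu \<in> measurable M (lborel_vec q)" using nu by (rule distributed_measurable)
  define A where "A i = sqrt (lam i) * (u i \<bullet> l)" for i
  define U where "U v i = sqrt (lam i) * (u i \<bullet> LMN_mean mu B v)" for v i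
  (* Completeness of the eigenvectors excludes that all spectral coefficients of l vanish. *)
  have A0: "\<exists>i<p. A i \<noteq> 0"
  proof (rule ccontr)
    assume "\<not> (\<exists>i<p. A i \<noteq> 0)"
    then have "\<And>i. i < p \<Longrightarrow> u i \<bullet> l = 0" using lam_pos unfolding A_def by (metis less_irrefl mult_eq_0_iff real_sqrt_eq_zero_cancel_iff)
    then have "l \<bullet> unit_vec p r = 0" for r
      by (subst orthonormal_eigensystem_parseval[OF pd es l]) auto
    then have "l $ r = 0" if "r < p" for r
      using scalar_prod_right_unit[OF that, of l] by simp
    then have "l = 0\<^sub>v p" using l by (intro eq_vecI) auto
    with l0 show False by contradiction
  qed
  have model: "gaussian_sample_model p n A lam c m1 M1"
    using n p c m1 lam A0 by unfold_locales auto
  define T where "T v = gaussian_sample_model.T p n A (U v) lam c" for v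
  note defs = gaussian_sample_model.T_def[OF model] gaussian_sample_model.Xv_def[OF model]
    gaussian_sample_model.\<sigma>2_def[OF model] gaussian_sample_model.V0_def[OF model]
    gaussian_sample_model.\<gamma>0_def[OF model] gaussian_sample_model.\<beta>0_def[OF model]
  let ?R = "PiM {..<n} (\<lambda>_. PiM {..<p} (\<lambda>_. borel)) :: (nat \<Rightarrow> nat \<Rightarrow> real) measure"
  let ?Q = "PiM {..<n} (\<lambda>_. gauss_vec p)"
  let ?P = "distr M (lborel_vec q) nu"
  define W where "W \<omega> = contrasts n mu (Y \<omega>)" for \<omega>
  have Wm: "W \<in> measurable M ?R"
    unfolding W_def by (rule measurable_compose[OF Ym measurable_contrasts[OF mu]])
  have Z_eq: "Z \<omega> = T (nu \<omega>) (W \<omega>)" if \<omega>: "\<omega> \<in> space M" for \<omega>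
  proof -
    have y: "Y \<omega> \<in> carrier_mat p n" using measurable_space[OF Ym \<omega>] by (simp add: space_lborel_mat)
    have v: "nu \<omega> \<in> carrier_vec q" using measurable_space[OF num \<omega>] by (simp add: space_lborel_vec)
    have b: "B *\<^sub>v nu \<omega> \<in> carrier_vec p" using B v by simp
    show ?thesis
      using statistic_eq[OF n y mu b l, of c m1 M1] model
      by (simp add: Z_def T_def W_def X[OF \<omega>] LMN_mean_def A_def[abs_def] U_def[abs_def])
  qed
  have entry: "(\<lambda>z. fst z k i) \<in> borel_measurable (?R \<Otimes>\<^sub>M lborel_vec q)" if "k < n" "i < p" for k i
  proof -
    have "(\<lambda>z. fst z k) \<in> measurable (?R \<Otimes>\<^sub>M lborel_vec q) (PiM {..<p} (\<lambda>_. borel))"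
      by (rule measurable_compose[OF measurable_fst]) (use that in \<open>auto intro!: measurable_component_singleton\<close>)
    from measurable_compose[OF this measurable_component_singleton[of i "{..<p}" "\<lambda>_. borel"]] that show ?thesis by simp
  qed
  have Um: "(\<lambda>z. U (snd z) i) \<in> borel_measurable (?R \<Otimes>\<^sub>M lborel_vec q)" if "i < p" for i
    unfolding U_def
    by (intro borel_measurable_times borel_measurable_const measurable_compose[OF measurable_snd measurable_LMN_mean_coord[OF mu B that]])
  have Tm: "(\<lambda>z. T (snd z) (fst z)) \<in> borel_measurable (?R \<Otimes>\<^sub>M lborel_vec q)"
    unfolding T_def defs
    by (intro borel_measurable_times borel_measurable_sum borel_measurable_diff borel_measurable_add borel_measurable_divide borel_measurable_power
        borel_measurable_const measurable_compose[OF _ borel_measurable_sqrt] entry Um) (use n in auto)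
  have pair: "(\<lambda>\<omega>. (W \<omega>, nu \<omega>)) \<in> measurable M (?R \<Otimes>\<^sub>M lborel_vec q)" using Wm num by (rule measurable_Pair)
  have "(\<lambda>\<omega>. T (nu \<omega>) (W \<omega>)) \<in> borel_measurable M"
    using measurable_compose[OF pair Tm] by simp
  then show Zm: "Z \<in> borel_measurable M"
    by (rule measurable_cong[THEN iffD1, rotated]) (simp add: Z_eq)
  have law: "distr M (?R \<Otimes>\<^sub>M lborel_vec q) (\<lambda>\<omega>. (W \<omega>, nu \<omega>)) = ?Q \<Otimes>\<^sub>M ?P"
  proof -
    have "distr M (?R \<Otimes>\<^sub>M lborel_vec q) (\<lambda>\<omega>. (W \<omega>, nu \<omega>)) = distr M ?R W \<Otimes>\<^sub>M ?P"
    proof (rule distr_pair_if_indep_events[OF Wm num])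
      fix E F assume E: "E \<in> sets ?R" and F: "F \<in> sets (lborel_vec q)"
      let ?E = "contrasts n mu -` E \<inter> space (lborel_mat p n)"
      have "W -` E \<inter> space M = Y -` ?E \<inter> space M"
        using measurable_space[OF Ym] by (auto simp: W_def)
      moreover have "?E \<in> sets (lborel_mat p n)"
        using measurable_contrasts[OF mu] E by (rule measurable_sets)
      ultimately have "W -` E \<inter> space M \<in> {Y -` A \<inter> space M |A. A \<in> sets (lborel_mat p n)}"
        by blast
      then show "prob ((W -` E \<inter> space M) \<inter> (nu -` F \<inter> space M)) = prob (W -` E \<inter> space M) * prob (nu -` F \<inter> space M)"
        using F by (intro indep_setD[OF ind]) blast+
    qed
    also have "distr M ?R W = ?Q"
      unfolding W_def by (rule contrasts_law[OF M mu n p Y])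
    finally show ?thesis .
  qed
  interpret Q: prob_space ?Q by (rule prob_space_PiM) (rule prob_space_gauss_vec)
  interpret P: prob_space ?P by (rule prob_space_distr) (rule num)
  interpret QP: pair_prob_space ?Q ?P ..
  have P1: "P.prob (space (lborel_vec q)) = 1" using P.prob_space by simp
  have sets_eq: "sets (?Q \<Otimes>\<^sub>M ?P) = sets (?R \<Otimes>\<^sub>M lborel_vec q)"
    using arg_cong[OF law, of sets] by simp
  have Tm': "(\<lambda>z. T (snd z) (fst z)) \<in> borel_measurable (?Q \<Otimes>\<^sub>M ?P)"
    using Tm measurable_cong_sets[OF sets_eq refl] by blast
  let ?e = "complex_of_real (exp (- (t\<^sup>2) / 2))"
  let ?b = "(568 * \<bar>t\<bar> ^ 3 + 16 * t ^ 4 + t\<^sup>2) / sqrt (real n - 1)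
        + (2 + t\<^sup>2) * (M1 / (m1 * sqrt n) + (sqrt (2 * p) / n + \<bar>p / n - c\<bar>) * (M1\<^sup>2 / m1\<^sup>2) + 1 / sqrt n + 1 / n)"
  have int: "integrable (?Q \<Otimes>\<^sub>M ?P) (\<lambda>(w, v). iexp (t * T v w))"
  proof (rule QP.integrable_const_bound[where B=1])
    have "(\<lambda>z. iexp (t * T (snd z) (fst z))) \<in> borel_measurable (?Q \<Otimes>\<^sub>M ?P)" using Tm' by measurable
    then show "(\<lambda>(w, v). iexp (t * T v w)) \<in> borel_measurable (?Q \<Otimes>\<^sub>M ?P)" by (simp add: case_prod_beta')
  qed auto
  have "(LINT \<omega>|M. iexp (t * Z \<omega>)) = (LINT \<omega>|M. iexp (t * T (nu \<omega>) (W \<omega>)))"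
    by (rule Bochner_Integration.integral_cong) (simp_all add: Z_eq)
  also have "\<dots> = (LINT z|(distr M (?R \<Otimes>\<^sub>M lborel_vec q) (\<lambda>\<omega>. (W \<omega>, nu \<omega>))). iexp (t * T (snd z) (fst z)))"
    using Tm by (subst integral_distr[OF pair]) auto
  also have "\<dots> = (LINT z|(?Q \<Otimes>\<^sub>M ?P). (\<lambda>(w, v). iexp (t * T v w)) z)"
    unfolding law by (simp only: case_prod_beta')
  also have "\<dots> = (LINT v|?P. LINT w|?Q. iexp (t * T v w))"
    using QP.integral_snd[OF int] by simp
  finally have E: "(LINT \<omega>|M. iexp (t * Z \<omega>)) = (LINT v|?P. LINT w|?Q. iexp (t * T v w))" .
  have "(LINT \<omega>|M. iexp (t * Z \<omega>)) - ?e = (LINT v|?P. (LINT w|?Q. iexp (t * T v w)) - ?e)"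
    unfolding E using QP.integrable_snd[OF int] by (simp add: P1)
  also have "cmod \<dots> \<le> (LINT v|?P. cmod ((LINT w|?Q. iexp (t * T v w)) - ?e))"
    by (rule integral_norm_bound)
  also have "\<dots> \<le> (LINT v|?P. ?b)"
  proof (rule integral_mono)
    show "integrable ?P (\<lambda>v. cmod ((LINT w|?Q. iexp (t * T v w)) - ?e))"
      using QP.integrable_snd[OF int] by (intro integrable_norm Bochner_Integration.integrable_diff) auto
    show "cmod ((LINT w|?Q. iexp (t * T v w)) - ?e) \<le> ?b" for v
      using gaussian_sample_model.char_T_bound[OF model, of t "U v"]
      unfolding T_def gaussian_sample_model.err_def[OF model] .
  qed simp
  also have "\<dots> = ?b" by (simp add: P1)
  finally show "cmod ((LINT \<omega>|M. iexp (t * Z \<omega>)) - ?e) \<le> ?b" .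
qed

end

section \<open>Convergence in distribution\<close>

theorem theorem1:
  fixes M :: "nat \<Rightarrow> 'w measure"
    and p :: "nat \<Rightarrow> nat" and q :: nat
    and c m1 M1 M2 :: real
    and mu l :: "nat \<Rightarrow> real vec" and Sig B :: "nat \<Rightarrow> real mat"
    and f :: "real vec \<Rightarrow> real"
    and X Y :: "nat \<Rightarrow> 'w \<Rightarrow> real mat" and nu :: "nat \<Rightarrow> 'w \<Rightarrow> real vec"
    and lam :: "nat \<Rightarrow> nat \<Rightarrow> real" and u :: "nat \<Rightarrow> nat \<Rightarrow> real vec"
  assumes q_pos: "0 < q"
    and p_pos: "\<And>n. 2 \<le> n \<Longrightarrow> 0 < p n"
    and c_nonneg: "0 \<le> c"
    and p_rate: "(\<lambda>n. real (p n) / real n - c) \<in> o(\<lambda>n. real n powr (- 1 / 2))"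
    and mu_dim: "\<And>d. 0 < d \<Longrightarrow> mu d \<in> carrier_vec d"
    and B_dim: "\<And>d. 0 < d \<Longrightarrow> B d \<in> carrier_mat d q"
    and Sigma_pd: "\<And>d. 0 < d \<Longrightarrow> pos_def_mat d (Sig d)"
    and l_dim: "\<And>d. 0 < d \<Longrightarrow> l d \<in> carrier_vec d"
    and l_nonzero: "\<And>d. 0 < d \<Longrightarrow> l d \<noteq> 0\<^sub>v d"
    and LMN: "\<And>n. 2 \<le> n \<Longrightarrow>
      LMN_representation (M n) (p n) n q (mu (p n)) (Sig (p n)) (B (p n)) f (X n) (Y n) (nu n)"
    and eigen: "\<And>d. 0 < d \<Longrightarrow> orthonormal_eigensystem d (Sig d) (lam d) (u d)"
    and m1_pos: "0 < m1"
    and lam_mono: "\<And>d i j. i \<le> j \<Longrightarrow> j < d \<Longrightarrow> lam d i \<le> lam d j"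
    and lam_bounds: "\<And>d i. i < d \<Longrightarrow> m1 \<le> lam d i \<and> lam d i \<le> M1"
    and mu_bound: "\<And>d i. i < d \<Longrightarrow> \<bar>u d i \<bullet> mu d\<bar> \<le> M2"
    and B_bound: "\<And>d i j. i < d \<Longrightarrow> j < q \<Longrightarrow> \<bar>u d i \<bullet> col (B d) j\<bar> \<le> M2"
    and l_bound: "\<And>d i. i < d \<Longrightarrow> \<bar>u d i \<bullet> l d\<bar> \<le> M2"
  shows "weak_conv_m
    (\<lambda>n. distr (M n) borel (\<lambda>\<omega>.
       let mu_nu = LMN_mean (mu (p n)) (B (p n)) (nu n \<omega>);
           sigma_nu = sqrt (LMN_var c (p n) (Sig (p n)) (l (p n)) mu_nu)
       in sqrt (real n) * inverse sigma_nu *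
            (l (p n) \<bullet> (sample_cov (X n \<omega>) *\<^sub>v sample_mean (X n \<omega>))
             - l (p n) \<bullet> (Sig (p n) *\<^sub>v mu_nu))))
    std_normal_distribution"
proof -
  define Z where "Z n \<omega> = (let mu_nu = LMN_mean (mu (p n)) (B (p n)) (nu n \<omega>);
           sigma_nu = sqrt (LMN_var c (p n) (Sig (p n)) (l (p n)) mu_nu)
       in sqrt (real n) * inverse sigma_nu *
            (l (p n) \<bullet> (sample_cov (X n \<omega>) *\<^sub>v sample_mean (X n \<omega>))
             - l (p n) \<bullet> (Sig (p n) *\<^sub>v mu_nu)))" for n \<omega>
  define \<mu> where "\<mu> n = distr (M n) borel (Z n)" for n
  define e where "e t n = (568 * \<bar>t\<bar> ^ 3 + 16 * t ^ 4 + t\<^sup>2) / sqrt (real n - 1)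
        + (2 + t\<^sup>2) * (M1 / (m1 * sqrt n) + (sqrt (2 * p n) / n + \<bar>p n / n - c\<bar>) * (M1\<^sup>2 / m1\<^sup>2) + 1 / sqrt n + 1 / n)"
    for t :: real and n :: nat
  have bound: "Z n \<in> borel_measurable (M n)"
    "cmod ((LINT \<omega>|M n. iexp (t * Z n \<omega>)) - of_real (exp (- (t\<^sup>2) / 2))) \<le> e t n" if n: "2 \<le> n" for n t
  proof -
    have p: "0 < p n" by (rule p_pos[OF n])
    interpret eigen_covariance "p n" "Sig (p n)" "lam (p n)" "u (p n)"
      using Sigma_pd[OF p] eigen[OF p] lam_bounds[of _ "p n"] m1_pos by unfold_locales (auto intro: less_le_trans)
    note * = LMN_statistic_char_bound[OF LMN[OF n] n p c_nonneg m1_pos lam_bounds l_dim[OF p] l_nonzero[OF p]]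
    from *(1) show "Z n \<in> borel_measurable (M n)"
      by (simp add: Z_def[abs_def] Let_def)
    from *(2)[of t] show "cmod ((LINT \<omega>|M n. iexp (t * Z n \<omega>)) - of_real (exp (- (t\<^sup>2) / 2))) \<le> e t n"
      unfolding Z_def[abs_def] Let_def e_def .
  qed
  have ratio: "(\<lambda>n. real (p n) / real n) \<longlonglongrightarrow> c"
  proof -
    have "(\<lambda>n. (real (p n) / real n - c) / real n powr (- 1 / 2)) \<longlonglongrightarrow> 0"
      using p_rate by (rule smalloD_tendsto)
    moreover have "(\<lambda>n. real n powr (- 1 / 2)) \<longlonglongrightarrow> 0" by real_asymp
    ultimately have "(\<lambda>n. (real (p n) / real n - c) / real n powr (- 1 / 2) * real n powr (- 1 / 2)) \<longlonglongrightarrow> 0 * 0"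
      by (rule tendsto_mult)
    then have prod: "(\<lambda>n. (real (p n) / real n - c) / real n powr (- 1 / 2) * real n powr (- 1 / 2)) \<longlonglongrightarrow> 0" by simp
    have "(\<lambda>n. real (p n) / real n - c) \<longlonglongrightarrow> 0"
    proof (rule Lim_transform_eventually[where l="0::real" and f="\<lambda>n. (real (p n) / real n - c) / real n powr (- 1 / 2) * real n powr (- 1 / 2)"])
      show "\<forall>\<^sub>F n in sequentially. (real (p n) / real n - c) / real n powr (- 1 / 2) * real n powr (- 1 / 2) = real (p n) / real n - c"
        using eventually_gt_at_top[of 0] by eventually_elim simp
    qed (rule prod)
    then show ?thesis by (simp add: LIM_zero_iff)
  qed
  have e_lim: "e t \<longlonglongrightarrow> 0" for t
  proof -
    have "(\<lambda>n. (568 * \<bar>t\<bar> ^ 3 + 16 * t ^ 4 + t\<^sup>2) / sqrt (real n - 1)) \<longlonglongrightarrow> 0"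
      by (rule tendsto_divide_0[OF tendsto_const]) real_asymp
    moreover have "(\<lambda>n. M1 / (m1 * sqrt (real n))) \<longlonglongrightarrow> 0"
    proof -
      have "(\<lambda>n. M1 / m1 * (1 / sqrt (real n))) \<longlonglongrightarrow> M1 / m1 * 0"
        by (intro tendsto_intros) real_asymp
      then show ?thesis by simp
    qed
    moreover have "(\<lambda>n. sqrt (real (2 * p n)) / real n) \<longlonglongrightarrow> 0"
    proof -
      have "(\<lambda>n. sqrt (2 * (real (p n) / real n) * (1 / real n))) \<longlonglongrightarrow> sqrt (2 * c * 0)"
        by (intro tendsto_real_sqrt tendsto_mult tendsto_const ratio) real_asymp
      moreover have "sqrt (2 * (real (p n) / real n) * (1 / real n)) = sqrt (2 * real (p n)) / real n" for n
      proof -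
        have "2 * (real (p n) / real n) * (1 / real n) = 2 * real (p n) / (real n)\<^sup>2" by (simp add: power2_eq_square)
        then show ?thesis by (simp only: real_sqrt_divide real_sqrt_abs abs_of_nat)
      qed
      ultimately show ?thesis by simp
    qed
    moreover have "(\<lambda>n. \<bar>real (p n) / real n - c\<bar>) \<longlonglongrightarrow> 0"
      using ratio by (simp add: tendsto_rabs_zero_iff LIM_zero_iff)
    moreover have "(\<lambda>n. 1 / sqrt (real n)) \<longlonglongrightarrow> 0" "(\<lambda>n. 1 / real n) \<longlonglongrightarrow> 0" by real_asymp+
    ultimately have "e t \<longlonglongrightarrow> 0 + (2 + t\<^sup>2) * (0 + (0 + 0) * (M1\<^sup>2 / m1\<^sup>2) + 0 + 0)"
      unfolding e_def[abs_def] by (intro tendsto_add tendsto_mult tendsto_const)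
    then show ?thesis by simp
  qed
  (* The hypotheses on the sample concern sizes n \<ge> 2 only, so the sequence is shifted by 2. *)
  have "weak_conv_m (\<lambda>n. \<mu> (n + 2)) std_normal_distribution"
  proof (rule levy_continuity)
    show "real_distribution (\<mu> (n + 2))" for n
    proof -
      have "prob_space (M (n + 2))" using LMN[of "n + 2"] by (simp add: LMN_representation_def)
      then show ?thesis
        unfolding \<mu>_def using bound(1)[of "n + 2"] by (intro prob_space.real_distribution_distr) auto
    qed
    show "real_distribution std_normal_distribution" by (rule real_dist_normal_dist)
    fix t
    have "(\<lambda>n. char (\<mu> (n + 2)) t - char std_normal_distribution t) \<longlonglongrightarrow> 0"
    proof (rule Lim_null_comparison)
      show "\<forall>\<^sub>F n in sequentially. cmod (char (\<mu> (n + 2)) t - char std_normal_distribution t) \<le> e t (n + 2)"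
      proof (intro always_eventually allI)
        fix n :: nat
        have "char (\<mu> (n + 2)) t = (LINT \<omega>|M (n + 2). iexp (t * Z (n + 2) \<omega>))"
          unfolding \<mu>_def char_def using bound(1)[of "n + 2"] by (subst integral_distr) auto
        then show "cmod (char (\<mu> (n + 2)) t - char std_normal_distribution t) \<le> e t (n + 2)"
          using bound(2)[OF le_add2, of n t] by (simp only: char_std_normal_distribution)
      qed
      show "(\<lambda>n. e t (n + 2)) \<longlonglongrightarrow> 0" by (rule LIMSEQ_ignore_initial_segment[OF e_lim])
    qed
    then show "(\<lambda>n. char (\<mu> (n + 2)) t) \<longlonglongrightarrow> char std_normal_distribution t"
      by (simp add: LIM_zero_iff)
  qed
  then have "weak_conv_m \<mu> std_normal_distribution"
    unfolding weak_conv_m_def weak_conv_def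
  proof (intro allI impI)
    fix x assume lim: "\<forall>x. isCont (cdf std_normal_distribution) x \<longrightarrow> (\<lambda>n. cdf (\<mu> (n + 2)) x) \<longlonglongrightarrow> cdf std_normal_distribution x"
      and "isCont (cdf std_normal_distribution) x"
    then have "(\<lambda>n. cdf (\<mu> (n + 2)) x) \<longlonglongrightarrow> cdf std_normal_distribution x" by blast
    then show "(\<lambda>n. cdf (\<mu> n) x) \<longlonglongrightarrow> cdf std_normal_distribution x" by (rule LIMSEQ_offset)
  qed
  then show ?thesis
    unfolding \<mu>_def[abs_def] Z_def[abs_def] .
qed

end
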